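(* Let $s,t>0$ satisfy $s+t>1$, let $u\in(\Sigma_t^s)'(\mathbf R^d)$ and let $z_0\in T^*\mathbf R^d\setminus0$. Suppose $\psi\in\Sigma_t^s(\mathbf R^d)\setminus\{0\}$ and $U\subseteq T^*\mathbf R^d\setminus0$ is an open set containing $z_0$ such that $$\sup_{\lambda>0,\,(x,\xi)\in U}e^{r\lambda}|V_\psi u(\lambda^tx,\lambda^s\xi)|<\infty\quad\forall r>0.$$ If $\varphi\in\Sigma_t^s(\mathbf R^d)\setminus\{0\}$, then there exists an open set $V\subseteq U$ such that $z_0\in V$ and $$\sup_{\lambda>0,\,(x,\xi)\in V}e^{r\lambda}|V_\varphi u(\lambda^tx,\lambda^s\xi)|<\infty\quad\forall r>0.$$
   Context: Notation: $\mathbf N=\{0,1,2,\dots\}$, $D^\beta=(-i)^{|\beta|}\partial^\beta$, $T^*\mathbf R^d\simeq\mathbf R^{2d}$. For $s,t>0$ with $s+t>1$, the (Beurling type) Gelfand--Shilov space $\Sigma_t^s(\mathbf R^d)$ consists of all $f\in C^\infty(\mathbf R^d)$ such that for every $h>0$ $$\|f\|_{\mathcal S_{t,h}^s}=\sup_{\alpha,\beta\in\mathbf N^d,\,x\in\mathbf R^d}\frac{|x^\alpha D^\beta f(x)|}{h^{|\alpha+\beta|}\alpha!^t\beta!^s}<\infty,$$ with the Fréchet topology given by these seminorms. $(\Sigma_t^s)'(\mathbf R^d)$ is its topological dual; the action $(u,\varphi)$ is conjugate linear in $\varphi$ and consistent with the $L^2$ inner product. Short-time Fourier transform: with $T_xf(y)=f(y-x)$,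 $M_\xi f(y)=e^{i\langle y,\xi\rangle}f(y)$, set $V_\psi u(x,\xi)=(2\pi)^{-d/2}(u,M_\xi T_x\psi)$, $x,\xi\in\mathbf R^d$. *)

theory Defs
  imports "HOL-Analysis.Analysis"
begin

text \<open>
  Functions on \<open>\<real>\<^sup>d\<close> are modelled as \<^typ>\<open>real ^ 'd \<Rightarrow> complex\<close> with \<open>d = CARD('d)\<close>, multi-indices
  in \<open>\<nat>\<^sup>d\<close> as \<^typ>\<open>nat ^ 'd\<close>, and \<open>T\<^sup>*\<real>\<^sup>d\<close> as \<^typ>\<open>(real ^ 'd) \<times> (real ^ 'd)\<close>.
\<close>

definition mi_abs :: "nat ^ 'd \<Rightarrow> nat" where
  "mi_abs \<alpha> = (\<Sum>i\<in>UNIV. \<alpha> $ i)"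

definition mi_fact :: "nat ^ 'd \<Rightarrow> real" where
  "mi_fact \<alpha> = (\<Prod>i\<in>UNIV. fact (\<alpha> $ i))"

definition mi_power :: "real ^ 'd \<Rightarrow> nat ^ 'd \<Rightarrow> real" where
  "mi_power x \<alpha> = (\<Prod>i\<in>UNIV. (x $ i) ^ (\<alpha> $ i))"

definition partial :: "'d \<Rightarrow> (real ^ 'd \<Rightarrow> complex) \<Rightarrow> real ^ 'd \<Rightarrow> complex" where
  "partial i f x = vector_derivative (\<lambda>t. f (x + t *\<^sub>R axis i 1)) (at 0)"

definition partials :: "'d list \<Rightarrow> (real ^ 'd \<Rightarrow> complex) \<Rightarrow> real ^ 'd \<Rightarrow> complex" where
  "partials is f = foldr partial is f"

text \<open>\<open>C\<^sup>\<infinity>\<close>: the iterated partial derivatives of all orders exist and are continuous.\<close>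

definition smooth :: "(real ^ 'd \<Rightarrow> complex) \<Rightarrow> bool" where
  "smooth f \<longleftrightarrow>
     (\<forall>is. continuous_on UNIV (partials is f) \<and>
       (\<forall>i x. (\<lambda>t. partials is f (x + t *\<^sub>R axis i 1)) differentiable (at 0)))"

lemma multi_index_list_exists:
  fixes \<beta> :: "nat ^ 'd"
  shows "\<exists>is. \<forall>i. count_list is i = \<beta> $ i"
proof -
  have "\<exists>is. \<forall>i. count_list is i = (if i \<in> S then \<beta> $ i else 0)" if "finite S" for S :: "'d set"
    using that
  proof (induction S)
    case empty
    then show ?case by (auto intro: exI[of _ "[]"])
  next
    case (insert j S)
    then obtain xs where xs: "\<And>i. count_list xs i = (if i \<in> S then \<beta> $ i else 0)"
      by blast
    have rep: "count_list (replicate n j) i = (if i = j then n else 0)" for n i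
      by (induction n) auto
    show ?case
      using insert.hyps by (intro exI[of _ "replicate (\<beta> $ j) j @ xs"]) (auto simp: xs rep)
  qed
  from this[of UNIV] show ?thesis by simp
qed

text \<open>
  The operator \<open>\<partial>\<^sup>\<beta>\<close> differentiates \<open>\<beta> $ i\<close> times in the \<open>i\<close>-th coordinate. The index type carries
  no order, so the order of differentiation is chosen; it is irrelevant for smooth functions.
\<close>

definition mi_deriv :: "nat ^ 'd \<Rightarrow> (real ^ 'd \<Rightarrow> complex) \<Rightarrow> real ^ 'd \<Rightarrow> complex" where
  "mi_deriv \<beta> f = partials (SOME is. \<forall>i. count_list is i = \<beta> $ i) f"

definition mi_D :: "nat ^ 'd \<Rightarrow> (real ^ 'd \<Rightarrow> complex) \<Rightarrow> real ^ 'd \<Rightarrow> complex" where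
  "mi_D \<beta> f x = (- \<i>) ^ mi_abs \<beta> * mi_deriv \<beta> f x"

definition gs_norm :: "real \<Rightarrow> real \<Rightarrow> real \<Rightarrow> (real ^ 'd \<Rightarrow> complex) \<Rightarrow> ennreal" where
  "gs_norm t s h f =
     (SUP (\<alpha>, \<beta>, x) \<in> UNIV.
        ennreal (cmod (of_real (mi_power x \<alpha>) * mi_D \<beta> f x) /
                 (h ^ mi_abs (\<alpha> + \<beta>) * mi_fact \<alpha> powr t * mi_fact \<beta> powr s)))"

text \<open>The Beurling type space \<open>\<Sigma>\<^sub>t\<^sup>s\<close>; the decay parameter \<open>t\<close> is the first argument.\<close>

definition gelfand_shilov :: "real \<Rightarrow> real \<Rightarrow> (real ^ 'd \<Rightarrow> complex) set" where
  "gelfand_shilov t s = {f. smooth f \<and> (\<forall>h>0. gs_norm t s h f < \<infinity>)}"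

text \<open>The locally convex topology of the seminorms, with the seminorm balls as a subbase.\<close>

definition gs_ball ::
  "real \<Rightarrow> real \<Rightarrow> real \<Rightarrow> (real ^ 'd \<Rightarrow> complex) \<Rightarrow> real \<Rightarrow> (real ^ 'd \<Rightarrow> complex) set" where
  "gs_ball t s h f \<epsilon> =
     {g \<in> gelfand_shilov t s. gs_norm t s h (\<lambda>x. g x - f x) < ennreal \<epsilon>}"

definition gs_topology :: "real \<Rightarrow> real \<Rightarrow> (real ^ 'd \<Rightarrow> complex) topology" where
  "gs_topology t s =
     topology_generated_by {gs_ball t s h f \<epsilon> |h f \<epsilon>. h > 0 \<and> f \<in> gelfand_shilov t s \<and> \<epsilon> > 0}"

text \<open>
  Elements of the topological dual are continuous linear functionals on \<open>\<Sigma>\<^sub>t\<^sup>s\<close>; their values off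
  \<open>\<Sigma>\<^sub>t\<^sup>s\<close> are irrelevant. A function \<open>g\<close> acts as \<open>f \<mapsto> \<integral> g f\<close>, so that the action \<open>(u, \<phi>)\<close>
  extending the \<open>L\<^sup>2\<close> inner product, conjugate linear in \<open>\<phi>\<close>, is \<open>u\<close> applied to the
  complex conjugate of \<open>\<phi>\<close>.
\<close>

definition gs_dual :: "real \<Rightarrow> real \<Rightarrow> ((real ^ 'd \<Rightarrow> complex) \<Rightarrow> complex) set" where
  "gs_dual t s =
     {u. (\<forall>f\<in>gelfand_shilov t s. \<forall>g\<in>gelfand_shilov t s. u (\<lambda>x. f x + g x) = u f + u g) \<and>
         (\<forall>c. \<forall>f\<in>gelfand_shilov t s. u (\<lambda>x. c * f x) = c * u f) \<and>
         continuous_map (gs_topology t s) euclidean u}"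

definition pairing ::
  "((real ^ 'd \<Rightarrow> complex) \<Rightarrow> complex) \<Rightarrow> (real ^ 'd \<Rightarrow> complex) \<Rightarrow> complex" where
  "pairing u \<phi> = u (\<lambda>x. cnj (\<phi> x))"

definition translate :: "real ^ 'd \<Rightarrow> (real ^ 'd \<Rightarrow> complex) \<Rightarrow> real ^ 'd \<Rightarrow> complex" where
  "translate x f y = f (y - x)"

definition modulate :: "real ^ 'd \<Rightarrow> (real ^ 'd \<Rightarrow> complex) \<Rightarrow> real ^ 'd \<Rightarrow> complex" where
  "modulate \<xi> f y = exp (\<i> * of_real (y \<bullet> \<xi>)) * f y"

definition stft ::
  "(real ^ 'd \<Rightarrow> complex) \<Rightarrow> ((real ^ 'd \<Rightarrow> complex) \<Rightarrow> complex) \<Rightarrow>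
     (real ^ 'd) \<times> (real ^ 'd) \<Rightarrow> complex" where
  "stft \<psi> u = (\<lambda>(x, \<xi>).
     of_real ((2 * pi) powr (- (real CARD('d) / 2))) * pairing u (modulate \<xi> (translate x \<psi>)))"

end

theory Submission
  imports Defs "HOL-Probability.Characteristic_Functions" "HOL-Probability.Sinc_Integral"
begin

text \<open>
  With \<open>f\<close> and \<open>g\<close> the complex conjugates of \<open>\<phi>\<close> and \<open>\<psi>\<close>, and \<open>\<pi> (y, \<eta>)\<close> the time-frequency
  shift \<open>\<pi> (y, \<eta>) g x = e\<^sup>-\<^sup>i\<^sup>x\<^sup>\<eta> g (x - y)\<close>, the transform with window \<open>\<psi>\<close> is \<open>z \<mapsto> u (\<pi> z g)\<close> up to a
  constant. Fourier inversion gives \<open>f = c \<integral> A z \<cdot> \<pi> z g dz\<close>, where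
  \<open>A (y, \<eta>) = \<integral> f x \<cdot> cnj (g (x - y)) e\<^sup>i\<^sup>x\<^sup>\<eta> dx\<close> decays like
  \<open>exp (- \<rho> (|y|\<^sup>1\<^sup>/\<^sup>t + |\<eta>|\<^sup>1\<^sup>/\<^sup>s))\<close> for every \<open>\<rho>\<close>. All derivatives of \<open>f\<close> are recovered in the same
  way, so Riemann sums of the integral converge in every seminorm and \<open>u\<close> may be applied under the
  integral sign: \<open>|u (\<pi> z\<^sub>0 f)| \<le> c \<integral> |A z| |u (\<pi> (z\<^sub>0 + z) g)| dz\<close>. At
  \<open>z\<^sub>0 = (\<lambda>\<^sup>t x, \<lambda>\<^sup>s \<xi>)\<close> the points \<open>z\<close> with \<open>|y| < \<epsilon> \<lambda>\<^sup>t\<close> and \<open>|\<eta>| < \<epsilon> \<lambda>\<^sup>s\<close> are controlled by the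
  hypothesis, and at all others the decay of \<open>A\<close> beats the growth
  \<open>exp (R (|y|\<^sup>1\<^sup>/\<^sup>t + |\<eta>|\<^sup>1\<^sup>/\<^sup>s))\<close> of \<open>u (\<pi> (y, \<eta>) g)\<close>.
\<close>

section \<open>Partial derivatives of smooth functions\<close>

text \<open>The Beurling condition drives the estimates: every bound holds for all \<open>h\<close>
  and \<open>r\<close>, so each loss (a factor 2 in \<open>h\<close> from the product rule, a
  constant factor in the decay rate from the quasi-triangle inequality of the weights, the growth
  rate \<open>R\<close> of \<open>u\<close>) is repaid by starting from a better pair. The seminorms
  are therefore traded for bounds \<open>gs_bound\<close> with exponential weights, on which
  translations, modulations and products act transparently. The obstacle is the passage of
  \<open>u\<close> under the integral: \<open>u\<close> is controlled by a single bound, but one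
  that involves derivatives of all orders and all \<open>x\<close> at once, so the Riemann sums must
  converge uniformly in both. The neighbourhood is chosen before \<open>r\<close>: \<open>V\<close>
  is a ball of half the radius of one inside \<open>U\<close>, and only the constants, including the
  decay rate asked of \<open>A\<close>, depend on \<open>r\<close>.\<close>

definition has_partial ::
  "'d::finite \<Rightarrow> (real ^ 'd \<Rightarrow> complex) \<Rightarrow> (real ^ 'd \<Rightarrow> complex) \<Rightarrow> bool" where
  "has_partial i f f' \<longleftrightarrow>
     (\<forall>x. ((\<lambda>t. f (x + t *\<^sub>R axis i 1)) has_vector_derivative f' x) (at 0))"

lemma has_partial_imp_partial: "has_partial i f f' \<Longrightarrow> partial i f = f'"
  by (auto simp: has_partial_def partial_def intro!: ext vector_derivative_at)

lemma has_partial_imp_differentiable: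
  "has_partial i f f' \<Longrightarrow> (\<lambda>t. f (x + t *\<^sub>R axis i 1)) differentiable (at 0)"
  by (auto simp: has_partial_def intro: differentiableI_vector)

lemma has_partial_along:
  assumes "has_partial i f f'"
  shows "((\<lambda>t. f (x + t *\<^sub>R axis i 1)) has_vector_derivative f' (x + t *\<^sub>R axis i 1)) (at t)"
proof -
  have 1: "((\<lambda>r. r - t) has_vector_derivative 1) (at t)"
    by (auto intro!: derivative_eq_intros)
  have 2: "((\<lambda>r. f ((x + t *\<^sub>R axis i 1) + r *\<^sub>R axis i 1)) has_vector_derivative
      f' (x + t *\<^sub>R axis i 1)) (at (t - t))"
    using assms by (simp add: has_partial_def)
  show ?thesis
    using vector_diff_chain_at[OF 1 2] by (simp add: o_def algebra_simps)
qed

lemma has_partial_add: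
  "has_partial i f f' \<Longrightarrow> has_partial i g g' \<Longrightarrow> has_partial i (\<lambda>x. f x + g x) (\<lambda>x. f' x + g' x)"
  by (auto simp: has_partial_def intro: has_vector_derivative_add)

lemma has_partial_mult:
  assumes "has_partial i f f'" "has_partial i g g'"
  shows "has_partial i (\<lambda>x. f x * g x) (\<lambda>x. f' x * g x + f x * g' x)"
  unfolding has_partial_def
proof
  fix x
  show "((\<lambda>t. f (x + t *\<^sub>R axis i 1) * g (x + t *\<^sub>R axis i 1)) has_vector_derivative
      f' x * g x + f x * g' x) (at 0)"
    using has_vector_derivative_mult[of "\<lambda>t. f (x + t *\<^sub>R axis i 1)" "f' x" 0 UNIV
        "\<lambda>t. g (x + t *\<^sub>R axis i 1)" "g' x"] assms
    by (simp add: has_partial_def add.commute)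
qed

lemma has_partial_const: "has_partial i (\<lambda>x. c) (\<lambda>x. 0)"
  by (simp add: has_partial_def)

lemma has_partial_cnj:
  "has_partial i f f' \<Longrightarrow> has_partial i (\<lambda>x. cnj (f x)) (\<lambda>x. cnj (f' x))"
  by (simp add: has_partial_def has_vector_derivative_cnj)

lemma has_partial_translate:
  assumes "has_partial i f f'"
  shows "has_partial i (translate y f) (translate y f')"
  unfolding has_partial_def translate_def
proof
  fix x
  show "((\<lambda>t. f (x + t *\<^sub>R axis i 1 - y)) has_vector_derivative f' (x - y)) (at 0)"
    using assms unfolding has_partial_def
    by (auto simp: algebra_simps dest!: spec[of _ "x - y"])
qed

definition character :: "real ^ 'd \<Rightarrow> real ^ 'd \<Rightarrow> complex" where
  "character \<xi> x = exp (\<i> * of_real (x \<bullet> \<xi>))"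

lemma norm_character [simp]: "cmod (character \<xi> x) = 1"
  by (simp add: character_def)

lemma continuous_character [continuous_intros]:
  "continuous_on S f \<Longrightarrow> continuous_on S g \<Longrightarrow> continuous_on S (\<lambda>z. character (f z) (g z))"
  unfolding character_def by (intro continuous_intros)

lemma has_partial_character:
  fixes \<xi> :: "real ^ 'd"
  shows "has_partial i (character \<xi>) (\<lambda>x. (\<i> * of_real (\<xi> $ i)) * character \<xi> x)"
  unfolding has_partial_def
proof
  fix x :: "real ^ 'd"
  have eq: "(\<lambda>t. character \<xi> (x + t *\<^sub>R axis i 1)) =
      (\<lambda>t. character \<xi> x * exp (of_real t * (\<i> * of_real (\<xi> $ i))))"
    by (auto simp: character_def inner_add_left inner_axis' exp_add [symmetric] algebra_simps)
  have "((\<lambda>t::real. exp (of_real t * (\<i> * of_real (\<xi> $ i)))) has_vector_derivative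
      \<i> * of_real (\<xi> $ i)) (at 0)"
  proof -
    have "((\<lambda>z. exp (z * (\<i> * of_real (\<xi> $ i)))) has_field_derivative
      \<i> * of_real (\<xi> $ i)) (at (of_real 0))"
      by (auto intro!: derivative_eq_intros)
    from has_vector_derivative_real_field[OF this] show ?thesis by simp
  qed
  then have "((\<lambda>t::real. character \<xi> x * exp (of_real t * (\<i> * of_real (\<xi> $ i))))
      has_vector_derivative character \<xi> x * (\<i> * of_real (\<xi> $ i))) (at 0)"
    by (intro has_vector_derivative_mult_right)
  then show "((\<lambda>t. character \<xi> (x + t *\<^sub>R axis i 1)) has_vector_derivative
      (\<i> * of_real (\<xi> $ i)) * character \<xi> x) (at 0)"
    by (subst eq) (simp add: mult.commute)
qed

lemma partials_Nil [simp]: "partials [] f = f"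
  by (simp add: partials_def)

lemma partials_Cons: "partials (i # is) f = partial i (partials is f)"
  by (simp add: partials_def)

lemma partials_append: "partials (is @ js) f = partials is (partials js f)"
  by (simp add: partials_def)

lemma smooth_has_partials:
  assumes "smooth f"
  shows "has_partial i (partials is f) (partials (i # is) f)"
  using assms by (simp add: smooth_def has_partial_def partials_Cons partial_def
      vector_derivative_works[symmetric])

lemma smooth_has_partial: "smooth f \<Longrightarrow> has_partial i f (partial i f)"
  using smooth_has_partials[of f i "[]"] by (simp add: partials_Cons)

lemma smooth_continuous_partials: "smooth f \<Longrightarrow> continuous_on S (partials is f)"
  by (auto simp: smooth_def intro: continuous_on_subset)

lemma smooth_continuous: "smooth f \<Longrightarrow> continuous_on S f"
  using smooth_continuous_partials[of f S "[]"] by simp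

lemma smooth_partials: "smooth f \<Longrightarrow> smooth (partials is f)"
  by (simp add: smooth_def flip: partials_append)

lemma smooth_partial: "smooth f \<Longrightarrow> smooth (partial i f)"
  using smooth_partials[of f "[i]"] by (simp add: partials_Cons)

text \<open>A set closed under partial derivatives contains all iterated ones, so smoothness follows
  without any formula for them. The closure properties below only have to exhibit such a
  set.\<close>

lemma smooth_coinduct:
  assumes f: "f \<in> S"
    and cont: "\<And>g. g \<in> S \<Longrightarrow> continuous_on UNIV g"
    and part: "\<And>g i. g \<in> S \<Longrightarrow> \<exists>g'\<in>S. has_partial i g g'"
  shows "smooth f"
proof -
  have "partials is f \<in> S" for "is"
  proof (induction "is")
    case (Cons i "is")
    then show ?case
      using part[of "partials is f" i] has_partial_imp_partial by (fastforce simp: partials_Cons)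
  qed (simp add: f)
  then show ?thesis
    unfolding smooth_def using cont part has_partial_imp_differentiable by metis
qed

text \<open>The derivative of a product is a sum of products. Closing under both operations gives a
  set stable under differentiation, as \<open>smooth_coinduct\<close> demands.\<close>

inductive_set smooth_algebra :: "(real ^ 'd \<Rightarrow> complex) set" where
  base: "smooth f \<Longrightarrow> f \<in> smooth_algebra"
| add: "f \<in> smooth_algebra \<Longrightarrow> g \<in> smooth_algebra \<Longrightarrow> (\<lambda>x. f x + g x) \<in> smooth_algebra"
| mult: "f \<in> smooth_algebra \<Longrightarrow> g \<in> smooth_algebra \<Longrightarrow> (\<lambda>x. f x * g x) \<in> smooth_algebra"

lemma smooth_algebra_smooth:
  assumes "f \<in> smooth_algebra"
  shows "smooth f"
proof (rule smooth_coinduct[OF assms])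
  show "continuous_on UNIV g" if "g \<in> smooth_algebra" for g :: "real ^ 'd \<Rightarrow> complex"
    using that by induction (auto intro: smooth_continuous continuous_on_add continuous_on_mult)
  show "\<exists>g'\<in>smooth_algebra. has_partial i g g'" if "g \<in> smooth_algebra"
    for g :: "real ^ 'd \<Rightarrow> complex" and i
    using that
  proof induction
    case (base f)
    then show ?case
      by (intro bexI[of _ "partial i f"] smooth_algebra.base smooth_has_partial smooth_partial)
  next
    case (add f g)
    then obtain f' g' where "f' \<in> smooth_algebra" "has_partial i f f'"
      "g' \<in> smooth_algebra" "has_partial i g g'" by blast
    then show ?case
      by (intro bexI[of _ "\<lambda>x. f' x + g' x"] has_partial_add smooth_algebra.add)
  next
    case (mult f g)
    then obtain f' g' where *: "f' \<in> smooth_algebra" "has_partial i f f'"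
      "g' \<in> smooth_algebra" "has_partial i g g'" by blast
    have "(\<lambda>x. f' x * g x + f x * g' x) \<in> smooth_algebra"
      using * mult by (intro smooth_algebra.add smooth_algebra.mult)
    with has_partial_mult[OF *(2) *(4)] show ?case
      by (rule bexI)
  qed
qed

lemma smooth_add: "smooth f \<Longrightarrow> smooth g \<Longrightarrow> smooth (\<lambda>x. f x + g x)"
  by (rule smooth_algebra_smooth[OF smooth_algebra.add[OF smooth_algebra.base smooth_algebra.base]])

lemma smooth_mult: "smooth f \<Longrightarrow> smooth g \<Longrightarrow> smooth (\<lambda>x. f x * g x)"
  by (rule smooth_algebra_smooth[OF smooth_algebra.mult[OF smooth_algebra.base smooth_algebra.base]])

lemma smooth_const: "smooth (\<lambda>x. c)"
  by (rule smooth_coinduct[of _ "range (\<lambda>c x. c)"]) (auto intro: has_partial_const)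

lemma smooth_cmult: "smooth f \<Longrightarrow> smooth (\<lambda>x. c * f x)"
  by (intro smooth_mult smooth_const)

lemma smooth_cnj: "smooth f \<Longrightarrow> smooth (\<lambda>x. cnj (f x))"
proof (rule smooth_coinduct[of _ "{\<lambda>x. cnj (g x) |g. smooth g}"], goal_cases)
  case (2 g)
  then show ?case by (auto intro: continuous_on_cnj smooth_continuous)
next
  case (3 g i)
  then show ?case
    using has_partial_cnj smooth_has_partial smooth_partial by blast
qed auto

lemma smooth_translate: "smooth f \<Longrightarrow> smooth (translate y f)"
proof (rule smooth_coinduct[of _ "{translate y g |g. smooth g}"], goal_cases)
  case (2 g)
  then obtain k where g: "g = translate y k" and k: "smooth k" by auto
  show ?case
    unfolding g translate_def
    by (rule continuous_on_compose2[OF smooth_continuous[OF k, of UNIV]])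
       (auto intro!: continuous_intros)
next
  case (3 g i)
  then show ?case
    using has_partial_translate smooth_has_partial smooth_partial by blast
qed auto

text \<open>Each partial derivative multiplies a character by a constant, so its scalar multiples
  form a stable set.\<close>

lemma smooth_character: "smooth (character \<xi>)"
proof (rule smooth_coinduct[of _ "{\<lambda>x. c * character \<xi> x |c. True}"], goal_cases)
  case 1
  show ?case by (auto intro!: exI[of _ 1])
next
  case (2 g)
  then show ?case by (auto intro!: continuous_intros)
next
  case (3 g i)
  then obtain c where g: "g = (\<lambda>x. c * character \<xi> x)" by auto
  have "has_partial i g (\<lambda>x. (c * (\<i> * of_real (\<xi> $ i))) * character \<xi> x)"
    using has_partial_mult[OF has_partial_const[of i c] has_partial_character[of i \<xi>]]
    by (simp add: g mult.assoc)
  then show ?case by blast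
qed

section \<open>Iterated derivatives of elementary operations\<close>

lemma partials_add:
  assumes "smooth f" "smooth g"
  shows "partials is (\<lambda>x. f x + g x) = (\<lambda>x. partials is f x + partials is g x)"
proof (induction "is")
  case (Cons i "is")
  show ?case
    using has_partial_imp_partial[OF has_partial_add[OF smooth_has_partials smooth_has_partials,
          OF assms]] Cons by (simp add: partials_Cons)
qed simp

lemma partials_cmult:
  assumes "smooth f"
  shows "partials is (\<lambda>x. c * f x) = (\<lambda>x. c * partials is f x)"
proof (induction "is")
  case (Cons i "is")
  show ?case
    using has_partial_imp_partial[OF has_partial_mult[OF has_partial_const smooth_has_partials],
          OF assms] Cons by (simp add: partials_Cons)
qed simp

lemma partials_cnj:
  assumes "smooth f"
  shows "partials is (\<lambda>x. cnj (f x)) = (\<lambda>x. cnj (partials is f x))"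
proof (induction "is")
  case (Cons i "is")
  show ?case
    using has_partial_imp_partial[OF has_partial_cnj[OF smooth_has_partials],
          OF assms] Cons by (simp add: partials_Cons)
qed simp

lemma partials_translate:
  assumes "smooth f"
  shows "partials is (translate y f) = translate y (partials is f)"
proof (induction "is")
  case (Cons i "is")
  show ?case
    using has_partial_imp_partial[OF has_partial_translate[OF smooth_has_partials],
          OF assms] Cons by (simp add: partials_Cons)
qed simp

lemma partial_mult:
  assumes "smooth f" "smooth g"
  shows "partial i (\<lambda>x. f x * g x) = (\<lambda>x. partial i f x * g x + f x * partial i g x)"
  by (intro has_partial_imp_partial has_partial_mult smooth_has_partial assms)

lemma partial_character: "partial i (character \<xi>) = (\<lambda>x. (\<i> * of_real (\<xi> $ i)) * character \<xi> x)"
  by (rule has_partial_imp_partial[OF has_partial_character])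

lemma partials_character:
  "partials is (character \<xi>) = (\<lambda>x. prod_list (map (\<lambda>i. \<i> * of_real (\<xi> $ i)) is) * character \<xi> x)"
proof (induction "is")
  case (Cons i "is")
  have "partial i (partials is (character \<xi>)) =
      (\<lambda>x. prod_list (map (\<lambda>i. \<i> * of_real (\<xi> $ i)) is) * partial i (character \<xi>) x)"
    using partials_cmult[OF smooth_character, of "[i]"] by (simp add: partials_Cons Cons)
  then show ?case
    by (simp add: partials_Cons partial_character mult_ac)
qed simp

section \<open>Symmetry of partial derivatives\<close>

lemma has_vector_derivative_partial_shift:
  assumes "smooth f"
  shows "((\<lambda>r. f (x + r *\<^sub>R axis j 1 + s *\<^sub>R axis i 1)) has_vector_derivative
      partial j f (x + r *\<^sub>R axis j 1 + s *\<^sub>R axis i 1)) (at r)"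
  using has_partial_along[OF smooth_has_partial[OF assms], of "x + s *\<^sub>R axis i 1" j r]
  by (simp add: algebra_simps)

lemma has_integral_partial_segment:
  assumes "smooth f" "0 \<le> s"
  shows "((\<lambda>\<sigma>. partial i f (x + \<sigma> *\<^sub>R axis i 1)) has_integral
      f (x + s *\<^sub>R axis i 1) - f x) {0..s}"
proof -
  have "((\<lambda>\<sigma>. partial i f (x + \<sigma> *\<^sub>R axis i 1)) has_integral
      f (x + s *\<^sub>R axis i 1) - f (x + 0 *\<^sub>R axis i 1)) {0..s}"
    by (rule fundamental_theorem_of_calculus[OF assms(2)])
       (rule has_vector_derivative_at_within[OF has_partial_along[OF smooth_has_partial[OF assms(1)]]])
  then show ?thesis by simp
qed

lemma continuous_smooth_compose:
  assumes "smooth f" "continuous_on S g"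
  shows "continuous_on S (\<lambda>z. f (g z))"
  using continuous_on_compose2[OF smooth_continuous[OF assms(1), of UNIV] assms(2)] by simp

text \<open>
  Clairaut's theorem: differentiate \<open>f (x + s e\<^sub>i) = f x + \<integral>\<^sub>0\<^sup>s \<partial>\<^sub>i f (x + \<sigma> e\<^sub>i) d\<sigma>\<close> in direction
  \<open>j\<close> under the integral sign, and then in \<open>s\<close>.
\<close>

lemma partial_commute:
  assumes f: "smooth f"
  shows "partial i (partial j f) = partial j (partial i f)"
proof
  fix x :: "real ^ 'a"
  let ?I = "\<lambda>r s. integral {0..s} (\<lambda>\<sigma>. partial i f (x + r *\<^sub>R axis j 1 + \<sigma> *\<^sub>R axis i 1))"
  let ?J = "\<lambda>s. integral {0..s} (\<lambda>\<sigma>. partial j (partial i f) (x + \<sigma> *\<^sub>R axis i 1))"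
  have sm: "smooth (partial i f)" "smooth (partial j f)" "smooth (partial j (partial i f))"
    using f by (auto intro: smooth_partial)
  have eq: "partial j f (x + s *\<^sub>R axis i 1) = partial j f x + ?J s" if "0 \<le> s" for s
  proof -
    have "((\<lambda>r. integral (cbox 0 s) (\<lambda>\<sigma>. partial i f (x + r *\<^sub>R axis j 1 + \<sigma> *\<^sub>R axis i 1)))
        has_vector_derivative integral (cbox 0 s)
          (\<lambda>\<sigma>. partial j (partial i f) (x + 0 *\<^sub>R axis j 1 + \<sigma> *\<^sub>R axis i 1))) (at 0 within UNIV)"
      by (rule leibniz_rule_vector_derivative)
         (auto intro!: has_vector_derivative_partial_shift sm integrable_continuous_real
             continuous_smooth_compose continuous_intros simp: split_beta)
    then have "((\<lambda>r. f (x + r *\<^sub>R axis j 1) + ?I r s) has_vector_derivative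
        partial j f x + ?J s) (at 0)"
      using smooth_has_partial[OF f, of j]
      by (intro has_vector_derivative_add) (auto simp: has_partial_def)
    moreover have "f (x + r *\<^sub>R axis j 1) + ?I r s = f (x + r *\<^sub>R axis j 1 + s *\<^sub>R axis i 1)" for r
      using integral_unique[OF has_integral_partial_segment[OF f that, of i]] by simp
    ultimately have "((\<lambda>r. f (x + r *\<^sub>R axis j 1 + s *\<^sub>R axis i 1)) has_vector_derivative
        partial j f x + ?J s) (at 0)"
      by simp
    then show ?thesis
      using vector_derivative_unique_at has_vector_derivative_partial_shift[OF f, of x j s i 0]
      by fastforce
  qed
  \<comment> \<open>\<open>eq\<close> covers non-negative \<open>s\<close>, so the two derivatives
    at 0 are compared from the right; they agree because 0 is a limit point of the unit
    interval.\<close>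
  have "(?J has_vector_derivative partial j (partial i f) (x + 0 *\<^sub>R axis i 1)) (at 0 within {0..1})"
    by (rule integral_has_vector_derivative)
       (auto intro!: continuous_smooth_compose sm continuous_intros)
  then have "((\<lambda>s. partial j f x + ?J s) has_vector_derivative partial j (partial i f) x)
      (at 0 within {0..1})"
    by (auto intro!: derivative_eq_intros)
  then have 1: "((\<lambda>s. partial j f (x + s *\<^sub>R axis i 1)) has_vector_derivative
      partial j (partial i f) x) (at 0 within {0..1})"
    by (rule has_vector_derivative_transform[rotated 2]) (auto simp: eq)
  have 2: "((\<lambda>s. partial j f (x + s *\<^sub>R axis i 1)) has_vector_derivative
      partial i (partial j f) x) (at 0 within {0..1})"
    using smooth_has_partial[OF sm(2), of i]
    by (auto simp: has_partial_def intro: has_vector_derivative_at_within)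
  have "(0::real) \<in> cbox 0 1" by simp
  from vector_derivative_unique_within[OF _ 2 1]
  show "partial i (partial j f) x = partial j (partial i f) x"
    using trivial_limit_within islimpt_Icc[of 0 1 "0::real"] by (auto simp: trivial_limit_within)
qed

text \<open>By commutation, an occurrence of the head of one list can be moved to the front of the
  other. This makes the arbitrary choice of a list in \<open>mi_deriv\<close> harmless.\<close>

lemma partials_cong_mset:
  assumes f: "smooth f" and "mset is = mset js"
  shows "partials is f = partials js f"
  using assms(2)
proof (induction "is" arbitrary: js)
  case (Cons i "is")
  have move: "partials (js1 @ i # js2) f = partials (i # js1 @ js2) f" for js1 js2
  proof (induction js1)
    case (Cons j js1)
    have "partials ((j # js1) @ i # js2) f = partial j (partial i (partials (js1 @ js2) f))"
      using Cons by (simp add: partials_Cons)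
    also have "\<dots> = partial i (partial j (partials (js1 @ js2) f))"
      by (intro partial_commute smooth_partials f)
    finally show ?case by (simp add: partials_Cons)
  qed simp
  have "i \<in> set js"
    using Cons.prems by (metis list.set_intros(1) mset_eq_setD)
  then obtain js1 js2 where js: "js = js1 @ i # js2"
    by (meson split_list)
  have "partials is f = partials (js1 @ js2) f"
    using Cons.prems by (intro Cons.IH) (simp add: js)
  then show ?case
    by (simp add: js move partials_Cons)
qed simp

text \<open>
  Lists of directions replace multi-indices, so that estimates can be proved by list induction;
  \<open>mfact is\<close> is the multi-index factorial of \<open>list_mi is\<close>.
\<close>

definition list_mi :: "'d::finite list \<Rightarrow> nat ^ 'd" where
  "list_mi is = (\<chi> i. count_list is i)"

lemma mi_deriv_list_mi:
  assumes "smooth f"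
  shows "mi_deriv (list_mi is) f = partials is f"
proof -
  have "\<forall>i. count_list (SOME js. \<forall>i. count_list js i = list_mi is $ i) i = list_mi is $ i"
    by (rule someI_ex) (rule multi_index_list_exists)
  then have "mset (SOME js. \<forall>i. count_list js i = list_mi is $ i) = mset is"
    by (intro multiset_eqI) (simp add: list_mi_def count_mset)
  then show ?thesis
    unfolding mi_deriv_def by (rule partials_cong_mset[OF assms])
qed

lemma list_mi_surj: "\<exists>is. list_mi is = \<beta>"
  using multi_index_list_exists[of \<beta>] by (auto simp: list_mi_def vec_eq_iff)

lemma mi_abs_list_mi: "mi_abs (list_mi is) = length is"
  by (simp add: mi_abs_def list_mi_def sum_count_set)

definition mfact :: "'d::finite list \<Rightarrow> real" where
  "mfact is = (\<Prod>i\<in>UNIV. fact (count_list is i))"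

lemma mi_fact_list_mi: "mi_fact (list_mi is) = mfact is"
  by (simp add: mi_fact_def mfact_def list_mi_def)

lemma cmod_mi_D_list_mi: "smooth f \<Longrightarrow> cmod (mi_D (list_mi is) f x) = cmod (partials is f x)"
  by (simp add: mi_D_def mi_deriv_list_mi norm_mult norm_power)

section \<open>Weighted bounds on derivatives\<close>

text \<open>The exponent \<open>1 / t\<close> matches the factor \<open>fact n powr t\<close> in the
  seminorms: bounds by \<open>h ^ n * fact n powr t\<close> on powers of order \<open>n\<close>, for
  all \<open>h\<close>, amount to decay like \<open>exp (- r * weight t x)\<close> for all
  \<open>r\<close>.\<close>

definition weight :: "real \<Rightarrow> 'a::real_normed_vector \<Rightarrow> real" where
  "weight t x = norm x powr (1 / t)"

lemma weight_nonneg [simp]: "0 \<le> weight t x"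
  by (simp add: weight_def)

lemma weight_minus [simp]: "weight t (- x) = weight t x"
  by (simp add: weight_def)

text \<open>For \<open>t < 1\<close> the exponent exceeds 1 and subadditivity fails. Bounding the
  norm of the sum by twice the larger norm works for every \<open>t\<close>, at the price of a
  constant.\<close>

lemma weight_add:
  assumes "0 < t"
  shows "weight t (x + y) \<le> 2 powr (1 / t) * (weight t x + weight t y)"
proof -
  have *: "weight t (x + y) \<le> 2 powr (1 / t) * weight t z" if "norm (x + y) \<le> 2 * norm z" for z :: 'a
  proof -
    have "weight t (x + y) \<le> (2 * norm z) powr (1 / t)"
      unfolding weight_def using that assms by (intro powr_mono2) auto
    then show ?thesis by (simp add: powr_mult weight_def)
  qed
  have "norm (x + y) \<le> 2 * norm x \<or> norm (x + y) \<le> 2 * norm y"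
    using norm_triangle_ineq[of x y] by linarith
  then show ?thesis
    using *[of x] *[of y] by (auto simp: distrib_left intro: order_trans)
qed

text \<open>The left side divided by \<open>fact n\<close> is a single term of the exponential
  series.\<close>

lemma power_le_fact_exp:
  fixes a :: real
  assumes "0 \<le> a"
  shows "a ^ n \<le> fact n * exp a"
proof -
  have "(\<Sum>k\<in>{n}. a ^ k /\<^sub>R fact k) \<le> (\<Sum>k. a ^ k /\<^sub>R fact k)"
    using assms by (intro sum_le_suminf summable_exp_generic) auto
  then show ?thesis
    by (simp add: exp_def field_simps)
qed

lemma powr_inverse_powr: "0 \<le> y \<Longrightarrow> 0 < t \<Longrightarrow> (y powr (1 / t)) powr t = (y::real)"
  by (cases "y = 0") (auto simp: powr_powr)

lemma power_powr_commute:
  fixes a t :: real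
  assumes "0 \<le> a" "0 < t"
  shows "(a ^ n) powr t = (a powr t) ^ n"
proof (cases "a = 0")
  case True
  then show ?thesis using assms by (cases n) auto
next
  case False
  then have "0 < a" using assms by simp
  then show ?thesis
    by (simp add: powr_realpow[symmetric] powr_powr mult.commute)
qed

text \<open>This is the \<open>t\<close>-th power of \<open>power_le_fact_exp\<close> at
  \<open>a = (y / h) powr (1 / t)\<close>.\<close>

lemma power_le_fact_powr_exp:
  fixes y :: real
  assumes "0 < t" "0 < h" "0 \<le> y"
  shows "y ^ n \<le> h ^ n * fact n powr t * exp (t * (1 / h) powr (1 / t) * y powr (1 / t))"
proof -
  define a where "a = (y / h) powr (1 / t)"
  have a: "0 \<le> a" "a powr t = y / h"
    using assms by (auto simp: a_def powr_inverse_powr)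
  have "(y / h) ^ n = (a ^ n) powr t"
    using a assms by (simp add: power_powr_commute)
  also have "\<dots> \<le> (fact n * exp a) powr t"
    using power_le_fact_exp[OF a(1)] a assms by (intro powr_mono2) auto
  also have "\<dots> = fact n powr t * exp (t * a)"
    by (simp add: powr_mult exp_powr_real mult.commute)
  also have "a = (1 / h) powr (1 / t) * y powr (1 / t)"
    using assms by (simp add: a_def powr_mult [symmetric])
  finally show ?thesis
    using assms by (simp add: field_simps)
qed

text \<open>
  With \<open>b = y\<^sup>1\<^sup>/\<^sup>t\<close> and \<open>\<rho> = r / t\<close>, the \<open>t\<close>-th roots of the hypotheses bound the terms of
  the exponential series of \<open>\<rho> b\<close> by a geometric series.
\<close>

lemma exp_decay_of_power_bounds:
  fixes y A K :: real
  assumes "0 < t" "0 < r" "0 \<le> y" "0 \<le> A"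
    and bound: "\<And>n. A * y ^ n \<le> K * ((t / (2 * r)) powr t) ^ n * fact n powr t"
  shows "A \<le> 2 powr t * K * exp (- r * y powr (1 / t))"
proof (cases "A = 0")
  case True
  then have "0 \<le> K" using bound[of 0] by simp
  then show ?thesis using True by simp
next
  case False
  define B where "B = (A / K) powr (1 / t)"
  define b where "b = y powr (1 / t)"
  define \<rho> where "\<rho> = r / t"
  have K: "0 < K" and A: "0 < A" using bound[of 0] False assms by auto
  have b: "0 \<le> b" and \<rho>: "0 < \<rho>" and B: "0 < B" using assms A K by (auto simp: b_def \<rho>_def B_def)
  have geom: "B * ((\<rho> * b) ^ n / fact n) \<le> (1 / 2) ^ n" for n
  proof -
    have "A / K * y ^ n \<le> ((t / (2 * r)) powr t) ^ n * fact n powr t"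
      using bound[of n] K by (simp add: field_simps)
    then have "(A / K * y ^ n) powr (1 / t) \<le> (((t / (2 * r)) powr t) ^ n * fact n powr t) powr (1 / t)"
      using assms A K by (intro powr_mono2) auto
    moreover have "(A / K * y ^ n) powr (1 / t) = B * b ^ n"
    proof -
      have "(y ^ n) powr (1 / t) = b ^ n"
        unfolding b_def using assms by (simp add: power_powr_commute)
      then show ?thesis by (simp only: B_def powr_mult)
    qed
    moreover have "(((t / (2 * r)) powr t) ^ n * fact n powr t) powr (1 / t) = (t / (2 * r)) ^ n * fact n"
    proof -
      have "((t / (2 * r)) powr t) ^ n = ((t / (2 * r)) ^ n) powr t"
        using assms by (simp add: power_powr_commute)
      then show ?thesis
        using assms by (simp add: powr_mult powr_powr)
    qed
    ultimately have "B * b ^ n \<le> (t / (2 * r)) ^ n * fact n" by simp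
    then have "\<rho> ^ n * (B * b ^ n) \<le> \<rho> ^ n * ((t / (2 * r)) ^ n * fact n)"
      using \<rho> by (intro mult_left_mono) auto
    \<comment> \<open>The 2 in \<open>t / (2 * r)\<close> is there to produce the ratio 1/2. The
      geometric series then sums to 2, whence the constant \<open>2 powr t\<close>.\<close>
    also have "\<rho> ^ n * ((t / (2 * r)) ^ n * fact n) = (1 / 2) ^ n * fact n"
      using assms by (simp add: \<rho>_def power_mult_distrib[symmetric])
    finally show ?thesis by (simp add: power_mult_distrib field_simps)
  qed
  have "(\<lambda>n. B * ((\<rho> * b) ^ n / fact n)) sums (B * exp (\<rho> * b))"
    using exp_converges[of "\<rho> * b"] by (intro sums_mult) (simp add: divide_inverse mult.commute)
  moreover have "(\<lambda>n. (1 / 2 :: real) ^ n) sums 2"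
    using geometric_sums[of "1 / 2 :: real"] by simp
  ultimately have "B * exp (\<rho> * b) \<le> 2"
    by (rule sums_le[OF geom])
  then have "(B * exp (\<rho> * b)) powr t \<le> 2 powr t"
    using B assms by (intro powr_mono2) auto
  moreover have "(B * exp (\<rho> * b)) powr t = A / K * exp (r * b)"
    using assms A K by (simp add: powr_mult B_def powr_inverse_powr exp_powr_real \<rho>_def)
  ultimately have "A / K * exp (r * b) \<le> 2 powr t" by simp
  then show ?thesis
    using K by (simp add: b_def exp_minus field_simps)
qed

lemma mfact_ge_1: "1 \<le> mfact is"
  unfolding mfact_def by (rule prod_ge_1) (simp add: fact_ge_1)

lemma mfact_Nil [simp]: "mfact [] = 1"
  by (simp add: mfact_def)

lemma fact_mult_fact_le: "fact m * fact n \<le> (fact (m + n) :: real)"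
  by (metis (mono_tags, lifting) dvd_imp_le fact_fact_dvd_fact fact_gt_zero of_nat_fact of_nat_le_iff of_nat_mult)

lemma mfact_append: "mfact is * mfact js \<le> mfact (is @ js)"
  unfolding mfact_def prod.distrib[symmetric] by (rule prod_mono) (auto intro: fact_mult_fact_le)

lemma count_list_replicate: "count_list (replicate n j) i = (if i = j then n else 0)"
  by (induction n) auto

lemma mfact_replicate: "mfact (replicate n i) = fact n"
  by (simp add: mfact_def count_list_replicate if_distrib[of fact] prod.delta cong: if_cong)

lemma mi_power_list_mi: "mi_power x (list_mi is) = prod_list (map (($) x) is)"
proof (induction "is")
  case (Cons i "is")
  have "mi_power x (list_mi (i # is)) = (\<Prod>j\<in>UNIV. (if j = i then x $ j else 1) * x $ j ^ count_list is j)"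
    unfolding mi_power_def by (intro prod.cong) (auto simp: list_mi_def)
  also have "\<dots> = x $ i * mi_power x (list_mi is)"
    by (simp add: prod.distrib mi_power_def list_mi_def)
  finally show ?case by (simp add: Cons)
qed (simp add: mi_power_def list_mi_def)

text \<open>The one-variable bound is used in each coordinate. As every coordinate is at most the
  norm, the \<open>CARD('d)\<close> exponentials combine into one, with that factor in the
  exponent.\<close>

lemma abs_mi_power_le:
  fixes x :: "real ^ 'd"
  assumes "0 < t" "0 < h"
  shows "\<bar>mi_power x (list_mi is)\<bar> \<le> h ^ length is * mfact is powr t *
    exp (real CARD('d) * t * (1 / h) powr (1 / t) * weight t x)"
proof -
  let ?c = "t * (1 / h) powr (1 / t)"
  have c: "0 \<le> ?c" using assms by simp
  have "\<bar>mi_power x (list_mi is)\<bar> = (\<Prod>i\<in>UNIV. \<bar>x $ i\<bar> ^ count_list is i)"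
    by (simp add: mi_power_def list_mi_def abs_prod power_abs)
  also have "\<dots> \<le> (\<Prod>i\<in>UNIV. h ^ count_list is i * fact (count_list is i) powr t * exp (?c * weight t x))"
  proof (rule prod_mono, safe)
    fix i :: 'd
    have "\<bar>x $ i\<bar> ^ count_list is i \<le> h ^ count_list is i * fact (count_list is i) powr t * exp (?c * \<bar>x $ i\<bar> powr (1 / t))"
      using power_le_fact_powr_exp[OF assms, of "\<bar>x $ i\<bar>"] by simp
    also have "\<dots> \<le> h ^ count_list is i * fact (count_list is i) powr t * exp (?c * weight t x)"
      using assms c component_le_norm_cart[of x i] unfolding weight_def
      by (intro mult_left_mono iffD2[OF exp_le_cancel_iff] powr_mono2) auto
    finally show "\<bar>x $ i\<bar> ^ count_list is i \<le> \<dots>" .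
  qed simp
  also have "\<dots> = h ^ length is * mfact is powr t * exp (real CARD('d) * ?c * weight t x)"
  proof -
    have "(\<Prod>i\<in>UNIV. h ^ count_list is i) = h ^ length is"
      by (simp add: power_sum[symmetric] sum_count_set)
    then show ?thesis
      by (simp add: prod.distrib mfact_def prod_powr_distrib exp_of_nat_mult[symmetric] mult.assoc)
  qed
  finally show ?thesis by (simp add: mult.assoc)
qed

text \<open>The supremum over powers of \<open>x\<close> is replaced by a majorant \<open>E\<close>.
  Keeping \<open>E\<close> an arbitrary function lets translations and products act on it pointwise,
  and lets it carry constants that depend on a phase space point.\<close>

definition gs_bound ::
  "real \<Rightarrow> real \<Rightarrow> (real ^ 'd \<Rightarrow> real) \<Rightarrow> (real ^ 'd \<Rightarrow> complex) \<Rightarrow> bool" where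
  "gs_bound s h E f \<longleftrightarrow> (\<forall>is x. cmod (partials is f x) \<le> h ^ length is * mfact is powr s * E x)"

lemma gs_boundD: "gs_bound s h E f \<Longrightarrow> cmod (partials is f x) \<le> h ^ length is * mfact is powr s * E x"
  by (auto simp: gs_bound_def)

lemma gs_bound_Nil: "gs_bound s h E f \<Longrightarrow> cmod (f x) \<le> E x"
  using gs_boundD[of s h E f "[]" x] by simp

lemma gs_bound_nonneg: "gs_bound s h E f \<Longrightarrow> 0 \<le> E x"
  using gs_bound_Nil[of s h E f x] norm_ge_zero[of "f x"] by linarith

lemma gs_bound_mono:
  assumes "gs_bound s h E f" "\<And>x. E x \<le> E' x" "0 \<le> h" "h \<le> h'"
  shows "gs_bound s h' E' f"
  unfolding gs_bound_def
proof safe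
  fix "is" x
  have "cmod (partials is f x) \<le> h ^ length is * mfact is powr s * E x"
    by (rule gs_boundD[OF assms(1)])
  also have "\<dots> \<le> h' ^ length is * mfact is powr s * E' x"
    using assms gs_bound_nonneg[OF assms(1)] by (intro mult_mono power_mono) auto
  finally show "cmod (partials is f x) \<le> \<dots>" .
qed

lemma gs_bound_cmult:
  "smooth f \<Longrightarrow> gs_bound s h E f \<Longrightarrow> gs_bound s h (\<lambda>x. cmod c * E x) (\<lambda>x. c * f x)"
  unfolding gs_bound_def
  by (auto simp: partials_cmult norm_mult mult.left_commute[of _ "cmod c"] intro!: mult_left_mono)

lemma gs_bound_add:
  assumes "smooth f" "smooth g" "gs_bound s h E f" "gs_bound s h E' g"
  shows "gs_bound s h (\<lambda>x. E x + E' x) (\<lambda>x. f x + g x)"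
  unfolding gs_bound_def
proof safe
  fix "is" x
  have "cmod (partials is (\<lambda>x. f x + g x) x) \<le> cmod (partials is f x) + cmod (partials is g x)"
    by (simp add: partials_add assms norm_triangle_ineq)
  also have "\<dots> \<le> h ^ length is * mfact is powr s * (E x + E' x)"
    using gs_boundD[OF assms(3), of "is" x] gs_boundD[OF assms(4), of "is" x]
    by (simp add: distrib_left)
  finally show "cmod (partials is (\<lambda>x. f x + g x) x) \<le> \<dots>" .
qed

lemma gs_bound_cnj: "smooth f \<Longrightarrow> gs_bound s h E f \<Longrightarrow> gs_bound s h E (\<lambda>x. cnj (f x))"
  by (simp add: gs_bound_def partials_cnj)

lemma gs_bound_translate:
  "smooth f \<Longrightarrow> gs_bound s h E f \<Longrightarrow> gs_bound s h (\<lambda>x. E (x - y)) (translate y f)"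
  by (simp add: gs_bound_def partials_translate translate_def)

text \<open>
  Generalising to products of derivatives replaces the Leibniz formula and its binomial coefficients:
  each derivative splits such a product into two products of the same shape.
\<close>

lemma partials_mult_bound:
  assumes f: "smooth f" and g: "smooth g"
    and bf: "gs_bound s h E f" and bg: "gs_bound s h E' g" and "0 \<le> h" "0 \<le> s"
  shows "cmod (partials is (\<lambda>x. partials js f x * partials ks g x) x) \<le>
    2 ^ length is * (h ^ length (is @ js @ ks) * mfact (is @ js @ ks) powr s * (E x * E' x))"
\<comment> \<open>Reverse induction, because the last direction in the list acts first, that is,
  directly on the product.\<close>
proof (induction "is" arbitrary: js ks rule: rev_induct)
  case Nil
  have "cmod (partials js f x) * cmod (partials ks g x) \<le>
      (h ^ length js * mfact js powr s * E x) * (h ^ length ks * mfact ks powr s * E' x)"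
    using gs_boundD[OF bf, of js x] gs_boundD[OF bg, of ks x]
    by (intro mult_mono) (auto intro: order_trans[OF norm_ge_zero])
  also have "\<dots> = h ^ length (js @ ks) * (mfact js * mfact ks) powr s * (E x * E' x)"
    by (simp add: powr_mult power_add)
  also have "\<dots> \<le> h ^ length (js @ ks) * mfact (js @ ks) powr s * (E x * E' x)"
    using assms gs_bound_nonneg[OF bf] gs_bound_nonneg[OF bg] mfact_append[of js ks]
      mfact_ge_1[of js] mfact_ge_1[of ks]
    by (intro mult_right_mono mult_left_mono powr_mono2) auto
  finally show ?case by (simp add: norm_mult)
next
  case (snoc i "is")
  let ?B = "h ^ length ((is @ [i]) @ js @ ks) * mfact ((is @ [i]) @ js @ ks) powr s * (E x * E' x)"
  \<comment> \<open>The new direction joins either \<open>js\<close> or \<open>ks\<close>. Both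
    placements have the same multiset of directions, hence the same bound.\<close>
  have cong: "h ^ length l * mfact l powr s * (E x * E' x) = ?B"
    if "mset l = mset ((is @ [i]) @ js @ ks)" for l
  proof -
    have "mfact l = mfact ((is @ [i]) @ js @ ks)"
      unfolding mfact_def by (intro prod.cong refl) (metis count_mset that)
    moreover have "length l = length ((is @ [i]) @ js @ ks)"
      using that by (metis size_mset)
    ultimately show ?thesis by simp
  qed
  have sm: "smooth (partials js f)" "smooth (partials ks g)"
    by (auto intro: smooth_partials f g)
  have "partials (is @ [i]) (\<lambda>x. partials js f x * partials ks g x) =
      partials is (\<lambda>x. partials (i # js) f x * partials ks g x + partials js f x * partials (i # ks) g x)"
    by (simp add: partials_append partials_Cons partial_mult sm)
  also have "\<dots> = (\<lambda>x. partials is (\<lambda>x. partials (i # js) f x * partials ks g x) x +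
      partials is (\<lambda>x. partials js f x * partials (i # ks) g x) x)"
    by (intro partials_add smooth_mult smooth_partials f g)
  finally have "cmod (partials (is @ [i]) (\<lambda>x. partials js f x * partials ks g x) x) \<le>
      cmod (partials is (\<lambda>x. partials (i # js) f x * partials ks g x) x) +
      cmod (partials is (\<lambda>x. partials js f x * partials (i # ks) g x) x)"
    by (simp add: norm_triangle_ineq)
  also have "\<dots> \<le> 2 ^ length is * ?B + 2 ^ length is * ?B"
  proof (rule add_mono)
    have eq: "h ^ length (is @ (i # js) @ ks) * mfact (is @ (i # js) @ ks) powr s * (E x * E' x) = ?B"
      "h ^ length (is @ js @ i # ks) * mfact (is @ js @ i # ks) powr s * (E x * E' x) = ?B"
      by (intro cong; simp)+
    show "cmod (partials is (\<lambda>x. partials (i # js) f x * partials ks g x) x) \<le> 2 ^ length is * ?B"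
      "cmod (partials is (\<lambda>x. partials js f x * partials (i # ks) g x) x) \<le> 2 ^ length is * ?B"
      using snoc[of "i # js" ks] snoc[of js "i # ks"] unfolding eq by blast+
  qed
  also have "\<dots> = 2 ^ length (is @ [i]) * ?B" by simp
  finally show ?case .
qed

text \<open>Doubling \<open>h\<close> absorbs the factor \<open>2 ^ length is\<close> that counts
  the terms of the product rule.\<close>

lemma gs_bound_mult:
  assumes "smooth f" "smooth g" "gs_bound s h E f" "gs_bound s h E' g" "0 \<le> h" "0 \<le> s"
  shows "gs_bound s (2 * h) (\<lambda>x. E x * E' x) (\<lambda>x. f x * g x)"
  using partials_mult_bound[OF assms, where js="[]" and ks="[]"]
  by (simp add: gs_bound_def power_mult_distrib mult_ac)

text \<open>Differentiation brings down monomials in \<open>\<xi>\<close>, which are bounded like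
  monomials in \<open>x\<close>, now with \<open>s\<close> in place of \<open>t\<close>.\<close>

lemma gs_bound_character:
  fixes \<xi> :: "real ^ 'd"
  assumes "0 < s" "0 < h"
  shows "gs_bound s h (\<lambda>x. exp (real CARD('d) * s * (1 / h) powr (1 / s) * weight s \<xi>)) (character \<xi>)"
  unfolding gs_bound_def
proof safe
  fix "is" x
  have "cmod (prod_list (map (\<lambda>i. \<i> * complex_of_real (\<xi> $ i)) is)) = \<bar>prod_list (map (($) \<xi>) is)\<bar>"
    by (induction "is") (auto simp: norm_mult abs_mult)
  then show "cmod (partials is (character \<xi>) x) \<le> h ^ length is * mfact is powr s *
      exp (real CARD('d) * s * (1 / h) powr (1 / s) * weight s \<xi>)"
    using abs_mi_power_le[OF assms, of \<xi> "is"] by (simp add: partials_character norm_mult mi_power_list_mi)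
qed

section \<open>Equivalence of seminorms and exponential weights\<close>

lemma gs_norm_le_iff:
  fixes f :: "real ^ 'd \<Rightarrow> complex"
  assumes "smooth f" "0 < h" "0 \<le> K"
  shows "gs_norm t s h f \<le> ennreal K \<longleftrightarrow>
    (\<forall>js is x. \<bar>mi_power x (list_mi js)\<bar> * cmod (partials is f x) \<le>
       K * (h ^ (length js + length is) * mfact js powr t * mfact is powr s))"
proof -
  have pos: "0 < mi_fact \<beta>" for \<beta> :: "nat ^ 'd"
    by (auto simp: mi_fact_def intro: prod_pos)
  have pos': "0 < mfact js" for js :: "'d list"
    using mfact_ge_1[of js] by linarith
  have add: "mi_abs (\<alpha> + \<beta>) = mi_abs \<alpha> + mi_abs \<beta>" for \<alpha> \<beta> :: "nat ^ 'd"
    by (simp add: mi_abs_def sum.distrib)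
  have "gs_norm t s h f \<le> ennreal K \<longleftrightarrow>
    (\<forall>\<alpha> \<beta> x. cmod (of_real (mi_power x \<alpha>) * mi_D \<beta> f x) /
                 (h ^ mi_abs (\<alpha> + \<beta>) * mi_fact \<alpha> powr t * mi_fact \<beta> powr s) \<le> K)"
    using assms by (auto simp: gs_norm_def SUP_le_iff ennreal_le_iff)
  also have "\<dots> \<longleftrightarrow> (\<forall>js is x. cmod (of_real (mi_power x (list_mi js)) * mi_D (list_mi is) f x) /
                 (h ^ mi_abs (list_mi js + list_mi is) * mi_fact (list_mi js) powr t * mi_fact (list_mi is) powr s) \<le> K)"
    using list_mi_surj by metis
  also have "\<dots> \<longleftrightarrow> (\<forall>js is x. \<bar>mi_power x (list_mi js)\<bar> * cmod (partials is f x) \<le>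
       K * (h ^ (length js + length is) * mfact js powr t * mfact is powr s))"
  proof (intro arg_cong[of _ _ All] ext)
    fix js "is" :: "'d list" and x :: "real ^ 'd"
    have "0 < h ^ (length js + length is) * mfact js powr t * mfact is powr s"
      using assms(2) pos'[of js] pos'[of "is"] by simp
    from pos_divide_le_eq[OF this]
    show "(cmod (of_real (mi_power x (list_mi js)) * mi_D (list_mi is) f x) /
        (h ^ mi_abs (list_mi js + list_mi is) * mi_fact (list_mi js) powr t * mi_fact (list_mi is) powr s) \<le> K) =
      (\<bar>mi_power x (list_mi js)\<bar> * cmod (partials is f x) \<le>
         K * (h ^ (length js + length is) * mfact js powr t * mfact is powr s))"
      using assms(1) by (simp add: norm_mult cmod_mi_D_list_mi mi_fact_list_mi add mi_abs_list_mi)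
  qed
  finally show ?thesis .
qed

lemma gelfand_shilov_smooth: "f \<in> gelfand_shilov t s \<Longrightarrow> smooth f"
  by (simp add: gelfand_shilov_def)

text \<open>The norm is at most the sum of the absolute coordinates, so some coordinate is at least
  the norm divided by the dimension. Pure powers of single coordinates therefore control powers of
  the norm.\<close>

lemma norm_power_mult_le:
  fixes x :: "real ^ 'd"
  assumes "\<And>i. \<bar>x $ i\<bar> ^ n * A \<le> B" "0 \<le> A"
  shows "norm x ^ n * A \<le> real CARD('d) ^ n * B"
proof -
  have "\<exists>i. norm x \<le> real CARD('d) * \<bar>x $ i\<bar>"
  proof (rule ccontr)
    assume "\<not> ?thesis"
    then have "(\<Sum>i\<in>UNIV. real CARD('d) * \<bar>x $ i\<bar>) < (\<Sum>i\<in>(UNIV :: 'd set). norm x)"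
      by (intro sum_strict_mono) (auto simp: not_le)
    also have "\<dots> = real CARD('d) * norm x" by simp
    finally show False
      using norm_le_l1_cart[of x] by (simp add: sum_distrib_left[symmetric])
  qed
  then obtain i where i: "norm x \<le> real CARD('d) * \<bar>x $ i\<bar>" by blast
  have "norm x ^ n * A \<le> (real CARD('d) * \<bar>x $ i\<bar>) ^ n * A"
    using i assms by (intro mult_right_mono power_mono) auto
  also have "\<dots> = real CARD('d) ^ n * (\<bar>x $ i\<bar> ^ n * A)"
    by (simp add: power_mult_distrib)
  also have "\<dots> \<le> real CARD('d) ^ n * B"
    by (intro mult_left_mono assms) simp
  finally show ?thesis .
qed

lemma mi_power_replicate: "mi_power x (list_mi (replicate n i)) = x $ i ^ n"
  by (induction n) (auto simp: mi_power_list_mi)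

text \<open>Taking only powers of single coordinates among the monomials bounds all powers of the
  norm, and \<open>exp_decay_of_power_bounds\<close> turns these bounds into exponential
  decay.\<close>

lemma gelfand_shilov_gs_bound:
  fixes f :: "real ^ 'd \<Rightarrow> complex"
  assumes f: "f \<in> gelfand_shilov t s" and "0 < t" "0 < h" "0 < r"
  obtains C where "0 < C" "gs_bound s h (\<lambda>x. C * exp (- r * weight t x)) f"
proof -
  \<comment> \<open>\<open>h1\<close> is the ratio that \<open>exp_decay_of_power_bounds\<close>
    requires for the rate \<open>r\<close>. Dividing by the dimension pays for
    \<open>norm_power_mult_le\<close>, and the minimum with \<open>h\<close> serves the
    derivatives.\<close>
  define h1 where "h1 = (t / (2 * r)) powr t"
  define h' where "h' = min h (h1 / real CARD('d))"
  have h': "0 < h'" "h' \<le> h" "real CARD('d) * h' \<le> h1" "0 < h1"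
    using assms by (auto simp: h'_def h1_def min_def field_simps)
  have sm: "smooth f" using f by (rule gelfand_shilov_smooth)
  define K where "K = enn2real (gs_norm t s h' f)"
  have "gs_norm t s h' f < \<infinity>" using f h' by (auto simp: gelfand_shilov_def)
  then have "gs_norm t s h' f \<le> ennreal K" "0 \<le> K" by (auto simp: K_def less_top)
  then have K: "\<bar>mi_power x (list_mi js)\<bar> * cmod (partials is f x) \<le>
       K * (h' ^ (length js + length is) * mfact js powr t * mfact is powr s)" for x js "is"
    using gs_norm_le_iff[OF sm h'(1)] by blast
  have "gs_bound s h (\<lambda>x. (2 powr t * K) * exp (- r * weight t x)) f"
    unfolding gs_bound_def
  proof safe
    fix "is" x
    let ?A = "cmod (partials is f x)" and ?M = "h ^ length is * mfact is powr s"
    have "?A \<le> 2 powr t * (K * ?M) * exp (- r * norm x powr (1 / t))"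
    proof (rule exp_decay_of_power_bounds)
      fix n
      have "norm x ^ n * ?A \<le> real CARD('d) ^ n * (K * (h' ^ (n + length is) * fact n powr t * mfact is powr s))"
        using K[of x "replicate n _" "is"]
        by (intro norm_power_mult_le) (auto simp: mi_power_replicate mfact_replicate power_abs)
      also have "\<dots> = K * ((real CARD('d) * h') ^ n * (h' ^ length is * (fact n powr t * mfact is powr s)))"
        by (simp add: power_mult_distrib power_add)
      also have "\<dots> \<le> K * (h1 ^ n * (h ^ length is * (fact n powr t * mfact is powr s)))"
        using h' \<open>0 \<le> K\<close> by (intro mult_left_mono mult_mono power_mono) auto
      finally show "?A * norm x ^ n \<le> K * ?M * ((t / (2 * r)) powr t) ^ n * fact n powr t"
        by (simp add: h1_def mult_ac)
    qed (use assms in auto)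
    then show "?A \<le> ?M * (2 powr t * K * exp (- r * weight t x))"
      by (simp add: weight_def mult_ac)
  qed
  \<comment> \<open>Adding 1 makes the constant strictly positive even if
    \<open>K = 0\<close>.\<close>
  then have "gs_bound s h (\<lambda>x. (2 powr t * K + 1) * exp (- r * weight t x)) f"
    by (rule gs_bound_mono) (use assms in auto)
  moreover have "0 < 2 powr t * K + 1"
    using \<open>0 \<le> K\<close> by (intro add_nonneg_pos) auto
  ultimately show ?thesis
    using that by blast
qed

text \<open>The required decay rate is exactly the growth rate of monomials in
  \<open>abs_mi_power_le\<close>, so the two exponentials cancel.\<close>

lemma gs_norm_le:
  fixes f :: "real ^ 'd \<Rightarrow> complex"
  assumes "smooth f" "0 < t" "0 < h" "0 \<le> K"
    and "gs_bound s h (\<lambda>x. K * exp (- (real CARD('d) * t * (1 / h) powr (1 / t)) * weight t x)) f"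
  shows "gs_norm t s h f \<le> ennreal K"
  unfolding gs_norm_le_iff[OF assms(1,3,4)]
proof safe
  fix js "is" :: "'d list" and x :: "real ^ 'd"
  let ?r = "real CARD('d) * t * (1 / h) powr (1 / t)"
  have "\<bar>mi_power x (list_mi js)\<bar> * cmod (partials is f x) \<le>
     (h ^ length js * mfact js powr t * exp (?r * weight t x)) *
     (h ^ length is * mfact is powr s * (K * exp (- ?r * weight t x)))"
    using abs_mi_power_le[OF assms(2,3)] gs_boundD[OF assms(5)] assms(3)
    by (intro mult_mono) auto
  also have "\<dots> = K * (h ^ (length js + length is) * mfact js powr t * mfact is powr s)"
    by (simp add: power_add exp_minus field_simps)
  finally show "\<bar>mi_power x (list_mi js)\<bar> * cmod (partials is f x) \<le> \<dots>" .
qed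

lemma gelfand_shilovI:
  fixes f :: "real ^ 'd \<Rightarrow> complex"
  assumes "smooth f" "0 < t"
    and "\<And>h r. 0 < h \<Longrightarrow> 0 < r \<Longrightarrow> \<exists>C. gs_bound s h (\<lambda>x. C * exp (- r * weight t x)) f"
  shows "f \<in> gelfand_shilov t s"
  unfolding gelfand_shilov_def
proof safe
  fix h :: real assume h: "0 < h"
  obtain C where C: "gs_bound s h (\<lambda>x. C * exp (- (real CARD('d) * t * (1 / h) powr (1 / t)) * weight t x)) f"
    using assms(3)[OF h, of "real CARD('d) * t * (1 / h) powr (1 / t)"] h assms(2) by auto
  have "0 \<le> C" using gs_bound_nonneg[OF C, of 0] by (simp add: zero_le_mult_iff)
  then have "gs_norm t s h f \<le> ennreal C" by (intro gs_norm_le[OF assms(1,2) h _ C])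
  then show "gs_norm t s h f < \<infinity>" using ennreal_less_top le_less_trans by fastforce
qed fact

section \<open>Closure under sums, multiples and conjugation\<close>

lemma gelfand_shilov_add:
  assumes "f \<in> gelfand_shilov t s" "g \<in> gelfand_shilov t s" "0 < t"
  shows "(\<lambda>x. f x + g x) \<in> gelfand_shilov t s"
proof (rule gelfand_shilovI)
  fix h r :: real assume hr: "0 < h" "0 < r"
  obtain C where C: "gs_bound s h (\<lambda>x. C * exp (- r * weight t x)) f"
    using gelfand_shilov_gs_bound[OF assms(1,3) hr] by metis
  obtain D where D: "gs_bound s h (\<lambda>x. D * exp (- r * weight t x)) g"
    using gelfand_shilov_gs_bound[OF assms(2,3) hr] by metis
  show "\<exists>C. gs_bound s h (\<lambda>x. C * exp (- r * weight t x)) (\<lambda>x. f x + g x)"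
    using gs_bound_add[OF gelfand_shilov_smooth[OF assms(1)] gelfand_shilov_smooth[OF assms(2)] C D]
    by (auto simp: distrib_right[symmetric])
qed (use assms in \<open>auto intro: smooth_add gelfand_shilov_smooth\<close>)

lemma gelfand_shilov_cmult:
  assumes "f \<in> gelfand_shilov t s" "0 < t"
  shows "(\<lambda>x. c * f x) \<in> gelfand_shilov t s"
proof (rule gelfand_shilovI)
  fix h r :: real assume hr: "0 < h" "0 < r"
  obtain C where C: "gs_bound s h (\<lambda>x. C * exp (- r * weight t x)) f"
    using gelfand_shilov_gs_bound[OF assms hr] by metis
  show "\<exists>C. gs_bound s h (\<lambda>x. C * exp (- r * weight t x)) (\<lambda>x. c * f x)"
    using gs_bound_cmult[OF gelfand_shilov_smooth[OF assms(1)] C, of c]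
    by (auto simp: mult.assoc[symmetric])
qed (use assms in \<open>auto intro: smooth_cmult gelfand_shilov_smooth\<close>)

lemma gelfand_shilov_cnj:
  assumes "f \<in> gelfand_shilov t s" "0 < t"
  shows "(\<lambda>x. cnj (f x)) \<in> gelfand_shilov t s"
proof (rule gelfand_shilovI)
  fix h r :: real assume hr: "0 < h" "0 < r"
  obtain C where C: "gs_bound s h (\<lambda>x. C * exp (- r * weight t x)) f"
    using gelfand_shilov_gs_bound[OF assms hr] by metis
  show "\<exists>C. gs_bound s h (\<lambda>x. C * exp (- r * weight t x)) (\<lambda>x. cnj (f x))"
    using gs_bound_cnj[OF gelfand_shilov_smooth[OF assms(1)] C] by blast
qed (use assms in \<open>auto intro: smooth_cnj gelfand_shilov_smooth\<close>)

section \<open>Continuous functionals and phase space shifts\<close>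

lemma gs_norm_cases:
  obtains (infinite) "gs_norm t s h f = \<infinity>" | (finite) K where "0 \<le> K" "gs_norm t s h f = ennreal K"
  by (cases "gs_norm t s h f") auto

lemma gs_norm_antimono:
  assumes "smooth f" "0 < h'" "h' \<le> h"
  shows "gs_norm t s h f \<le> gs_norm t s h' f"
proof (cases rule: gs_norm_cases[of t s h' f])
  case (finite K)
  have "gs_norm t s h f \<le> ennreal K"
  proof (subst gs_norm_le_iff, safe)
    fix js "is" x
    have "\<bar>mi_power x (list_mi js)\<bar> * cmod (partials is f x) \<le>
        K * (h' ^ (length js + length is) * mfact js powr t * mfact is powr s)"
      using gs_norm_le_iff[OF assms(1,2) finite(1), of t s] finite(2) by simp
    also have "\<dots> \<le> K * (h ^ (length js + length is) * mfact js powr t * mfact is powr s)"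
      using assms finite by (intro mult_left_mono mult_right_mono power_mono) auto
    finally show "\<bar>mi_power x (list_mi js)\<bar> * cmod (partials is f x) \<le> \<dots>" .
  qed (use assms finite in auto)
  then show ?thesis using finite by simp
qed simp

lemma gs_norm_triangle:
  fixes f g :: "real ^ 'd \<Rightarrow> complex"
  assumes "smooth f" "smooth g" "0 < h"
  shows "gs_norm t s h (\<lambda>x. f x + g x) \<le> gs_norm t s h f + gs_norm t s h g"
proof (cases rule: gs_norm_cases[of t s h f])
  case f: (finite K)
  show ?thesis
  proof (cases rule: gs_norm_cases[of t s h g])
    case g: (finite L)
    have "gs_norm t s h (\<lambda>x. f x + g x) \<le> ennreal (K + L)"
    proof (subst gs_norm_le_iff, safe)
      fix js "is" :: "'d list" and x :: "real ^ 'd"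
      let ?M = "h ^ (length js + length is) * mfact js powr t * mfact is powr s"
      have "\<bar>mi_power x (list_mi js)\<bar> * cmod (partials is f x) \<le> K * ?M"
        using gs_norm_le_iff[OF assms(1,3) f(1), of t s] f(2) by simp
      moreover have "\<bar>mi_power x (list_mi js)\<bar> * cmod (partials is g x) \<le> L * ?M"
        using gs_norm_le_iff[OF assms(2,3) g(1), of t s] g(2) by simp
      moreover have "\<bar>mi_power x (list_mi js)\<bar> * cmod (partials is (\<lambda>x. f x + g x) x) \<le>
          \<bar>mi_power x (list_mi js)\<bar> * (cmod (partials is f x) + cmod (partials is g x))"
        using assms by (intro mult_left_mono) (auto simp: partials_add norm_triangle_ineq)
      ultimately show "\<bar>mi_power x (list_mi js)\<bar> * cmod (partials is (\<lambda>x. f x + g x) x) \<le> (K + L) * ?M"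
        by (simp add: distrib_left distrib_right)
    qed (use assms f g in \<open>auto intro: smooth_add\<close>)
    then show ?thesis using f g by simp
  qed simp
qed simp

lemma smooth_diff: "smooth f \<Longrightarrow> smooth g \<Longrightarrow> smooth (\<lambda>x. f x - g x)"
  using smooth_add[of f "\<lambda>x. (-1) * g x"] smooth_cmult[of g "-1"] by simp

lemma gs_ball_mono:
  assumes "f \<in> gelfand_shilov t s" "0 < h'" "h' \<le> h" "\<epsilon>' \<le> \<epsilon>"
  shows "gs_ball t s h' f \<epsilon>' \<subseteq> gs_ball t s h f \<epsilon>"
proof
  fix g assume g: "g \<in> gs_ball t s h' f \<epsilon>'"
  then have "smooth (\<lambda>x. g x - f x)"
    using assms by (auto simp: gs_ball_def intro: smooth_diff gelfand_shilov_smooth)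
  then have "gs_norm t s h (\<lambda>x. g x - f x) \<le> gs_norm t s h' (\<lambda>x. g x - f x)"
    using assms by (intro gs_norm_antimono)
  also have "\<dots> < ennreal \<epsilon>'" using g by (simp add: gs_ball_def)
  also have "\<dots> \<le> ennreal \<epsilon>" using assms by (simp add: ennreal_leI)
  finally show "g \<in> gs_ball t s h f \<epsilon>" using g by (simp add: gs_ball_def)
qed

text \<open>The generating balls have arbitrary centres. The triangle inequality recentres a ball at
  \<open>f\<close>, and for intersections the smaller \<open>h\<close> and \<open>\<epsilon>\<close>
  serve, since the seminorms increase as \<open>h\<close> decreases. Thus a single seminorm ball
  suffices.\<close>

lemma gs_topology_nhd:
  assumes "openin (gs_topology t s) W" "f \<in> W"
  shows "\<exists>h>0. \<exists>\<epsilon>>0. gs_ball t s h f \<epsilon> \<subseteq> W"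
proof -
  have "generate_topology_on {gs_ball t s h f \<epsilon> |h f \<epsilon>. h > 0 \<and> f \<in> gelfand_shilov t s \<and> \<epsilon> > 0} W"
    using assms(1) unfolding gs_topology_def by (rule openin_topology_generated_by)
  then show ?thesis
    using assms(2)
  proof induction
    case (Int A B)
    then obtain h \<epsilon> h' \<epsilon>' where *: "0 < h" "0 < \<epsilon>" "gs_ball t s h f \<epsilon> \<subseteq> A"
      "0 < h'" "0 < \<epsilon>'" "gs_ball t s h' f \<epsilon>' \<subseteq> B"
      by blast
    have f: "f \<in> gelfand_shilov t s"
    proof -
      have "A \<subseteq> gelfand_shilov t s"
        using Int(1)
      proof induction
        case (Basis A)
        then show ?case by (auto simp: gs_ball_def)
      qed auto
      then show ?thesis using Int.prems by auto
    qed
    have "gs_ball t s (min h h') f (min \<epsilon> \<epsilon>') \<subseteq> gs_ball t s h f \<epsilon>"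
      "gs_ball t s (min h h') f (min \<epsilon> \<epsilon>') \<subseteq> gs_ball t s h' f \<epsilon>'"
      by (intro gs_ball_mono f; use * in simp)+
    then have "gs_ball t s (min h h') f (min \<epsilon> \<epsilon>') \<subseteq> A \<inter> B" using * by blast
    moreover have "0 < min h h'" "0 < min \<epsilon> \<epsilon>'" using * by auto
    ultimately show ?case by blast
  next
    case (UN K)
    then show ?case by (meson UnionE Union_upper order_trans)
  next
    case (Basis A)
    then obtain h f0 \<epsilon> where A: "A = gs_ball t s h f0 \<epsilon>" and h: "0 < h" and
      f0: "f0 \<in> gelfand_shilov t s" and \<epsilon>: "0 < \<epsilon>"
      by blast
    have f: "f \<in> gelfand_shilov t s" and less: "gs_norm t s h (\<lambda>x. f x - f0 x) < ennreal \<epsilon>"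
      using Basis A by (auto simp: gs_ball_def)
    obtain K where K: "0 \<le> K" "gs_norm t s h (\<lambda>x. f x - f0 x) = ennreal K" "K < \<epsilon>"
      using less by (cases rule: gs_norm_cases[of t s h "\<lambda>x. f x - f0 x"]) (auto simp: ennreal_less_iff)
    have "gs_ball t s h f (\<epsilon> - K) \<subseteq> A"
    proof
      fix g assume g: "g \<in> gs_ball t s h f (\<epsilon> - K)"
      then have g': "g \<in> gelfand_shilov t s" by (simp add: gs_ball_def)
      have "gs_norm t s h (\<lambda>x. g x - f0 x) = gs_norm t s h (\<lambda>x. (g x - f x) + (f x - f0 x))"
        by simp
      also have "\<dots> \<le> gs_norm t s h (\<lambda>x. g x - f x) + gs_norm t s h (\<lambda>x. f x - f0 x)"
        using f g' f0 h by (intro gs_norm_triangle smooth_diff gelfand_shilov_smooth)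
      also have "\<dots> < ennreal (\<epsilon> - K) + ennreal K"
        using g K by (simp add: gs_ball_def add.commute ennreal_add_left_cancel_less)
      also have "\<dots> = ennreal \<epsilon>" using K by (simp add: ennreal_plus[symmetric] del: ennreal_plus)
      finally show "g \<in> A" using g' by (simp add: A gs_ball_def)
    qed
    then show ?case using h K by (metis diff_gt_0_iff_gt)
  qed auto
qed

text \<open>Continuity is recorded as one estimate against a weighted bound. In this form it passes
  to \<open>f \<mapsto> u (phase_shift z f)\<close> without going back to the topology.\<close>

definition gs_functional :: "real \<Rightarrow> real \<Rightarrow> ((real ^ 'd \<Rightarrow> complex) \<Rightarrow> complex) \<Rightarrow> bool" where
  "gs_functional t s u \<longleftrightarrow>
     (\<forall>f\<in>gelfand_shilov t s. \<forall>g\<in>gelfand_shilov t s. u (\<lambda>x. f x + g x) = u f + u g) \<and>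
     (\<forall>c. \<forall>f\<in>gelfand_shilov t s. u (\<lambda>x. c * f x) = c * u f) \<and>
     (\<exists>h>0. \<exists>r>0. \<exists>C>0. \<forall>f\<in>gelfand_shilov t s. \<forall>K>0.
        gs_bound s h (\<lambda>x. K * exp (- r * weight t x)) f \<longrightarrow> cmod (u f) \<le> C * K)"

lemma gs_functional_add:
  "gs_functional t s u \<Longrightarrow> f \<in> gelfand_shilov t s \<Longrightarrow> g \<in> gelfand_shilov t s \<Longrightarrow>
    u (\<lambda>x. f x + g x) = u f + u g"
  by (simp add: gs_functional_def)

lemma gs_functional_cmult:
  "gs_functional t s u \<Longrightarrow> f \<in> gelfand_shilov t s \<Longrightarrow> u (\<lambda>x. c * f x) = c * u f"
  by (simp add: gs_functional_def)

lemma partials_zero: "partials is (\<lambda>x. 0) = (\<lambda>x. 0)"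
  using partials_cmult[OF smooth_const[of 0], of "is" 0] by simp

lemma zero_in_gelfand_shilov: "0 < t \<Longrightarrow> (\<lambda>x. 0) \<in> gelfand_shilov t s"
  by (rule gelfand_shilovI)
     (auto simp: gs_bound_def partials_zero intro!: exI[of _ 0] smooth_const)

lemma gs_dual_functional:
  \<comment> \<open>The preimage of the unit disc contains a seminorm ball around 0, and scaling
    into that ball gives the estimate. The rate \<open>r\<close> is the one for which
    \<open>gs_norm_le\<close> bounds this seminorm.\<close>
  fixes u :: "(real ^ 'd \<Rightarrow> complex) \<Rightarrow> complex"
  assumes u: "u \<in> gs_dual t s" and t: "0 < t"
  shows "gs_functional t s u"
proof -
  let ?z = "\<lambda>x :: real ^ 'd. 0 :: complex"
  have hom: "u (\<lambda>x. c * f x) = c * u f" if "f \<in> gelfand_shilov t s" for c f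
    using u that by (auto simp: gs_dual_def)
  have zero: "?z \<in> gelfand_shilov t s" by (rule zero_in_gelfand_shilov[OF t])
  have u0: "u ?z = 0" using hom[OF zero, of 0] by simp
  define W where "W = {f \<in> topspace (gs_topology t s). u f \<in> ball 0 1}"
  have "openin (gs_topology t s) W"
    unfolding W_def using u by (intro openin_continuous_map_preimage[where Y = euclidean]) (auto simp: gs_dual_def)
  moreover have "?z \<in> W"
  proof -
    have "gs_norm t s 1 ?z \<le> ennreal 0"
      by (subst gs_norm_le_iff) (auto simp: partials_zero intro: smooth_const)
    then have norm0: "gs_norm t s 1 ?z = 0" by simp
    have "?z \<in> gs_ball t s 1 ?z 1"
      using zero norm0 by (simp add: gs_ball_def)
    then have "?z \<in> topspace (gs_topology t s)"
      using zero unfolding gs_topology_def topology_generated_by_topspace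
      by (intro UnionI[of "gs_ball t s 1 ?z 1"] CollectI exI[of _ "1 :: real"] exI[of _ ?z]) auto
    then show ?thesis by (simp add: W_def u0)
  qed
  ultimately obtain h \<epsilon> where h: "0 < h" and \<epsilon>: "0 < \<epsilon>" and ball: "gs_ball t s h ?z \<epsilon> \<subseteq> W"
    using gs_topology_nhd by blast
  define r where "r = real CARD('d) * t * (1 / h) powr (1 / t)"
  have "cmod (u f) \<le> 2 / \<epsilon> * K"
    if f: "f \<in> gelfand_shilov t s" and K: "0 < K" and b: "gs_bound s h (\<lambda>x. K * exp (- r * weight t x)) f" for f K
  proof -
    \<comment> \<open>With this factor the seminorm of \<open>c * f\<close> is at most
      \<open>\<epsilon> / 2\<close>, strictly inside the ball.\<close>
    define c where "c = \<epsilon> / (2 * K)"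
    have c: "0 < c" using \<epsilon> K by (simp add: c_def)
    have "gs_bound s h (\<lambda>x. cmod (of_real c) * (K * exp (- r * weight t x))) (\<lambda>x. of_real c * f x)"
      by (rule gs_bound_cmult[OF gelfand_shilov_smooth[OF f] b])
    then have "gs_norm t s h (\<lambda>x. of_real c * f x) \<le> ennreal (c * K)"
      using f c K h t
      by (intro gs_norm_le smooth_cmult gelfand_shilov_smooth[of f]) (auto simp: r_def mult.assoc)
    also have "\<dots> < ennreal \<epsilon>" using \<epsilon> K by (simp add: c_def ennreal_lessI)
    finally have "(\<lambda>x. of_real c * f x) \<in> W"
      using ball gelfand_shilov_cmult[OF f t, of "of_real c"] by (auto simp: gs_ball_def)
    then have "c * cmod (u f) < 1"
      using hom[OF f] c by (simp add: W_def norm_mult)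
    then show ?thesis using \<epsilon> K by (simp add: c_def field_simps)
  qed
  moreover have "0 < r" "0 < 2 / \<epsilon>" using h t \<epsilon> by (auto simp: r_def)
  ultimately show ?thesis
    using u h unfolding gs_functional_def gs_dual_def by blast
qed

text \<open>The minus sign reflects the conjugation in \<open>pairing\<close>: \<open>u\<close> is
  applied to the conjugate of the modulated window, which has the opposite frequency.\<close>

definition phase_shift ::
  "(real ^ 'd) \<times> (real ^ 'd) \<Rightarrow> (real ^ 'd \<Rightarrow> complex) \<Rightarrow> real ^ 'd \<Rightarrow> complex" where
  "phase_shift z f x = character (- snd z) x * translate (fst z) f x"

definition phase_weight :: "real \<Rightarrow> real \<Rightarrow> (real ^ 'd) \<times> (real ^ 'd) \<Rightarrow> real" where
  "phase_weight t s z = weight t (fst z) + weight s (snd z)"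

lemma phase_weight_nonneg [simp]: "0 \<le> phase_weight t s z"
  by (simp add: phase_weight_def)

lemma character_add_left: "character (\<xi> + \<eta>) x = character \<xi> x * character \<eta> x"
  by (simp add: character_def inner_add_right distrib_left exp_add)

text \<open>Phase shifts compose additively up to a unimodular factor, which disappears from all
  estimates.\<close>

lemma phase_shift_phase_shift:
  "phase_shift z0 (phase_shift z f) =
     (\<lambda>x. character (snd z) (fst z0) * phase_shift (z0 + z) f x)"
proof
  fix x
  have "character (- snd z) (x - fst z0) = character (snd z) (fst z0) * character (- snd z) x"
    by (simp add: character_def exp_add[symmetric] inner_diff_left algebra_simps)
  moreover have "character (- snd (z0 + z)) x = character (- snd z0) x * character (- snd z) x"
    using character_add_left[of "- snd z0" "- snd z" x] by simp
  ultimately show "phase_shift z0 (phase_shift z f) x = character (snd z) (fst z0) * phase_shift (z0 + z) f x"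
    by (simp add: phase_shift_def translate_def diff_diff_eq)
qed

lemma stft_eq_phase_shift:
  "stft \<psi> u (x, \<xi>) = of_real ((2 * pi) powr (- (real CARD('d) / 2))) *
     u (phase_shift (x, \<xi>) (\<lambda>y. cnj (\<psi> y)))"
  for \<psi> :: "real ^ 'd \<Rightarrow> complex"
proof -
  have "(\<lambda>y. cnj (modulate \<xi> (translate x \<psi>) y)) = phase_shift (x, \<xi>) (\<lambda>y. cnj (\<psi> y))"
    by (simp add: fun_eq_iff modulate_def phase_shift_def translate_def character_def exp_cnj)
  then show ?thesis by (simp add: stft_def pairing_def)
qed

lemma smooth_phase_shift: "smooth f \<Longrightarrow> smooth (phase_shift z f)"
  unfolding phase_shift_def[abs_def]
  by (rule smooth_mult[OF smooth_character smooth_translate])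

lemma phase_shift_add: "phase_shift z (\<lambda>x. f x + g x) = (\<lambda>x. phase_shift z f x + phase_shift z g x)"
  by (simp add: fun_eq_iff phase_shift_def translate_def distrib_left)

lemma phase_shift_cmult: "phase_shift z (\<lambda>x. c * f x) = (\<lambda>x. c * phase_shift z f x)"
  by (simp add: fun_eq_iff phase_shift_def translate_def)

text \<open>The point is that \<open>h'\<close>, \<open>r'\<close> and \<open>R\<close> do not
  depend on \<open>f\<close>, \<open>K\<close> or \<open>z\<close>. Translation loses the
  quasi-triangle constant \<open>c\<close> in the rate, the product with the character loses a
  factor 2 in \<open>h\<close>, and both leave at most exponential growth in
  \<open>z\<close>.\<close>

lemma gs_bound_phase_shift:
  fixes h r :: real
  assumes "0 < t" "0 < s" "0 < h" "0 < r"
  obtains h' r' R where "0 < h'" "0 < r'" "0 < R"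
    "\<And>(f :: real ^ 'd \<Rightarrow> complex) K z. smooth f \<Longrightarrow> 0 \<le> K \<Longrightarrow>
       gs_bound s h' (\<lambda>x. K * exp (- r' * weight t x)) f \<Longrightarrow>
       gs_bound s h (\<lambda>x. K * exp (R * phase_weight t s z) * exp (- r * weight t x)) (phase_shift z f)"
proof -
  define c where "c = 2 powr (1 / t)"
  define M where "M = real CARD('d) * s * (1 / (h / 2)) powr (1 / s)"
  define R where "R = c * r + M"
  have pos: "0 < c" "0 < M" using assms by (auto simp: c_def M_def)
  have "gs_bound s h (\<lambda>x. K * exp (R * phase_weight t s z) * exp (- r * weight t x)) (phase_shift z f)"
    if f: "smooth f" and K: "0 \<le> K" and b: "gs_bound s (h / 2) (\<lambda>x. K * exp (- (c * r) * weight t x)) f"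
    for f :: "real ^ 'd \<Rightarrow> complex" and K z
  proof -
    have "gs_bound s (h / 2) (\<lambda>x. exp (M * weight s (snd z))) (character (- snd z))"
      using gs_bound_character[of s "h / 2" "- snd z"] assms by (simp add: M_def)
    moreover have "gs_bound s (h / 2) (\<lambda>x. K * exp (- (c * r) * weight t (x - fst z))) (translate (fst z) f)"
      by (rule gs_bound_translate[OF f b])
    ultimately have "gs_bound s (2 * (h / 2)) (\<lambda>x. exp (M * weight s (snd z)) *
        (K * exp (- (c * r) * weight t (x - fst z)))) (\<lambda>x. character (- snd z) x * translate (fst z) f x)"
      using assms by (intro gs_bound_mult smooth_character smooth_translate f) auto
    then show ?thesis
      unfolding phase_shift_def[abs_def]
    proof (rule gs_bound_mono)
      fix x
      have "weight t x \<le> c * (weight t (x - fst z) + weight t (fst z))"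
        using weight_add[OF assms(1), of "x - fst z" "fst z"] by (simp add: c_def)
      then have "r * weight t x \<le> r * (c * (weight t (x - fst z) + weight t (fst z)))"
        using assms by simp
      \<comment> \<open>\<open>R\<close> is the sum of the translation and modulation rates, so
        these mixed terms occur in \<open>R * phase_weight t s z\<close> and are dropped.\<close>
      moreover have "0 \<le> M * weight t (fst z)" "0 \<le> c * r * weight s (snd z)"
        using pos assms by simp_all
      ultimately have "M * weight s (snd z) - (c * r) * weight t (x - fst z) \<le>
          R * phase_weight t s z - r * weight t x"
        by (simp add: R_def phase_weight_def algebra_simps)
      then have "exp (M * weight s (snd z)) * exp (- (c * r) * weight t (x - fst z)) \<le>
          exp (R * phase_weight t s z) * exp (- r * weight t x)"
        by (simp add: exp_add[symmetric])
      from mult_left_mono[OF this K]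
      show "exp (M * weight s (snd z)) * (K * exp (- (c * r) * weight t (x - fst z)))
          \<le> K * exp (R * phase_weight t s z) * exp (- r * weight t x)"
        by (simp add: mult_ac)
    qed (use assms in auto)
  qed
  moreover have "0 < h / 2" "0 < c * r" "0 < R" using assms pos by (auto simp: R_def add_pos_pos)
  ultimately show ?thesis using that by blast
qed

lemma gelfand_shilov_phase_shift:
  assumes "f \<in> gelfand_shilov t s" "0 < t" "0 < s"
  shows "phase_shift z f \<in> gelfand_shilov t s"
proof (rule gelfand_shilovI)
  fix h r :: real assume hr: "0 < h" "0 < r"
  obtain h' r' R where *: "0 < h'" "0 < r'" "0 < R" and
    bound: "\<And>(f :: real ^ 'a \<Rightarrow> complex) K z. smooth f \<Longrightarrow> 0 \<le> K \<Longrightarrow>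
       gs_bound s h' (\<lambda>x. K * exp (- r' * weight t x)) f \<Longrightarrow>
       gs_bound s h (\<lambda>x. K * exp (R * phase_weight t s z) * exp (- r * weight t x)) (phase_shift z f)"
    using gs_bound_phase_shift[OF assms(2,3) hr] by blast
  obtain C where "0 < C" "gs_bound s h' (\<lambda>x. C * exp (- r' * weight t x)) f"
    using gelfand_shilov_gs_bound[OF assms(1,2) *(1,2)] by metis
  then show "\<exists>C. gs_bound s h (\<lambda>x. C * exp (- r * weight t x)) (phase_shift z f)"
    using bound[of f C z] gelfand_shilov_smooth[OF assms(1)] by auto
qed (use assms in \<open>auto intro: smooth_phase_shift gelfand_shilov_smooth\<close>)

lemma gs_functional_phase_shift:
  fixes u :: "(real ^ 'd \<Rightarrow> complex) \<Rightarrow> complex"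
  assumes u: "gs_functional t s u" and ts: "0 < t" "0 < s"
  shows "gs_functional t s (\<lambda>f. u (phase_shift z f))"
proof -
  obtain h r C where hr: "0 < h" "0 < r" "0 < C" and
    bnd: "\<And>f K. f \<in> gelfand_shilov t s \<Longrightarrow> 0 < K \<Longrightarrow>
        gs_bound s h (\<lambda>x. K * exp (- r * weight t x)) f \<Longrightarrow> cmod (u f) \<le> C * K"
    using u unfolding gs_functional_def by blast
  obtain h' r' R where *: "0 < h'" "0 < r'" "0 < R" and
    bound: "\<And>(f :: real ^ 'd \<Rightarrow> complex) K z. smooth f \<Longrightarrow> 0 \<le> K \<Longrightarrow>
       gs_bound s h' (\<lambda>x. K * exp (- r' * weight t x)) f \<Longrightarrow>
       gs_bound s h (\<lambda>x. K * exp (R * phase_weight t s z) * exp (- r * weight t x)) (phase_shift z f)"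
    using gs_bound_phase_shift[OF ts hr(1,2)] by blast
  have "cmod (u (phase_shift z f)) \<le> C * exp (R * phase_weight t s z) * K"
    if "f \<in> gelfand_shilov t s" "0 < K" "gs_bound s h' (\<lambda>x. K * exp (- r' * weight t x)) f" for f K
    using bnd[of "phase_shift z f" "K * exp (R * phase_weight t s z)"] bound[of f K z] that ts
    by (auto simp: gelfand_shilov_phase_shift gelfand_shilov_smooth mult_ac)
  moreover have "0 < C * exp (R * phase_weight t s z)" using hr by simp
  ultimately have "\<exists>h>0. \<exists>r>0. \<exists>C>0. \<forall>f\<in>gelfand_shilov t s. \<forall>K>0.
      gs_bound s h (\<lambda>x. K * exp (- r * weight t x)) f \<longrightarrow> cmod (u (phase_shift z f)) \<le> C * K"
    using * by blast
  moreover have "u (phase_shift z (\<lambda>x. f x + g x)) = u (phase_shift z f) + u (phase_shift z g)"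
    if "f \<in> gelfand_shilov t s" "g \<in> gelfand_shilov t s" for f g
    using u that ts by (simp add: gs_functional_def phase_shift_add gelfand_shilov_phase_shift)
  moreover have "u (phase_shift z (\<lambda>x. c * f x)) = c * u (phase_shift z f)"
    if "f \<in> gelfand_shilov t s" for c f
    using u that ts by (simp add: gs_functional_def phase_shift_cmult gelfand_shilov_phase_shift)
  ultimately show ?thesis unfolding gs_functional_def by blast
qed

text \<open>The counterpart of the polynomial growth of the short-time Fourier transform of a
  tempered distribution. The rate \<open>R\<close> is dictated by \<open>u\<close> and cannot be
  prescribed.\<close>

lemma gs_functional_phase_shift_growth:
  fixes u :: "(real ^ 'd \<Rightarrow> complex) \<Rightarrow> complex"
  assumes u: "gs_functional t s u" and ts: "0 < t" "0 < s" and g: "g \<in> gelfand_shilov t s"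
  obtains C R where "0 < C" "0 < R" "\<And>z. cmod (u (phase_shift z g)) \<le> C * exp (R * phase_weight t s z)"
proof -
  obtain h r C where hr: "0 < h" "0 < r" "0 < C" and
    bnd: "\<And>f K. f \<in> gelfand_shilov t s \<Longrightarrow> 0 < K \<Longrightarrow>
        gs_bound s h (\<lambda>x. K * exp (- r * weight t x)) f \<Longrightarrow> cmod (u f) \<le> C * K"
    using u unfolding gs_functional_def by blast
  obtain h' r' R where *: "0 < h'" "0 < r'" "0 < R" and
    bound: "\<And>(f :: real ^ 'd \<Rightarrow> complex) K z. smooth f \<Longrightarrow> 0 \<le> K \<Longrightarrow>
       gs_bound s h' (\<lambda>x. K * exp (- r' * weight t x)) f \<Longrightarrow>
       gs_bound s h (\<lambda>x. K * exp (R * phase_weight t s z) * exp (- r * weight t x)) (phase_shift z f)"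
    using gs_bound_phase_shift[OF ts hr(1,2)] by blast
  obtain K where K: "0 < K" "gs_bound s h' (\<lambda>x. K * exp (- r' * weight t x)) g"
    using gelfand_shilov_gs_bound[OF g ts(1) *(1,2)] by metis
  have "cmod (u (phase_shift z g)) \<le> (C * K) * exp (R * phase_weight t s z)" for z
    using bnd[of "phase_shift z g" "K * exp (R * phase_weight t s z)"] bound[of g K z] K g ts
    by (auto simp: gelfand_shilov_phase_shift gelfand_shilov_smooth mult_ac)
  then show ?thesis using that[of "C * K" R] hr * K by simp
qed

section \<open>Integration and Fourier inversion\<close>

text \<open>\<open>lborel\<close> is the image of a product of one-dimensional measures under the
  coordinate map, so Fubini for finite products carries over.\<close>

lemma
  fixes f :: "'a::euclidean_space \<Rightarrow> real \<Rightarrow> 'b::{real_normed_field,banach,second_countable_topology}"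
  assumes f: "\<And>b. b \<in> Basis \<Longrightarrow> integrable lborel (f b)"
  shows integrable_lborel_prod: "integrable lborel (\<lambda>x. \<Prod>b\<in>Basis. f b (x \<bullet> b))"
    and integral_lborel_prod:
      "(\<integral>x. (\<Prod>b\<in>Basis. f b (x \<bullet> b)) \<partial>lborel) = (\<Prod>b\<in>Basis. \<integral>y. f b y \<partial>lborel)"
proof -
  interpret product_sigma_finite "\<lambda>_. lborel :: real measure" ..
  let ?T = "\<lambda>g. \<Sum>b\<in>Basis. g b *\<^sub>R (b::'a)"
  have T: "?T \<in> (\<Pi>\<^sub>M b\<in>Basis. lborel) \<rightarrow>\<^sub>M borel" by measurable
  have [measurable]: "f b \<in> borel_measurable borel" if "b \<in> Basis" for b
    using f[OF that] by auto
  have m: "(\<lambda>x. \<Prod>b\<in>Basis. f b (x \<bullet> b)) \<in> borel_measurable borel" by measurable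
  have eq: "(\<Prod>b\<in>Basis. f b (?T g \<bullet> b)) = (\<Prod>b\<in>Basis. f b (g b))" for g
    by (intro prod.cong) auto
  show "integrable lborel (\<lambda>x. \<Prod>b\<in>Basis. f b (x \<bullet> b))"
    by (subst lborel_eq, subst integrable_distr_eq[OF T m], unfold eq)
       (intro product_integrable_prod f; simp)
  show "(\<integral>x. (\<Prod>b\<in>Basis. f b (x \<bullet> b)) \<partial>lborel) = (\<Prod>b\<in>Basis. \<integral>y. f b y \<partial>lborel)"
    by (subst lborel_eq, subst integral_distr[OF T m], unfold eq)
       (intro product_integral_prod f; simp)
qed

lemma
  fixes f :: "'a::euclidean_space \<Rightarrow> 'b::{banach,second_countable_topology}"
  assumes c: "c \<noteq> 0"
  shows integral_lborel_affine: "(\<integral>x. f x \<partial>lborel) = \<bar>c\<bar> ^ DIM('a) *\<^sub>R (\<integral>x. f (y + c *\<^sub>R x) \<partial>lborel)"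
    and integrable_lborel_affine: "integrable lborel f \<Longrightarrow> integrable lborel (\<lambda>x. f (y + c *\<^sub>R x))"
proof -
  have 1: "integrable lborel (\<lambda>x. f (y + c *\<^sub>R x))" if "integrable lborel f" "c \<noteq> 0"
    for f :: "'a \<Rightarrow> 'b" and c y
  proof -
    have [measurable]: "f \<in> borel_measurable borel" using that by auto
    have "integrable (density (distr lborel borel (\<lambda>x. y + c *\<^sub>R x)) (\<lambda>_. \<bar>c\<bar> ^ DIM('a))) f"
      using that lborel_affine[of c y] by metis
    then have "integrable lborel (\<lambda>x. \<bar>c\<bar> ^ DIM('a) *\<^sub>R f (y + c *\<^sub>R x))"
      by (subst (asm) integrable_density) (auto simp: integrable_distr_eq)
    from integrable_scaleR_right[OF this, of "1 / \<bar>c\<bar> ^ DIM('a)"] show ?thesis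
      using that(2) by simp
  qed
  then show int: "integrable lborel f \<Longrightarrow> integrable lborel (\<lambda>x. f (y + c *\<^sub>R x))"
    using c by blast
  show "(\<integral>x. f x \<partial>lborel) = \<bar>c\<bar> ^ DIM('a) *\<^sub>R (\<integral>x. f (y + c *\<^sub>R x) \<partial>lborel)"
  proof (cases "integrable lborel f")
    case True
    then have [measurable]: "f \<in> borel_measurable borel" by auto
    show ?thesis
      by (subst lborel_affine[OF c, of y], subst integral_density)
         (auto simp: integral_distr)
  next
    case False
    \<comment> \<open>Here both integrals take the default value 0: integrability on the right would
      transfer back through the inverse affine map.\<close>
    have "\<not> integrable lborel (\<lambda>x. f (y + c *\<^sub>R x))"
    proof
      assume "integrable lborel (\<lambda>x. f (y + c *\<^sub>R x))"
      then have "integrable lborel (\<lambda>x. f (y + c *\<^sub>R ((- (1 / c)) *\<^sub>R y + (1 / c) *\<^sub>R x)))"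
        using c by (intro 1[where f="\<lambda>x. f (y + c *\<^sub>R x)"]) auto
      then show False using False c by (simp add: scaleR_right_distrib scaleR_diff_right)
    qed
    then show ?thesis using False by (simp add: not_integrable_integral_eq)
  qed
qed

lemma integrable_inverse_1_plus_square_real: "integrable lborel (\<lambda>x::real. inverse (1 + x\<^sup>2))"
  using integrable_inverse_1_plus_square by (simp add: einterval_def set_integrable_def)

text \<open>The integrand is dominated by a product of one-dimensional functions
  \<open>inverse (1 + y\<^sup>2)\<close>: the reciprocal product is polynomial of degree
  \<open>2 * DIM('a)\<close> in the norm, which the exponential of the weight outgrows.\<close>

lemma integrable_exp_weight:
  assumes t: "0 < t" and r: "0 < r"
  shows "integrable lborel (\<lambda>x::'a::euclidean_space. exp (- r * weight t x))"
proof -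
  let ?D = "DIM('a)"
  \<comment> \<open>Solves \<open>t * (1 / h) powr (1 / t) = r\<close>, so that
    \<open>power_le_fact_powr_exp\<close> produces precisely
    \<open>exp (r * weight t x)\<close>.\<close>
  define h where "h = (t / r) powr t"
  have h: "0 < h" "t * (1 / h) powr (1 / t) = r"
    using assms by (auto simp: h_def powr_powr powr_divide powr_minus_divide[symmetric])
  define C where "C = 2 ^ ?D * (1 + h ^ (2 * ?D) * fact (2 * ?D) powr t)"
  have bound: "exp (- r * weight t x) \<le> C * (\<Prod>b\<in>Basis. inverse (1 + (x \<bullet> b)\<^sup>2))" for x :: 'a
  proof -
    have "(\<Prod>b\<in>Basis. 1 + (x \<bullet> b)\<^sup>2) \<le> (\<Prod>b\<in>(Basis::'a set). 1 + (norm x)\<^sup>2)"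
      by (rule prod_mono) (auto intro!: abs_le_square_iff[THEN iffD1] simp: Basis_le_norm)
    also have "\<dots> = (1 + (norm x)\<^sup>2) ^ ?D" by simp
    also have "\<dots> \<le> 2 ^ ?D * (1 + norm x ^ (2 * ?D))"
    proof (cases "norm x \<le> 1")
      case True
      then have "(1 + (norm x)\<^sup>2) ^ ?D \<le> 2 ^ ?D"
        by (intro power_mono) (auto simp: power_le_one)
      also have "\<dots> \<le> 2 ^ ?D * (1 + norm x ^ (2 * ?D))" by simp
      finally show ?thesis .
    next
      case False
      then have "(1 + (norm x)\<^sup>2) ^ ?D \<le> (2 * (norm x)\<^sup>2) ^ ?D"
        by (intro power_mono) (auto simp: one_le_power)
      also have "\<dots> \<le> 2 ^ ?D * (1 + norm x ^ (2 * ?D))"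
        by (simp add: power_mult_distrib power_mult)
      finally show ?thesis .
    qed
    also have "\<dots> \<le> 2 ^ ?D * (1 + h ^ (2 * ?D) * fact (2 * ?D) powr t * exp (r * weight t x))"
      using power_le_fact_powr_exp[OF t h(1) norm_ge_zero, of x "2 * ?D"] unfolding h(2) weight_def by simp
    also have "\<dots> \<le> 2 ^ ?D * (exp (r * weight t x) + h ^ (2 * ?D) * fact (2 * ?D) powr t * exp (r * weight t x))"
      using r by simp
    also have "\<dots> = C * exp (r * weight t x)" by (simp add: C_def algebra_simps)
    finally have le: "(\<Prod>b\<in>Basis. 1 + (x \<bullet> b)\<^sup>2) \<le> C * exp (r * weight t x)" .
    have pos: "0 < (\<Prod>b\<in>Basis. 1 + (x \<bullet> b)\<^sup>2)" by (intro prod_pos) (auto intro: add_pos_nonneg)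
    have inv: "(\<Prod>b\<in>Basis. inverse (1 + (x \<bullet> b)\<^sup>2)) = inverse (\<Prod>b\<in>Basis. 1 + (x \<bullet> b)\<^sup>2)"
      using prod_inversef[of "\<lambda>b. 1 + (x \<bullet> b)\<^sup>2" Basis] by (simp add: o_def)
    show ?thesis
      unfolding inv using le pos by (simp add: exp_minus divide_simps mult.commute)
  qed
  have int: "integrable lborel (\<lambda>x::'a. C * (\<Prod>b\<in>Basis. inverse (1 + (x \<bullet> b)\<^sup>2)))"
    by (intro integrable_mult_right integrable_lborel_prod integrable_inverse_1_plus_square_real)
  have meas: "(\<lambda>x::'a. exp (- r * weight t x)) \<in> borel_measurable lborel"
    unfolding weight_def by measurable
  have le: "norm (exp (- r * weight t x)) \<le> norm (C * (\<Prod>b\<in>Basis. inverse (1 + (x \<bullet> b)\<^sup>2)))" for x :: 'a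
    using order_trans[OF bound[of x] abs_ge_self] by simp
  show ?thesis
    by (rule Bochner_Integration.integrable_bound[OF int meas AE_I2[OF le]])
qed

lemma integrable_lborel_product:
  fixes f :: "'a::euclidean_space \<Rightarrow> 'c::{real_normed_field,banach,second_countable_topology}"
    and g :: "'b::euclidean_space \<Rightarrow> 'c"
  assumes "integrable lborel f" "integrable lborel g"
  shows "integrable lborel (\<lambda>z. f (fst z) * g (snd z))"
proof -
  have [measurable]: "f \<in> borel_measurable borel" "g \<in> borel_measurable borel" using assms by auto
  have "integrable (lborel \<Otimes>\<^sub>M lborel) (\<lambda>z. f (fst z) * g (snd z))"
    using assms by (intro lborel_pair.Fubini_integrable) (auto simp: norm_mult intro!: integrable_mult_left integrable_norm)
  then show ?thesis by (simp add: lborel_prod)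
qed

lemma integrable_exp_phase_weight:
  assumes "0 < t" "0 < s" "0 < r"
  shows "integrable lborel (\<lambda>z. exp (- r * phase_weight t s z))"
proof -
  have "exp (- r * phase_weight t s z) = exp (- r * weight t (fst z)) * exp (- r * weight s (snd z))"
    for z :: "(real ^ 'a) \<times> (real ^ 'a)"
    by (simp add: phase_weight_def exp_add[symmetric] algebra_simps)
  then show ?thesis
    using integrable_lborel_product[OF integrable_exp_weight integrable_exp_weight] assms by simp
qed

lemma has_vector_derivative_at_iff_quotient:
  "(f has_vector_derivative D) (at x) \<longleftrightarrow> ((\<lambda>h. (f (x + h) - f x) /\<^sub>R h) \<longlongrightarrow> D) (at 0)"
proof -
  have "(f has_vector_derivative D) (at x) \<longleftrightarrow>
      ((\<lambda>h. norm (f (x + h) - f x - h *\<^sub>R D) / norm h) \<longlongrightarrow> 0) (at 0)"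
    by (simp add: has_vector_derivative_def has_derivative_at bounded_linear_scaleR_left)
  also have "\<dots> \<longleftrightarrow> ((\<lambda>h. norm ((f (x + h) - f x) /\<^sub>R h - D)) \<longlongrightarrow> 0) (at 0)"
  proof (rule tendsto_cong)
    have "norm (f (x + h) - f x - h *\<^sub>R D) / norm h = norm ((f (x + h) - f x) /\<^sub>R h - D)" if "h \<noteq> 0" for h
    proof -
      have "(f (x + h) - f x) /\<^sub>R h - D = (f (x + h) - f x - h *\<^sub>R D) /\<^sub>R h"
        using that by (simp add: scaleR_diff_right)
      then show ?thesis by (simp add: divide_inverse mult.commute)
    qed
    then show "\<forall>\<^sub>F h in at 0. norm (f (x + h) - f x - h *\<^sub>R D) / norm h = norm ((f (x + h) - f x) /\<^sub>R h - D)"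
      by (auto simp: eventually_at_filter)
  qed
  also have "\<dots> \<longleftrightarrow> ((\<lambda>h. (f (x + h) - f x) /\<^sub>R h) \<longlongrightarrow> D) (at 0)"
    by (simp add: tendsto_norm_zero_iff LIM_zero_iff)
  finally show ?thesis .
qed

section \<open>Differentiation under the integral sign\<close>

lemma has_partial_difference_bound:
  assumes "has_partial i f f'"
    and "\<And>\<sigma>. \<bar>\<sigma>\<bar> \<le> 1 \<Longrightarrow> cmod (f' (x + \<sigma> *\<^sub>R axis i 1)) \<le> B" and "\<bar>\<tau>\<bar> \<le> 1"
  shows "cmod (f (x + \<tau> *\<^sub>R axis i 1) - f x) \<le> B * \<bar>\<tau>\<bar>"
proof -
  have "norm (f (x + \<tau> *\<^sub>R axis i 1) - f (x + 0 *\<^sub>R axis i 1)) \<le> B * norm (\<tau> - 0)"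
  proof (rule differentiable_bound[where S="{-1..1}" and f="\<lambda>\<sigma>. f (x + \<sigma> *\<^sub>R axis i 1)" and
        f'="\<lambda>\<sigma> h. h *\<^sub>R f' (x + \<sigma> *\<^sub>R axis i 1)"])
    fix \<sigma> :: real assume \<sigma>: "\<sigma> \<in> {-1..1}"
    show "((\<lambda>\<sigma>. f (x + \<sigma> *\<^sub>R axis i 1)) has_derivative (\<lambda>h. h *\<^sub>R f' (x + \<sigma> *\<^sub>R axis i 1))) (at \<sigma> within {-1..1})"
      using has_partial_along[OF assms(1), of x \<sigma>]
      by (auto simp: has_vector_derivative_def intro: has_derivative_at_withinI)
    have "cmod (f' (x + \<sigma> *\<^sub>R axis i 1)) \<le> B" using \<sigma> by (intro assms(2)) auto
    then show "onorm (\<lambda>h. h *\<^sub>R f' (x + \<sigma> *\<^sub>R axis i 1)) \<le> B"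
      by (intro onorm_le) (simp add: mult.commute[of B] mult_left_mono)
  qed (use assms(3) in auto)
  then show ?thesis by simp
qed

text \<open>By the mean value inequality a majorant of the derivative on a unit segment also
  dominates the difference quotients; dominated convergence then applies along every null
  sequence.\<close>

lemma has_partial_integral:
  fixes q q' :: "'z::euclidean_space \<Rightarrow> real ^ 'd \<Rightarrow> complex"
  assumes deriv: "\<And>z. has_partial i (q z) (q' z)"
    and int: "\<And>x. integrable lborel (\<lambda>z. q z x)"
    and dom: "\<And>x. \<exists>b. integrable lborel b \<and>
      (\<forall>z \<sigma>. \<bar>\<sigma>\<bar> \<le> 1 \<longrightarrow> cmod (q' z (x + \<sigma> *\<^sub>R axis i 1)) \<le> b z)"
  shows "has_partial i (\<lambda>x. \<integral>z. q z x \<partial>lborel) (\<lambda>x. \<integral>z. q' z x \<partial>lborel)"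
  unfolding has_partial_def has_vector_derivative_at_iff_quotient tendsto_at_iff_sequentially o_def
proof (intro allI impI)
  fix x :: "real ^ 'd" and X :: "nat \<Rightarrow> real"
  assume X0: "\<forall>n. X n \<in> UNIV - {0}" and X: "X \<longlonglongrightarrow> 0"
  let ?e = "axis i 1 :: real ^ 'd"
  obtain b where b: "integrable lborel b"
    "\<And>z \<sigma>. \<bar>\<sigma>\<bar> \<le> 1 \<Longrightarrow> cmod (q' z (x + \<sigma> *\<^sub>R ?e)) \<le> b z"
    using dom by blast
  obtain N where N: "\<And>n. N \<le> n \<Longrightarrow> \<bar>X n\<bar> \<le> 1"
    using LIMSEQ_D[OF X, of 1] by (auto intro: less_imp_le)
  define Y where "Y n = X (n + N)" for n
  have Y: "Y n \<noteq> 0" "\<bar>Y n\<bar> \<le> 1" "Y \<longlonglongrightarrow> 0" for n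
    using X0 N[of "n + N"] LIMSEQ_ignore_initial_segment[OF X, of N] by (auto simp: Y_def[abs_def])
  define D where "D n z = (q z (x + Y n *\<^sub>R ?e) - q z x) /\<^sub>R Y n" for n z
  have intD: "integrable lborel (D n)" for n
    unfolding D_def[abs_def] by (intro integrable_scaleR_right Bochner_Integration.integrable_diff int)
  have lim: "(\<lambda>n. D n z) \<longlonglongrightarrow> q' z x" for z
    using deriv[of z] Y unfolding has_partial_def has_vector_derivative_at_iff_quotient
      tendsto_at_iff_sequentially o_def D_def by auto
  have bound: "cmod (D n z) \<le> b z" for n z
  proof -
    have "cmod (q z (x + Y n *\<^sub>R ?e) - q z x) \<le> b z * \<bar>Y n\<bar>"
      by (rule has_partial_difference_bound[OF deriv b(2) Y(2)])
    moreover have "cmod (D n z) = cmod (q z (x + Y n *\<^sub>R ?e) - q z x) / \<bar>Y n\<bar>"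
      by (simp add: D_def divide_inverse mult.commute)
    ultimately show ?thesis using Y(1)[of n] by (simp add: pos_divide_le_eq)
  qed
  have "(\<lambda>n. integral\<^sup>L lborel (D n)) \<longlonglongrightarrow> (\<integral>z. q' z x \<partial>lborel)"
  proof (rule integral_dominated_convergence[where w=b])
    \<comment> \<open>The derivative inherits measurability in \<open>z\<close> as a pointwise limit
      of difference quotients.\<close>
    show "(\<lambda>z. q' z x) \<in> borel_measurable lborel"
      by (rule borel_measurable_LIMSEQ_metric[OF _ lim]) (use intD in auto)
  qed (use intD lim bound b in auto)
  moreover have "integral\<^sup>L lborel (D n) =
      ((\<integral>z. q z (x + Y n *\<^sub>R ?e) \<partial>lborel) - (\<integral>z. q z x \<partial>lborel)) /\<^sub>R Y n" for n
    unfolding D_def by (simp add: int)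
  ultimately have "(\<lambda>n. ((\<integral>z. q z (x + X (n + N) *\<^sub>R ?e) \<partial>lborel) - (\<integral>z. q z x \<partial>lborel)) /\<^sub>R X (n + N))
      \<longlonglongrightarrow> (\<integral>z. q' z x \<partial>lborel)"
    by (simp add: Y_def)
  then show "(\<lambda>n. ((\<integral>z. q z (x + (0 + X n) *\<^sub>R ?e) \<partial>lborel) - (\<integral>z. q z (x + 0 *\<^sub>R ?e) \<partial>lborel)) /\<^sub>R X n)
      \<longlonglongrightarrow> (\<integral>z. q' z x \<partial>lborel)"
    using LIMSEQ_offset[of "\<lambda>n. ((\<integral>z. q z (x + X n *\<^sub>R ?e) \<partial>lborel) - (\<integral>z. q z x \<partial>lborel)) /\<^sub>R X n" N] by simp
qed

section \<open>Gaussians and Fourier inversion\<close>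

definition gaussian :: "'a::euclidean_space \<Rightarrow> real" where
  "gaussian x = exp (- (norm x)\<^sup>2 / 2)"

lemma gaussian_eq_prod: "gaussian x = (\<Prod>b\<in>Basis. exp (- (x \<bullet> b)\<^sup>2 / 2))"
proof -
  have "(norm x)\<^sup>2 = (\<Sum>b\<in>Basis. (x \<bullet> b)\<^sup>2)"
    by (simp add: norm_eq_sqrt_inner euclidean_inner[of x x] sum_nonneg power2_eq_square)
  then show ?thesis
    by (simp add: gaussian_def exp_sum[symmetric] sum_negf sum_divide_distrib)
qed

lemma gaussian_nonneg [simp]: "0 \<le> gaussian x"
  by (simp add: gaussian_def)

text \<open>The integral is the characteristic function of the standard normal distribution, up to
  normalisation.\<close>

lemma
  fixes a :: real
  shows integrable_character_gaussian_real:
      "integrable lborel (\<lambda>x. exp (\<i> * of_real (a * x)) * of_real (exp (- x\<^sup>2 / 2)))"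
    and integral_character_gaussian_real:
      "(\<integral>x. exp (\<i> * of_real (a * x)) * of_real (exp (- x\<^sup>2 / 2)) \<partial>lborel) =
        of_real (sqrt (2 * pi) * exp (- a\<^sup>2 / 2))"
proof -
  have eq: "exp (\<i> * of_real (a * x)) * complex_of_real (exp (- x\<^sup>2 / 2)) =
      of_real (sqrt (2 * pi)) * (std_normal_density x *\<^sub>R iexp (a * x))" for x
    by (simp add: std_normal_density_def scaleR_conv_of_real)
  have int: "integrable lborel (\<lambda>x. std_normal_density x *\<^sub>R iexp (a * x))"
  proof (rule Bochner_Integration.integrable_bound)
    show "integrable lborel std_normal_density" by simp
  qed (auto simp: norm_mult)
  show "integrable lborel (\<lambda>x. exp (\<i> * of_real (a * x)) * of_real (exp (- x\<^sup>2 / 2)))"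
    unfolding eq using int by (intro integrable_mult_right)
  have "char std_normal_distribution a = (\<integral>x. std_normal_density x *\<^sub>R iexp (a * x) \<partial>lborel)"
    unfolding char_def by (subst integral_density) auto
  then have "(\<integral>x. std_normal_density x *\<^sub>R iexp (a * x) \<partial>lborel) = of_real (exp (- a\<^sup>2 / 2))"
    by (simp add: char_std_normal_distribution)
  then show "(\<integral>x. exp (\<i> * of_real (a * x)) * of_real (exp (- x\<^sup>2 / 2)) \<partial>lborel) =
        of_real (sqrt (2 * pi) * exp (- a\<^sup>2 / 2))"
    unfolding eq by (subst integral_mult_right_zero) simp
qed

lemma
  fixes v :: "real ^ 'd"
  shows integrable_character_gaussian: "integrable lborel (\<lambda>x. character v x * of_real (gaussian x))"
    and integral_character_gaussian: "(\<integral>x. character v x * of_real (gaussian x) \<partial>lborel) =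
      of_real (sqrt (2 * pi) ^ CARD('d) * gaussian v)"
proof -
  have eq: "character v x * of_real (gaussian x) =
      (\<Prod>b\<in>Basis. exp (\<i> * of_real ((v \<bullet> b) * (x \<bullet> b))) * of_real (exp (- (x \<bullet> b)\<^sup>2 / 2)))" for x
  proof -
    have "character v x = (\<Prod>b\<in>Basis. exp (\<i> * of_real ((v \<bullet> b) * (x \<bullet> b))))"
      by (simp add: character_def euclidean_inner[of x v] exp_sum[symmetric] sum_distrib_left mult.commute)
    then show ?thesis by (simp add: gaussian_eq_prod prod.distrib)
  qed
  show "integrable lborel (\<lambda>x. character v x * of_real (gaussian x))"
    unfolding eq by (intro integrable_lborel_prod integrable_character_gaussian_real)
  have "(\<integral>x. character v x * of_real (gaussian x) \<partial>lborel) =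
      (\<Prod>b\<in>Basis. of_real (sqrt (2 * pi) * exp (- (v \<bullet> b)\<^sup>2 / 2)))"
    unfolding eq by (subst integral_lborel_prod) (simp_all only: integrable_character_gaussian_real integral_character_gaussian_real)
  also have "\<dots> = of_real (sqrt (2 * pi) ^ CARD('d) * gaussian v)"
    by (simp add: prod.distrib gaussian_eq_prod)
  finally show "(\<integral>x. character v x * of_real (gaussian x) \<partial>lborel) = \<dots>" .
qed

lemma
  shows integrable_gaussian: "integrable lborel (gaussian :: real ^ 'd \<Rightarrow> real)"
    and integral_gaussian: "(\<integral>x. gaussian (x :: real ^ 'd) \<partial>lborel) = sqrt (2 * pi) ^ CARD('d)"
proof -
  have 0: "character 0 x = 1" for x :: "real ^ 'd" by (simp add: character_def)
  show int: "integrable lborel (gaussian :: real ^ 'd \<Rightarrow> real)"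
    using integrable_Re[OF integrable_character_gaussian[of "0 :: real ^ 'd"]] by (simp add: 0)
  have "of_real (\<integral>x. gaussian (x :: real ^ 'd) \<partial>lborel) = complex_of_real (sqrt (2 * pi) ^ CARD('d))"
    using integral_character_gaussian[of "0 :: real ^ 'd"] by (simp add: 0 gaussian_def)
  then show "(\<integral>x. gaussian (x :: real ^ 'd) \<partial>lborel) = sqrt (2 * pi) ^ CARD('d)"
    by (simp only: of_real_eq_iff)
qed

text \<open>
  The dilated Gaussian \<open>gaussian (\<epsilon> \<eta>)\<close> regularises the inverse Fourier integral into the convolution
  of \<open>f\<close> with an approximate identity.
\<close>

lemma fourier_inversion:
  fixes f :: "real ^ 'd \<Rightarrow> complex"
  assumes int: "integrable lborel f" and cont: "continuous_on UNIV f" and bnd: "\<And>x. cmod (f x) \<le> B"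
    and int': "integrable lborel (\<lambda>\<eta>. \<integral>x. f x * character \<eta> x \<partial>lborel)"
  shows "(\<integral>\<eta>. (\<integral>x. f x * character \<eta> x \<partial>lborel) * character (- \<eta>) w \<partial>lborel) =
    of_real ((2 * pi) ^ CARD('d)) * f w"
proof -
  let ?F = "\<lambda>\<eta>. \<integral>x. f x * character \<eta> x \<partial>lborel"
  let ?c = "sqrt (2 * pi) ^ CARD('d)"
  have [measurable]: "f \<in> borel_measurable borel" using int by auto
  have [measurable]: "gaussian \<in> borel_measurable (borel :: (real ^ 'd) measure)"
    using integrable_gaussian by auto
  have [measurable]: "(\<lambda>x. character (f x) (g x)) \<in> borel_measurable M"
    if "f \<in> borel_measurable M" "g \<in> borel_measurable M" for f g :: "'x \<Rightarrow> real ^ 'd" and M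
    unfolding character_def using that by measurable
  define I where "I \<epsilon> = (\<integral>\<eta>. ?F \<eta> * character (- \<eta>) w * of_real (gaussian (\<epsilon> *\<^sub>R \<eta>)) \<partial>lborel)" for \<epsilon>
  \<comment> \<open>Fubini integrates the frequency out first, which gives a Gaussian of width
    \<open>\<epsilon>\<close> around \<open>w\<close>. Substituting
    \<open>w + \<epsilon> *\<^sub>R v\<close> for the variable then cancels all powers of
    \<open>\<epsilon>\<close>.\<close>
  have I_eq: "I \<epsilon> = of_real ?c * (\<integral>v. f (w + \<epsilon> *\<^sub>R v) * of_real (gaussian v) \<partial>lborel)" if \<epsilon>: "0 < \<epsilon>" for \<epsilon>
  proof -
    let ?q = "\<lambda>\<eta> x. f x * (character \<eta> (x - w) * of_real (gaussian (\<epsilon> *\<^sub>R \<eta>)))"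
    have g: "integrable lborel (\<lambda>\<eta>. complex_of_real (gaussian (\<epsilon> *\<^sub>R \<eta> :: real ^ 'd)))"
      using integrable_lborel_affine[of \<epsilon> "gaussian :: real ^ 'd \<Rightarrow> real" 0] integrable_gaussian \<epsilon>
      by (intro integrable_of_real) simp
    have "integrable lborel (\<lambda>z. case_prod ?q z)"
    proof (rule Bochner_Integration.integrable_bound)
      show "integrable lborel (\<lambda>z :: (real ^ 'd) \<times> (real ^ 'd).
          complex_of_real (gaussian (\<epsilon> *\<^sub>R fst z)) * f (snd z))"
        by (rule integrable_lborel_product[OF g int])
      have "(\<lambda>z. case_prod ?q z) \<in> borel_measurable (borel \<Otimes>\<^sub>M borel)" by measurable
      then show "(\<lambda>z. case_prod ?q z) \<in> borel_measurable lborel" by (simp add: borel_prod)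
    qed (auto simp: norm_mult)
    then have fub: "(\<integral>\<eta>. (\<integral>x. ?q \<eta> x \<partial>lborel) \<partial>lborel) = (\<integral>x. (\<integral>\<eta>. ?q \<eta> x \<partial>lborel) \<partial>lborel)"
      by (intro lborel_pair.Fubini_integral[symmetric]) (simp add: lborel_prod)
    have ch: "character \<eta> (x - w) = character \<eta> x * character (- \<eta>) w" for \<eta> x :: "real ^ 'd"
      by (simp add: character_def exp_add[symmetric] inner_diff_left algebra_simps)
    have "I \<epsilon> = (\<integral>\<eta>. (\<integral>x. ?q \<eta> x \<partial>lborel) \<partial>lborel)"
      unfolding I_def
    proof (rule Bochner_Integration.integral_cong)
      fix \<eta>
      have "(\<integral>x. ?q \<eta> x \<partial>lborel) = (\<integral>x. f x * character \<eta> x * (character (- \<eta>) w * of_real (gaussian (\<epsilon> *\<^sub>R \<eta>))) \<partial>lborel)"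
        by (simp add: ch mult_ac)
      also have "\<dots> = ?F \<eta> * (character (- \<eta>) w * of_real (gaussian (\<epsilon> *\<^sub>R \<eta>)))"
        by (rule integral_mult_left_zero)
      finally show "?F \<eta> * character (- \<eta>) w * of_real (gaussian (\<epsilon> *\<^sub>R \<eta>)) = (\<integral>x. ?q \<eta> x \<partial>lborel)"
        by (simp add: mult.assoc)
    qed simp
    also have "\<dots> = (\<integral>x. f x * of_real (?c * (1 / \<epsilon>) ^ CARD('d) * gaussian ((1 / \<epsilon>) *\<^sub>R (x - w))) \<partial>lborel)"
      unfolding fub
    proof (rule Bochner_Integration.integral_cong)
      fix x
      have "(\<integral>\<eta>. character \<eta> (x - w) * of_real (gaussian (\<epsilon> *\<^sub>R \<eta>)) \<partial>lborel) =
          \<bar>1 / \<epsilon>\<bar> ^ CARD('d) *\<^sub>R (\<integral>\<eta>. character ((1 / \<epsilon>) *\<^sub>R (x - w)) \<eta> * complex_of_real (gaussian \<eta>) \<partial>lborel)"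
        using \<epsilon> by (subst integral_lborel_affine[of "1 / \<epsilon>" _ 0]) (auto simp: character_def inner_commute)
      also have "\<dots> = of_real (?c * (1 / \<epsilon>) ^ CARD('d) * gaussian ((1 / \<epsilon>) *\<^sub>R (x - w)))"
        using \<epsilon> by (simp add: integral_character_gaussian scaleR_conv_of_real)
      finally show "(\<integral>\<eta>. ?q \<eta> x \<partial>lborel) = f x * of_real (?c * (1 / \<epsilon>) ^ CARD('d) * gaussian ((1 / \<epsilon>) *\<^sub>R (x - w)))"
        by simp
    qed simp
    also have "\<dots> = \<bar>\<epsilon>\<bar> ^ CARD('d) *\<^sub>R
        (\<integral>v. f (w + \<epsilon> *\<^sub>R v) * of_real (?c * (1 / \<epsilon>) ^ CARD('d) * gaussian v) \<partial>lborel)"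
      using \<epsilon> by (subst integral_lborel_affine[of \<epsilon> _ w]) auto
    also have "\<dots> = \<bar>\<epsilon>\<bar> ^ CARD('d) *\<^sub>R
        (of_real (?c * (1 / \<epsilon>) ^ CARD('d)) * (\<integral>v. f (w + \<epsilon> *\<^sub>R v) * of_real (gaussian v) \<partial>lborel))"
      by (subst integral_mult_right_zero[symmetric]) (simp add: mult_ac)
    also have "\<dots> = of_real ?c * (\<integral>v. f (w + \<epsilon> *\<^sub>R v) * of_real (gaussian v) \<partial>lborel)"
      using \<epsilon> by (simp add: scaleR_conv_of_real power_one_over)
    finally show ?thesis .
  qed
  define \<epsilon> where "\<epsilon> n = inverse (real (Suc n))" for n
  have \<epsilon>: "\<epsilon> \<longlonglongrightarrow> 0" "0 < \<epsilon> n" for n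
    using LIMSEQ_inverse_real_of_nat by (auto simp: \<epsilon>_def[abs_def])
  have "(\<lambda>n. I (\<epsilon> n)) \<longlonglongrightarrow> (\<integral>\<eta>. ?F \<eta> * character (- \<eta>) w \<partial>lborel)"
    unfolding I_def
  proof (rule integral_dominated_convergence[where w="\<lambda>\<eta>. cmod (?F \<eta>)"])
    have [measurable]: "?F \<in> borel_measurable borel" using int' by auto
    show "(\<lambda>\<eta>. ?F \<eta> * character (- \<eta>) w) \<in> borel_measurable lborel" by measurable
    show "(\<lambda>\<eta>. ?F \<eta> * character (- \<eta>) w * of_real (gaussian (\<epsilon> n *\<^sub>R \<eta>))) \<in> borel_measurable lborel" for n
      by measurable
    show "integrable lborel (\<lambda>\<eta>. cmod (?F \<eta>))" using int' by (rule integrable_norm)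
    show "AE \<eta> in lborel. (\<lambda>n. ?F \<eta> * character (- \<eta>) w * of_real (gaussian (\<epsilon> n *\<^sub>R \<eta>)))
        \<longlonglongrightarrow> ?F \<eta> * character (- \<eta>) w"
    proof (rule AE_I2)
      fix \<eta> :: "real ^ 'd"
      have "(\<lambda>n. gaussian (\<epsilon> n *\<^sub>R \<eta>)) \<longlonglongrightarrow> exp (- (norm (0 *\<^sub>R \<eta>))\<^sup>2 / 2)"
        unfolding gaussian_def by (intro tendsto_intros \<epsilon>) auto
      then have "(\<lambda>n. ?F \<eta> * character (- \<eta>) w * of_real (gaussian (\<epsilon> n *\<^sub>R \<eta>)))
        \<longlonglongrightarrow> ?F \<eta> * character (- \<eta>) w * of_real (exp (- (norm (0 *\<^sub>R \<eta>))\<^sup>2 / 2))"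
        by (intro tendsto_intros)
      then show "(\<lambda>n. ?F \<eta> * character (- \<eta>) w * of_real (gaussian (\<epsilon> n *\<^sub>R \<eta>)))
        \<longlonglongrightarrow> ?F \<eta> * character (- \<eta>) w" by simp
    qed
    show "AE \<eta> in lborel. cmod (?F \<eta> * character (- \<eta>) w * of_real (gaussian (\<epsilon> n *\<^sub>R \<eta>))) \<le> cmod (?F \<eta>)" for n
      by (auto simp: norm_mult gaussian_def intro!: mult_left_le)
  qed
  moreover have "(\<lambda>n. I (\<epsilon> n)) \<longlonglongrightarrow> of_real ?c * (\<integral>v. f w * of_real (gaussian (v :: real ^ 'd)) \<partial>lborel)"
    unfolding I_eq[OF \<epsilon>(2)]
  proof (rule tendsto_mult[OF tendsto_const], rule integral_dominated_convergence[where w="\<lambda>v. B * gaussian v"])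
    show "integrable lborel (\<lambda>v :: real ^ 'd. B * gaussian v)"
      using integrable_gaussian by (intro integrable_mult_right)
    show "AE v in lborel. (\<lambda>n. f (w + \<epsilon> n *\<^sub>R v) * of_real (gaussian v)) \<longlonglongrightarrow> f w * of_real (gaussian v)"
    proof (rule AE_I2)
      fix v :: "real ^ 'd"
      have "(\<lambda>n. w + \<epsilon> n *\<^sub>R v) \<longlonglongrightarrow> w + 0 *\<^sub>R v" by (intro tendsto_intros \<epsilon>)
      then have "(\<lambda>n. f (w + \<epsilon> n *\<^sub>R v)) \<longlonglongrightarrow> f w"
        using continuous_on_tendsto_compose[OF cont, of "\<lambda>n. w + \<epsilon> n *\<^sub>R v" w] by simp
      then show "(\<lambda>n. f (w + \<epsilon> n *\<^sub>R v) * of_real (gaussian v)) \<longlonglongrightarrow> f w * of_real (gaussian v)"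
        by (intro tendsto_intros)
    qed
    show "AE v in lborel. cmod (f (w + \<epsilon> n *\<^sub>R v) * of_real (gaussian v)) \<le> B * gaussian v" for n
      using bnd by (auto simp: norm_mult intro!: mult_right_mono)
  qed (measurable)
  ultimately have "(\<integral>\<eta>. ?F \<eta> * character (- \<eta>) w \<partial>lborel) = of_real ?c * (\<integral>v. f w * of_real (gaussian (v :: real ^ 'd)) \<partial>lborel)"
    by (rule LIMSEQ_unique)
  also have "\<dots> = of_real ?c * (f w * of_real (\<integral>v. gaussian (v :: real ^ 'd) \<partial>lborel))"
    by (simp add: integral_complex_of_real)
  \<comment> \<open>One factor \<open>?c\<close> comes from the Fourier transform of the Gaussian,
    the other from its total mass.\<close>
  also have "\<dots> = of_real (?c * ?c) * f w"
    unfolding integral_gaussian of_real_mult by (simp only: mult_ac)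
  also have "?c * ?c = (sqrt (2 * pi) * sqrt (2 * pi)) ^ CARD('d)"
    by (rule power_mult_distrib[symmetric])
  also have "sqrt (2 * pi) * sqrt (2 * pi) = 2 * pi"
    by (rule real_sqrt_mult_self[THEN trans]) simp
  finally show ?thesis .
qed

section \<open>Reconstruction from the short-time Fourier transform\<close>

lemma integrable_of_decay:
  fixes f :: "'a::euclidean_space \<Rightarrow> complex"
  assumes "continuous_on UNIV f" "\<And>x. cmod (f x) \<le> C * exp (- r * weight t x)" "0 < t" "0 < r"
  shows "integrable lborel f"
proof (rule Bochner_Integration.integrable_bound)
  show "integrable lborel (\<lambda>x::'a. C * exp (- r * weight t x))"
    using assms by (intro integrable_mult_right integrable_exp_weight)
  show "f \<in> borel_measurable lborel"
    using assms(1) by (simp add: borel_measurable_continuous_onI)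
  show "AE x in lborel. norm (f x) \<le> norm (C * exp (- r * weight t x))"
    by (rule AE_I2) (use order_trans[OF assms(2) abs_ge_self] in simp)
qed

text \<open>Provides a majorant uniform over unit segments, as \<open>has_partial_integral\<close>
  requires: a shift by at most 1 costs a constant and part of the rate.\<close>

lemma exp_weight_shift:
  fixes x :: "real ^ 'd"
  assumes "0 < t" "0 < r" "\<bar>\<sigma>\<bar> \<le> 1"
  shows "exp (- r * weight t (x + \<sigma> *\<^sub>R axis i 1)) \<le> exp r * exp (- (r / 2 powr (1 / t)) * weight t x)"
proof -
  let ?c = "2 powr (1 / t) :: real"
  have "weight t x \<le> ?c * (weight t (x + \<sigma> *\<^sub>R axis i 1) + weight t (- (\<sigma> *\<^sub>R axis i 1 :: real ^ 'd)))"
    using weight_add[OF assms(1), of "x + \<sigma> *\<^sub>R axis i 1" "- (\<sigma> *\<^sub>R axis i 1)"] by simp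
  also have "weight t (- (\<sigma> *\<^sub>R axis i 1 :: real ^ 'd)) \<le> 1"
    using assms by (simp add: weight_def powr_le1)
  finally have "weight t x \<le> ?c * (weight t (x + \<sigma> *\<^sub>R axis i 1) + 1)" by simp
  then have "weight t x / ?c \<le> weight t (x + \<sigma> *\<^sub>R axis i 1) + 1"
    by (simp add: pos_divide_le_eq mult.commute)
  then have "r * (weight t x / ?c) \<le> r * (weight t (x + \<sigma> *\<^sub>R axis i 1) + 1)"
    using assms by (intro mult_left_mono) auto
  then show ?thesis
    by (simp add: exp_add[symmetric] algebra_simps)
qed

text \<open>By translation invariance the integral of \<open>q (z + x)\<close> over \<open>z\<close>
  is constant in \<open>x\<close>; differentiating it under the integral sign gives the claim
  without slicing along coordinates.\<close>

lemma integral_partial_eq_0: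
  fixes q :: "real ^ 'd \<Rightarrow> complex"
  assumes q: "smooth q" and tr: "0 < t" "0 < r"
    and b: "\<And>x. cmod (q x) \<le> C * exp (- r * weight t x)"
    and b': "\<And>x. cmod (partial i q x) \<le> C * exp (- r * weight t x)"
  shows "(\<integral>x. partial i q x \<partial>lborel) = 0"
proof -
  have int: "integrable lborel q"
    by (rule integrable_of_decay[OF smooth_continuous[OF q] b tr])
  have C: "0 \<le> C"
    using order_trans[OF norm_ge_zero b[of 0]] by (simp add: zero_le_mult_iff)
  have shift: "(\<integral>z. k (z + x) \<partial>lborel) = (\<integral>z. k z \<partial>lborel)"
    "integrable lborel (\<lambda>z. l (z + x))" if "integrable lborel l"
    for k :: "real ^ 'd \<Rightarrow> complex" and l :: "real ^ 'd \<Rightarrow> 'b::{banach,second_countable_topology}" and x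
    using integral_lborel_affine[of 1 k x] integrable_lborel_affine[of 1 l x] that by (simp_all add: add.commute)
  have "has_partial i (\<lambda>x. \<integral>z. q (z + x) \<partial>lborel) (\<lambda>x. \<integral>z. partial i q (z + x) \<partial>lborel)"
  proof (rule has_partial_integral)
    show "has_partial i (\<lambda>x. q (z + x)) (\<lambda>x. partial i q (z + x))" for z
      using has_partial_translate[OF smooth_has_partial[OF q], of i "- z"]
      by (simp add: translate_def[abs_def] add.commute)
    show "integrable lborel (\<lambda>z. q (z + x))" for x
      using int by (rule shift)
    fix x :: "real ^ 'd"
    let ?b = "\<lambda>z. (C * exp r) * exp (- (r / 2 powr (1 / t)) * weight t (z + x))"
    have "integrable lborel ?b"
      using tr by (intro integrable_mult_right shift integrable_exp_weight) auto
    moreover have "cmod (partial i q (z + (x + \<sigma> *\<^sub>R axis i 1))) \<le> ?b z" if "\<bar>\<sigma>\<bar> \<le> 1" for z \<sigma>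
    proof -
      have "cmod (partial i q (z + (x + \<sigma> *\<^sub>R axis i 1))) \<le> C * exp (- r * weight t (z + x + \<sigma> *\<^sub>R axis i 1))"
        using b'[of "z + x + \<sigma> *\<^sub>R axis i 1"] by (simp add: add.assoc)
      also have "\<dots> \<le> C * (exp r * exp (- (r / 2 powr (1 / t)) * weight t (z + x)))"
        using C tr that by (intro mult_left_mono exp_weight_shift) auto
      finally show ?thesis by (simp add: mult.assoc)
    qed
    ultimately show "\<exists>b. integrable lborel b \<and>
        (\<forall>z \<sigma>. \<bar>\<sigma>\<bar> \<le> 1 \<longrightarrow> cmod (partial i q (z + (x + \<sigma> *\<^sub>R axis i 1))) \<le> b z)"
      by blast
  qed
  then have "has_partial i (\<lambda>x. \<integral>z. q z \<partial>lborel) (\<lambda>x. \<integral>z. partial i q z \<partial>lborel)"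
    by (simp add: shift(1)[OF int])
  then have "(\<lambda>x :: real ^ 'd. \<integral>z. partial i q z \<partial>lborel) = (\<lambda>x. 0)"
    using has_partial_imp_partial has_partial_const by metis
  then show ?thesis by meson
qed

text \<open>Integration by parts: the derivative of \<open>?k x * character \<eta> x\<close>
  integrates to 0, so each derivative moved onto the character yields a factor of modulus
  \<open>\<bar>\<eta> $ i\<bar>\<close>.\<close>

lemma fourier_integral_partials:
  fixes k :: "real ^ 'd \<Rightarrow> complex"
  assumes k: "smooth k" and tr: "0 < t" "0 < r"
    and b: "\<And>is. \<exists>C. \<forall>x. cmod (partials is k x) \<le> C * exp (- r * weight t x)"
  shows "\<bar>\<eta> $ i\<bar> ^ n * cmod (\<integral>x. k x * character \<eta> x \<partial>lborel) =
    cmod (\<integral>x. partials (replicate n i) k x * character \<eta> x \<partial>lborel)"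
proof (induction n)
  case (Suc n)
  let ?k = "partials (replicate n i) k"
  have sm: "smooth ?k" by (rule smooth_partials[OF k])
  obtain C where C: "\<And>x. cmod (?k x) \<le> C * exp (- r * weight t x)" using b by blast
  obtain C' where C': "\<And>x. cmod (partials (i # replicate n i) k x) \<le> C' * exp (- r * weight t x)"
    using b by blast
  have nonneg: "0 \<le> C" "0 \<le> C'"
    using order_trans[OF norm_ge_zero C[of 0]] order_trans[OF norm_ge_zero C'[of 0]]
    by (simp_all add: zero_le_mult_iff)
  have eq: "partial i (\<lambda>x. ?k x * character \<eta> x) =
      (\<lambda>x. partials (i # replicate n i) k x * character \<eta> x + (\<i> * of_real (\<eta> $ i)) * (?k x * character \<eta> x))"
    unfolding partial_mult[OF sm smooth_character] partial_character partials_Cons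
    by (simp add: mult_ac)
  have int: "integrable lborel (\<lambda>x. ?k x * character \<eta> x)"
    "integrable lborel (\<lambda>x. partials (i # replicate n i) k x * character \<eta> x)"
    using C C' tr
    by (auto intro!: integrable_of_decay[of _ _ r t] continuous_intros smooth_continuous_partials k
        simp: norm_mult)
  have "(\<integral>x. partial i (\<lambda>x. ?k x * character \<eta> x) x \<partial>lborel) = 0"
  proof (rule integral_partial_eq_0[OF smooth_mult[OF sm smooth_character] tr])
    let ?C = "C' + \<bar>\<eta> $ i\<bar> * C + C"
    fix x
    have "cmod (?k x * character \<eta> x) \<le> C * exp (- r * weight t x)" using C by (simp add: norm_mult)
    also have "\<dots> \<le> ?C * exp (- r * weight t x)"
      using nonneg by (intro mult_right_mono) auto
    finally show "cmod (?k x * character \<eta> x) \<le> ?C * exp (- r * weight t x)" .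
    have "cmod (partial i (\<lambda>x. ?k x * character \<eta> x) x) \<le>
        cmod (partials (i # replicate n i) k x) + \<bar>\<eta> $ i\<bar> * cmod (?k x)"
      unfolding eq by (rule order_trans[OF norm_triangle_ineq]) (simp add: norm_mult)
    also have "\<dots> \<le> C' * exp (- r * weight t x) + \<bar>\<eta> $ i\<bar> * (C * exp (- r * weight t x))"
      using C C' by (intro add_mono mult_left_mono) auto
    also have "\<dots> \<le> ?C * exp (- r * weight t x)"
      using nonneg by (simp add: algebra_simps)
    finally show "cmod (partial i (\<lambda>x. ?k x * character \<eta> x) x) \<le> ?C * exp (- r * weight t x)" .
  qed
  then have "(\<integral>x. partials (i # replicate n i) k x * character \<eta> x \<partial>lborel) =
      - ((\<i> * of_real (\<eta> $ i)) * (\<integral>x. ?k x * character \<eta> x \<partial>lborel))"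
    unfolding eq using int by (simp add: eq_neg_iff_add_eq_0)
  then have "cmod (\<integral>x. partials (i # replicate n i) k x * character \<eta> x \<partial>lborel) =
      \<bar>\<eta> $ i\<bar> * cmod (\<integral>x. ?k x * character \<eta> x \<partial>lborel)"
    by (simp add: norm_mult)
  then show ?case using Suc by (simp add: mult.assoc)
qed simp

text \<open>Bounds on pure derivatives become bounds on powers of the frequency. The value of
  \<open>h\<close> is what \<open>exp_decay_of_power_bounds\<close> needs for the rate
  \<open>\<rho>\<close>, divided by the dimension to pass from coordinates to the norm.\<close>

lemma fourier_integral_decay:
  fixes k :: "real ^ 'd \<Rightarrow> complex"
  assumes k: "smooth k" and pos: "0 < t" "0 < s" "0 < r" "0 < \<rho>" and K: "0 \<le> K"
    and b: "gs_bound s ((s / (2 * \<rho>)) powr s / real CARD('d)) (\<lambda>x. K * exp (- r * weight t x)) k"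
  shows "cmod (\<integral>x. k x * character \<eta> x \<partial>lborel) \<le>
    2 powr s * (K * (\<integral>x. exp (- r * weight t (x :: real ^ 'd)) \<partial>lborel)) * exp (- \<rho> * weight s \<eta>)"
  unfolding weight_def[of s]
proof (rule exp_decay_of_power_bounds)
  let ?J = "\<integral>x. exp (- r * weight t (x :: real ^ 'd)) \<partial>lborel"
  let ?h1 = "(s / (2 * \<rho>)) powr s"
  let ?h = "?h1 / real CARD('d)"
  fix n
  have "\<bar>\<eta> $ i\<bar> ^ n * cmod (\<integral>x. k x * character \<eta> x \<partial>lborel) \<le> ?h ^ n * fact n powr s * (K * ?J)" for i
  proof -
    let ?k = "partials (replicate n i) k"
    have bk: "cmod (?k x) \<le> (?h ^ n * fact n powr s * K) * exp (- r * weight t x)" for x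
      using gs_boundD[OF b, of "replicate n i" x] by (simp add: mfact_replicate mult.assoc)
    have "\<bar>\<eta> $ i\<bar> ^ n * cmod (\<integral>x. k x * character \<eta> x \<partial>lborel) = cmod (\<integral>x. ?k x * character \<eta> x \<partial>lborel)"
    proof (rule fourier_integral_partials[OF k pos(1,3)])
      show "\<exists>C. \<forall>x. cmod (partials is k x) \<le> C * exp (- r * weight t x)" for "is"
        using gs_boundD[OF b, of "is"] by (auto simp: mult.assoc intro!: exI[of _ "?h ^ length is * mfact is powr s * K"])
    qed
    also have "\<dots> \<le> (\<integral>x. cmod (?k x * character \<eta> x) \<partial>lborel)"
      by (rule integral_norm_bound)
    also have "\<dots> \<le> (\<integral>x. (?h ^ n * fact n powr s * K) * exp (- r * weight t (x :: real ^ 'd)) \<partial>lborel)"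
    proof (rule integral_mono)
      show "integrable lborel (\<lambda>x. cmod (?k x * character \<eta> x))"
        using bk pos by (intro integrable_norm integrable_of_decay[of _ "?h ^ n * fact n powr s * K" r t]
            continuous_intros smooth_continuous_partials k) (auto simp: norm_mult)
      show "integrable lborel (\<lambda>x :: real ^ 'd. (?h ^ n * fact n powr s * K) * exp (- r * weight t x))"
        using pos by (intro integrable_mult_right integrable_exp_weight)
    qed (use bk in \<open>simp add: norm_mult\<close>)
    also have "\<dots> = ?h ^ n * fact n powr s * (K * ?J)"
      by (subst integral_mult_right_zero) (simp add: mult.assoc)
    finally show ?thesis .
  qed
  then have "norm \<eta> ^ n * cmod (\<integral>x. k x * character \<eta> x \<partial>lborel) \<le>
      real CARD('d) ^ n * (?h ^ n * fact n powr s * (K * ?J))"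
    by (rule norm_power_mult_le) simp
  also have "\<dots> = K * ?J * ?h1 ^ n * fact n powr s"
    by (simp add: power_divide)
  finally show "cmod (\<integral>x. k x * character \<eta> x \<partial>lborel) * norm \<eta> ^ n \<le> K * ?J * ?h1 ^ n * fact n powr s"
    by (simp add: mult.commute)
qed (use pos in auto)

text \<open>This is \<open>A\<close> of the overview: the inner product of \<open>f\<close> with
  \<open>phase_shift z g\<close>, arranged as a Fourier integral.\<close>

definition cross_coeff ::
  "(real ^ 'd \<Rightarrow> complex) \<Rightarrow> (real ^ 'd \<Rightarrow> complex) \<Rightarrow> (real ^ 'd) \<times> (real ^ 'd) \<Rightarrow> complex" where
  "cross_coeff f g z = (\<integral>x. (f x * translate (fst z) (\<lambda>x. cnj (g x)) x) * character (snd z) x \<partial>lborel)"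

text \<open>Since \<open>weight t y\<close> is at most \<open>c\<close> times the sum of the weights
  of \<open>x\<close> and \<open>x - y\<close>, one of the factors is small when \<open>y\<close> is
  large. The rate \<open>c * \<rho>\<close> in both factors gives \<open>\<rho>\<close> in
  \<open>y\<close>, and the extra 1 keeps integrability in \<open>x\<close>.\<close>

lemma gs_bound_mult_translate:
  fixes f g :: "real ^ 'd \<Rightarrow> complex"
  assumes f: "f \<in> gelfand_shilov t s" and g: "g \<in> gelfand_shilov t s"
    and pos: "0 < t" "0 < s" "0 < h" "0 < \<rho>"
  obtains C where "0 < C" "\<And>y. gs_bound s h
      (\<lambda>x. (C * exp (- \<rho> * weight t y)) * exp (- 1 * weight t x)) (\<lambda>x. f x * translate y g x)"
proof -
  define c where "c = 2 powr (1 / t)"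
  define r where "r = 1 + c * \<rho>"
  have c: "0 < c" "0 < r" using pos by (auto simp: c_def r_def intro: add_pos_pos)
  have h: "0 < h / 2" using pos by simp
  obtain C where C: "0 < C" "gs_bound s (h / 2) (\<lambda>x. C * exp (- r * weight t x)) f"
    using gelfand_shilov_gs_bound[OF f pos(1) h c(2)] by metis
  obtain D where D: "0 < D" "gs_bound s (h / 2) (\<lambda>x. D * exp (- r * weight t x)) g"
    using gelfand_shilov_gs_bound[OF g pos(1) h c(2)] by metis
  have sm: "smooth f" "smooth g" using f g by (auto intro: gelfand_shilov_smooth)
  have "gs_bound s h (\<lambda>x. (C * D * exp (- \<rho> * weight t y)) * exp (- 1 * weight t x)) (\<lambda>x. f x * translate y g x)" for y
  proof -
    have "gs_bound s (2 * (h / 2)) (\<lambda>x. (C * exp (- r * weight t x)) * (D * exp (- r * weight t (x - y))))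
        (\<lambda>x. f x * translate y g x)"
      using pos by (intro gs_bound_mult smooth_translate sm C gs_bound_translate D) auto
    then show ?thesis
    proof (rule gs_bound_mono)
      fix x
      have "weight t y \<le> c * (weight t x + weight t (x - y))"
        using weight_add[OF pos(1), of x "- (x - y)"] unfolding weight_minus by (simp add: c_def)
      then have "\<rho> * weight t y \<le> \<rho> * (c * (weight t x + weight t (x - y)))"
        using pos by (intro mult_left_mono) auto
      then have "- r * weight t x - r * weight t (x - y) \<le> - \<rho> * weight t y - 1 * weight t x"
        by (simp add: r_def algebra_simps add_increasing)
      then have "exp (- r * weight t x) * exp (- r * weight t (x - y)) \<le> exp (- \<rho> * weight t y) * exp (- 1 * weight t x)"
        by (simp add: exp_add[symmetric])
      from mult_left_mono[OF this, of "C * D"]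
      show "(C * exp (- r * weight t x)) * (D * exp (- r * weight t (x - y))) \<le>
          (C * D * exp (- \<rho> * weight t y)) * exp (- 1 * weight t x)"
        using C D by (simp add: mult_ac)
    qed (use pos in auto)
  qed
  then show ?thesis using that[of "C * D"] C D by simp
qed

text \<open>Position decay comes from the small overlap of \<open>f\<close> with the translated
  window, frequency decay from the derivatives of the product. The rate \<open>\<rho>\<close> is
  free, unlike the growth rate of \<open>u\<close>.\<close>

lemma cross_coeff_decay:
  fixes f g :: "real ^ 'd \<Rightarrow> complex"
  assumes f: "f \<in> gelfand_shilov t s" and g: "g \<in> gelfand_shilov t s"
    and pos: "0 < t" "0 < s" "0 < \<rho>"
  obtains C where "0 < C" "\<And>z. cmod (cross_coeff f g z) \<le> C * exp (- \<rho> * phase_weight t s z)"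
proof -
  let ?J = "\<integral>x. exp (- 1 * weight t (x :: real ^ 'd)) \<partial>lborel"
  have J: "0 \<le> ?J" by (intro integral_nonneg_AE) auto
  have h: "0 < (s / (2 * \<rho>)) powr s / real CARD('d)" using pos by simp
  have g': "(\<lambda>x. cnj (g x)) \<in> gelfand_shilov t s" by (rule gelfand_shilov_cnj[OF g pos(1)])
  obtain C where C: "0 < C" "\<And>y. gs_bound s ((s / (2 * \<rho>)) powr s / real CARD('d))
      (\<lambda>x. (C * exp (- \<rho> * weight t y)) * exp (- 1 * weight t x)) (\<lambda>x. f x * translate y (\<lambda>x. cnj (g x)) x)"
    by (rule gs_bound_mult_translate[OF f g' pos(1,2) h pos(3)], rule that)
  have "cmod (cross_coeff f g z) \<le> (2 powr s * (C * ?J) + 1) * exp (- \<rho> * phase_weight t s z)" for z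
  proof -
    have "cmod (cross_coeff f g z) \<le>
        2 powr s * ((C * exp (- \<rho> * weight t (fst z))) * ?J) * exp (- \<rho> * weight s (snd z))"
      unfolding cross_coeff_def using C pos
      by (intro fourier_integral_decay smooth_mult smooth_translate)
         (auto intro: gelfand_shilov_smooth[OF f] gelfand_shilov_smooth[OF g'])
    also have "\<dots> = 2 powr s * (C * ?J) * exp (- \<rho> * phase_weight t s z)"
      by (simp add: phase_weight_def algebra_simps exp_add[symmetric])
    also have "\<dots> \<le> (2 powr s * (C * ?J) + 1) * exp (- \<rho> * phase_weight t s z)"
      by (intro mult_right_mono) auto
    finally show ?thesis .
  qed
  moreover have "0 < 2 powr s * (C * ?J) + 1"
    using C J by (intro add_nonneg_pos mult_nonneg_nonneg) auto
  ultimately show ?thesis using that by blast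
qed

section \<open>Integrability and continuity of the reconstruction integrand\<close>

lemma gelfand_shilov_bounded:
  assumes "f \<in> gelfand_shilov t s" "0 < t"
  obtains B where "0 < B" "\<And>x. cmod (f x) \<le> B"
proof -
  obtain C where C: "0 < C" "gs_bound s 1 (\<lambda>x. C * exp (- 1 * weight t x)) f"
    using gelfand_shilov_gs_bound[OF assms, of 1 1] by auto
  have "cmod (f x) \<le> C" for x
    using order_trans[OF gs_bound_Nil[OF C(2), of x], of C] C(1) by (simp add: mult_left_le)
  then show ?thesis using that C by blast
qed

lemma gelfand_shilov_integrable:
  assumes "f \<in> gelfand_shilov t s" "0 < t"
  shows "integrable lborel f"
proof -
  obtain C where C: "0 < C" "gs_bound s 1 (\<lambda>x. C * exp (- 1 * weight t x)) f"
    using gelfand_shilov_gs_bound[OF assms, of 1 1] by auto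
  show ?thesis
    by (rule integrable_of_decay[OF smooth_continuous[OF gelfand_shilov_smooth[OF assms(1)]]
          gs_bound_Nil[OF C(2)] assms(2)]) simp
qed

lemma continuous_cross_coeff:
  fixes f g :: "real ^ 'd \<Rightarrow> complex"
  assumes f: "f \<in> gelfand_shilov t s" and g: "g \<in> gelfand_shilov t s" and t: "0 < t"
  shows "continuous_on UNIV (cross_coeff f g)"
proof (rule continuous_on_sequentiallyI)
  fix Z :: "nat \<Rightarrow> (real ^ 'd) \<times> (real ^ 'd)" and z assume Z: "Z \<longlonglongrightarrow> z"
  obtain B where B: "0 < B" "\<And>x. cmod (g x) \<le> B" using gelfand_shilov_bounded[OF g t] by metis
  have cf: "continuous_on UNIV f" and cg: "continuous_on UNIV g"
    using f g by (auto intro: smooth_continuous gelfand_shilov_smooth)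
  have cg': "continuous_on S (\<lambda>x. g (k x))" if "continuous_on S k" for k :: "'b::topological_space \<Rightarrow> real ^ 'd" and S
    by (rule continuous_on_compose2[OF cg that]) auto
  let ?q = "\<lambda>z x. (f x * translate (fst z) (\<lambda>x. cnj (g x)) x) * character (snd z) x"
  have m: "?q z \<in> borel_measurable lborel" for z
    unfolding translate_def by (auto intro!: borel_measurable_continuous_onI continuous_intros cf cg')
  show "(\<lambda>n. cross_coeff f g (Z n)) \<longlonglongrightarrow> cross_coeff f g z"
    unfolding cross_coeff_def
  proof (rule integral_dominated_convergence[where w="\<lambda>x. cmod (f x) * B"])
    show "integrable lborel (\<lambda>x. cmod (f x) * B)"
      by (intro integrable_mult_left integrable_norm gelfand_shilov_integrable[OF f t])
    show "AE x in lborel. (\<lambda>n. ?q (Z n) x) \<longlonglongrightarrow> ?q z x"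
    proof (rule AE_I2)
      fix x
      have "continuous_on UNIV (\<lambda>z. ?q z x)"
        unfolding translate_def by (intro continuous_intros cg')
      from continuous_on_tendsto_compose[OF this Z] show "(\<lambda>n. ?q (Z n) x) \<longlonglongrightarrow> ?q z x" by simp
    qed
    show "AE x in lborel. cmod (?q (Z n) x) \<le> cmod (f x) * B" for n
      using B by (auto simp: norm_mult translate_def intro!: mult_left_mono)
  qed (rule m)+
qed

text \<open>Differentiating a phase shift gives a multiple of itself plus a phase shift of a
  differentiated window. Generalising over \<open>js\<close> closes the induction.\<close>

lemma continuous_partials_phase_shift:
  fixes g :: "real ^ 'd \<Rightarrow> complex"
  assumes g: "smooth g"
  shows "continuous_on UNIV (\<lambda>p. partials is (phase_shift (fst p) (partials js g)) (snd p))"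
proof (induction "is" arbitrary: js rule: rev_induct)
  case Nil
  have "continuous_on UNIV (\<lambda>p :: ((real ^ 'd) \<times> (real ^ 'd)) \<times> (real ^ 'd). partials js g (snd p - fst (fst p)))"
    by (rule continuous_on_compose2[OF smooth_continuous_partials[OF g, of UNIV]])
       (auto intro!: continuous_intros)
  then show ?case
    unfolding phase_shift_def translate_def by (auto intro!: continuous_intros)
next
  case (snoc i "is")
  have eq: "partials (is @ [i]) (phase_shift z (partials js g)) x =
      (\<i> * of_real (- snd z $ i)) * partials is (phase_shift z (partials js g)) x +
      partials is (phase_shift z (partials (i # js) g)) x" for z x
  proof -
    let ?k = "partials js g"
    have sm: "smooth ?k" "smooth (partial i ?k)" using g by (auto intro: smooth_partials smooth_partial)
    have "partial i (phase_shift z ?k) = (\<lambda>x. (\<i> * of_real (- snd z $ i)) * phase_shift z ?k x +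
        phase_shift z (partial i ?k) x)"
      using partial_mult[OF smooth_character smooth_translate[OF sm(1)], of i "- snd z" "fst z"]
        partials_translate[OF sm(1), of "[i]"]
      by (simp add: phase_shift_def[abs_def] partial_character partials_Cons mult_ac)
    then have "partials (is @ [i]) (phase_shift z ?k) = partials is (\<lambda>x. (\<i> * of_real (- snd z $ i)) *
        phase_shift z ?k x + phase_shift z (partial i ?k) x)"
      by (simp add: partials_append partials_Cons)
    then show ?thesis
      by (simp only: partials_add[OF smooth_cmult[OF smooth_phase_shift[OF sm(1)]] smooth_phase_shift[OF sm(2)]]
          partials_cmult[OF smooth_phase_shift[OF sm(1)]] partials_Cons)
  qed
  show ?case
    unfolding eq by (intro continuous_intros snoc)
qed

lemma continuous_partials_phase_shift_fst:
  assumes "smooth g"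
  shows "continuous_on S (\<lambda>z. partials is (phase_shift z g) x)"
proof -
  have "continuous_on S (\<lambda>z. (z, x))" by (intro continuous_intros)
  from continuous_on_compose2[OF continuous_partials_phase_shift[OF assms, of "is" "[]"] this]
  show ?thesis by simp
qed

text \<open>
  Fourier inversion in the frequency variable recovers \<open>f(w) |g(w - y)|\<^sup>2\<close>, and integrating this
  over \<open>y\<close> gives \<open>f(w)\<close> times the squared \<open>L\<^sup>2\<close> norm of \<open>g\<close>.
\<close>

lemma integral_cross_coeff_phase_shift:
  fixes f g :: "real ^ 'd \<Rightarrow> complex"
  assumes f: "f \<in> gelfand_shilov t s" and g: "g \<in> gelfand_shilov t s" and pos: "0 < t" "0 < s"
  shows "(\<integral>z. cross_coeff f g z * phase_shift z g w \<partial>lborel) =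
    of_real ((2 * pi) ^ CARD('d) * (\<integral>x. (cmod (g x))\<^sup>2 \<partial>lborel)) * f w"
proof -
  obtain B where B: "0 < B" "\<And>x. cmod (g x) \<le> B" using gelfand_shilov_bounded[OF g pos(1)] by metis
  obtain Bf where Bf: "0 < Bf" "\<And>x. cmod (f x) \<le> Bf" using gelfand_shilov_bounded[OF f pos(1)] by metis
  obtain C where C: "0 < C" "\<And>z. cmod (cross_coeff f g z) \<le> C * exp (- 1 * phase_weight t s z)"
    using cross_coeff_decay[OF f g pos, of 1] by auto
  have sf: "smooth f" and sg: "smooth g" using f g by (auto intro: gelfand_shilov_smooth)
  have cA: "continuous_on UNIV (cross_coeff f g)" by (rule continuous_cross_coeff[OF f g pos(1)])
  have cP: "continuous_on UNIV (\<lambda>z. phase_shift z g w)"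
    using continuous_partials_phase_shift_fst[OF sg, of UNIV "[]"] by simp
  have "integrable lborel (\<lambda>z. cross_coeff f g z * phase_shift z g w)"
  proof (rule Bochner_Integration.integrable_bound)
    show "integrable lborel (\<lambda>z :: (real ^ 'd) \<times> (real ^ 'd). (C * exp (- 1 * phase_weight t s z)) * B)"
      using pos by (intro integrable_mult_left integrable_mult_right integrable_exp_phase_weight) auto
    show "(\<lambda>z. cross_coeff f g z * phase_shift z g w) \<in> borel_measurable lborel"
      using cA cP by (auto intro!: borel_measurable_continuous_onI continuous_intros)
    show "AE z in lborel. norm (cross_coeff f g z * phase_shift z g w) \<le> norm ((C * exp (- 1 * phase_weight t s z)) * B)"
    proof (rule AE_I2)
      fix z
      have "norm (cross_coeff f g z * phase_shift z g w) \<le> (C * exp (- 1 * phase_weight t s z)) * B"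
        unfolding norm_mult using C(1) B(2)[of "w - fst z"]
        by (intro mult_mono C(2)) (auto simp: norm_mult phase_shift_def translate_def)
      then show "norm (cross_coeff f g z * phase_shift z g w) \<le> norm ((C * exp (- 1 * phase_weight t s z)) * B)"
        using order_trans[OF _ abs_ge_self] by simp
    qed
  qed
  then have "(\<integral>z. cross_coeff f g z * phase_shift z g w \<partial>lborel) =
      (\<integral>y. (\<integral>\<eta>. cross_coeff f g (y, \<eta>) * phase_shift (y, \<eta>) g w \<partial>lborel) \<partial>lborel)"
    by (subst lborel_pair.integral_fst') (simp_all add: lborel_prod)
  also have "\<dots> = (\<integral>y. of_real ((2 * pi) ^ CARD('d)) * f w * of_real ((cmod (g (w - y)))\<^sup>2) \<partial>lborel)"
  proof (rule Bochner_Integration.integral_cong)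
    fix y
    let ?k = "\<lambda>x. f x * translate y (\<lambda>x. cnj (g x)) x"
    have ck: "continuous_on UNIV ?k"
      by (intro smooth_continuous smooth_mult smooth_translate smooth_cnj sf sg)
    have bk: "cmod (?k x) \<le> cmod (f x) * B" for x
      using B by (auto simp: norm_mult translate_def intro!: mult_left_mono)
    have "integrable lborel ?k"
    proof (rule Bochner_Integration.integrable_bound)
      show "integrable lborel (\<lambda>x. cmod (f x) * B)"
        by (intro integrable_mult_left integrable_norm gelfand_shilov_integrable[OF f pos(1)])
      show "?k \<in> borel_measurable lborel" using ck by (simp add: borel_measurable_continuous_onI)
    qed (use bk B in auto)
    \<comment> \<open>Inversion needs an integrable transform; the decay of
      \<open>cross_coeff\<close> in the frequency supplies it.\<close>
    moreover have "integrable lborel (\<lambda>\<eta>. \<integral>x. ?k x * character \<eta> x \<partial>lborel)"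
    proof (rule integrable_of_decay[where r=1 and t=s and C=C])
      have "continuous_on UNIV (\<lambda>\<eta>. cross_coeff f g (y, \<eta>))"
        by (rule continuous_on_compose2[OF cA]) (auto intro!: continuous_intros)
      then show "continuous_on UNIV (\<lambda>\<eta>. \<integral>x. ?k x * character \<eta> x \<partial>lborel)"
        by (simp add: cross_coeff_def)
      fix \<eta> :: "real ^ 'd"
      have "cmod (\<integral>x. ?k x * character \<eta> x \<partial>lborel) \<le> C * exp (- 1 * phase_weight t s (y, \<eta>))"
        using C(2)[of "(y, \<eta>)"] by (simp add: cross_coeff_def)
      also have "\<dots> \<le> C * exp (- 1 * weight s \<eta>)"
        using C by (intro mult_left_mono) (auto simp: phase_weight_def)
      finally show "cmod (\<integral>x. ?k x * character \<eta> x \<partial>lborel) \<le> C * exp (- 1 * weight s \<eta>)" .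
    qed (use pos in auto)
    moreover have "cmod (?k x) \<le> Bf * B" for x
      using order_trans[OF bk[of x] mult_right_mono[OF Bf(2)[of x], of B]] B by simp
    ultimately have inv: "(\<integral>\<eta>. (\<integral>x. ?k x * character \<eta> x \<partial>lborel) * character (- \<eta>) w \<partial>lborel) =
        of_real ((2 * pi) ^ CARD('d)) * ?k w"
      using ck by (intro fourier_inversion)
    have "(\<integral>\<eta>. cross_coeff f g (y, \<eta>) * phase_shift (y, \<eta>) g w \<partial>lborel) =
        (\<integral>\<eta>. ((\<integral>x. ?k x * character \<eta> x \<partial>lborel) * character (- \<eta>) w) * g (w - y) \<partial>lborel)"
      by (simp add: cross_coeff_def phase_shift_def translate_def mult.assoc)
    also have "\<dots> = of_real ((2 * pi) ^ CARD('d)) * ?k w * g (w - y)"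
      unfolding inv[symmetric] by (rule integral_mult_left_zero)
    also have "\<dots> = of_real ((2 * pi) ^ CARD('d)) * f w * of_real ((cmod (g (w - y)))\<^sup>2)"
      unfolding complex_norm_square by (simp add: translate_def mult_ac)
    finally show "(\<integral>\<eta>. cross_coeff f g (y, \<eta>) * phase_shift (y, \<eta>) g w \<partial>lborel) =
        of_real ((2 * pi) ^ CARD('d)) * f w * of_real ((cmod (g (w - y)))\<^sup>2)" .
  qed simp
  also have "\<dots> = of_real ((2 * pi) ^ CARD('d)) * f w * of_real (\<integral>y. (cmod (g (w - y)))\<^sup>2 \<partial>lborel)"
    by (subst integral_mult_right_zero) (simp only: integral_complex_of_real)
  also have "(\<integral>y. (cmod (g (w - y)))\<^sup>2 \<partial>lborel) = (\<integral>x. (cmod (g x))\<^sup>2 \<partial>lborel)"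
    using integral_lborel_affine[of "-1" "\<lambda>x. (cmod (g x))\<^sup>2" w] by simp
  finally show ?thesis by (simp add: mult_ac)
qed

lemma partials_phase_shift_bound:
  fixes g :: "real ^ 'd \<Rightarrow> complex"
  assumes g: "g \<in> gelfand_shilov t s" and pos: "0 < t" "0 < s" "0 < h" "0 < r"
  obtains K R where "0 < K" "0 < R" "\<And>z. gs_bound s h
    (\<lambda>x. K * exp (R * phase_weight t s z) * exp (- r * weight t x)) (phase_shift z g)"
proof -
  obtain h' r' R where *: "0 < h'" "0 < r'" "0 < R" and
    bound: "\<And>(f :: real ^ 'd \<Rightarrow> complex) K z. smooth f \<Longrightarrow> 0 \<le> K \<Longrightarrow>
       gs_bound s h' (\<lambda>x. K * exp (- r' * weight t x)) f \<Longrightarrow>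
       gs_bound s h (\<lambda>x. K * exp (R * phase_weight t s z) * exp (- r * weight t x)) (phase_shift z f)"
    using gs_bound_phase_shift[OF pos] by blast
  obtain K where K: "0 < K" "gs_bound s h' (\<lambda>x. K * exp (- r' * weight t x)) g"
    using gelfand_shilov_gs_bound[OF g pos(1) *(1,2)] by metis
  show ?thesis
    using that[OF K(1) *(3)] bound[OF gelfand_shilov_smooth[OF g] _ K(2)] K(1) by simp
qed

text \<open>The derivatives of \<open>phase_shift z g\<close> may grow at rate \<open>R\<close> in
  \<open>z\<close>, so the coefficient is taken with rate \<open>R + 1\<close>, which leaves the
  integrable factor \<open>exp (- 1 * phase_weight t s z)\<close>.\<close>

lemma cross_coeff_partials_bound:
  fixes f g :: "real ^ 'd \<Rightarrow> complex"
  assumes f: "f \<in> gelfand_shilov t s" and g: "g \<in> gelfand_shilov t s"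
    and pos: "0 < t" "0 < s" "0 < h" "0 < r"
  obtains C where "0 < C" "\<And>is z x. cmod (cross_coeff f g z * partials is (phase_shift z g) x) \<le>
    h ^ length is * mfact is powr s * (C * exp (- 1 * phase_weight t s z) * exp (- r * weight t x))"
proof -
  obtain K R where K: "0 < K" "0 < R" "\<And>z. gs_bound s h
    (\<lambda>x. K * exp (R * phase_weight t s z) * exp (- r * weight t x)) (phase_shift z g)"
    by (rule partials_phase_shift_bound[OF g pos], rule that)
  have R1: "0 < R + 1" using K by simp
  obtain C where C: "0 < C" "\<And>z. cmod (cross_coeff f g z) \<le> C * exp (- (R + 1) * phase_weight t s z)"
    using cross_coeff_decay[OF f g pos(1,2) R1] by auto
  have "cmod (cross_coeff f g z * partials is (phase_shift z g) x) \<le>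
    h ^ length is * mfact is powr s * ((C * K) * exp (- 1 * phase_weight t s z) * exp (- r * weight t x))"
    for "is" z x
  proof -
    have "cmod (cross_coeff f g z * partials is (phase_shift z g) x) \<le>
        (C * exp (- (R + 1) * phase_weight t s z)) *
        (h ^ length is * mfact is powr s * (K * exp (R * phase_weight t s z) * exp (- r * weight t x)))"
      unfolding norm_mult using C gs_boundD[OF K(3)[of z], of "is" x] by (intro mult_mono) auto
    also have "\<dots> = h ^ length is * mfact is powr s * ((C * K) *
        (exp (- (R + 1) * phase_weight t s z) * exp (R * phase_weight t s z)) * exp (- r * weight t x))"
      by (simp only: mult_ac)
    also have "exp (- (R + 1) * phase_weight t s z) * exp (R * phase_weight t s z) = exp (- 1 * phase_weight t s z)"
      by (simp add: exp_add[symmetric] algebra_simps)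
    finally show ?thesis .
  qed
  then show ?thesis using that[of "C * K"] C K by simp
qed

text \<open>Obtained by differentiating the reconstruction formula under the integral sign. All
  derivatives are needed because the bound controlling \<open>u\<close> involves all of
  them.\<close>

lemma integral_cross_coeff_partials:
  fixes f g :: "real ^ 'd \<Rightarrow> complex"
  assumes f: "f \<in> gelfand_shilov t s" and g: "g \<in> gelfand_shilov t s" and pos: "0 < t" "0 < s"
  shows "(\<integral>z. cross_coeff f g z * partials is (phase_shift z g) x \<partial>lborel) =
    of_real ((2 * pi) ^ CARD('d) * (\<integral>x. (cmod (g x))\<^sup>2 \<partial>lborel)) * partials is f x"
proof -
  let ?M = "complex_of_real ((2 * pi) ^ CARD('d) * (\<integral>x. (cmod (g x))\<^sup>2 \<partial>lborel))"
  have sf: "smooth f" and sg: "smooth g" using f g by (auto intro: gelfand_shilov_smooth)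
  have cA: "continuous_on UNIV (cross_coeff f g)" by (rule continuous_cross_coeff[OF f g pos(1)])
  obtain C where C: "0 < C" "\<And>is z x. cmod (cross_coeff f g z * partials is (phase_shift z g) x) \<le>
    1 ^ length is * mfact is powr s * (C * exp (- 1 * phase_weight t s z) * exp (- 1 * weight t x))"
    by (rule cross_coeff_partials_bound[OF f g pos zero_less_one zero_less_one], rule that)
  define b where "b is z = (mfact is powr s * C) * exp (- 1 * phase_weight t s z)"
    for "is" :: "'d list" and z :: "(real ^ 'd) \<times> (real ^ 'd)"
  have int_b: "integrable lborel (b is)" for "is"
    unfolding b_def[abs_def] using pos by (intro integrable_mult_right integrable_exp_phase_weight) auto
  have bound: "cmod (cross_coeff f g z * partials is (phase_shift z g) x) \<le> b is z" for "is" z x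
  proof -
    have "mfact is powr s * (C * exp (- 1 * phase_weight t s z) * exp (- 1 * weight t x)) \<le>
        mfact is powr s * (C * exp (- 1 * phase_weight t s z))"
      using C by (intro mult_left_mono mult_left_le) auto
    then show ?thesis using C(2)[of z "is" x] by (simp add: b_def mult.assoc)
  qed
  have int: "integrable lborel (\<lambda>z. cross_coeff f g z * partials is (phase_shift z g) x)" for "is" x
  proof (rule Bochner_Integration.integrable_bound[OF int_b])
    have "continuous_on UNIV (\<lambda>z. partials is (phase_shift z g) x)"
      by (rule continuous_partials_phase_shift_fst[OF sg])
    then show "(\<lambda>z. cross_coeff f g z * partials is (phase_shift z g) x) \<in> borel_measurable lborel"
      using cA by (auto intro!: borel_measurable_continuous_onI continuous_intros)
    show "AE z in lborel. norm (cross_coeff f g z * partials is (phase_shift z g) x) \<le> norm (b is z)"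
      by (rule AE_I2) (use order_trans[OF bound abs_ge_self] in simp)
  qed
  show ?thesis
  proof (induction "is" arbitrary: x)
    case Nil
    show ?case using integral_cross_coeff_phase_shift[OF f g pos] by simp
  next
    case (Cons i "is")
    have "has_partial i (\<lambda>x. \<integral>z. cross_coeff f g z * partials is (phase_shift z g) x \<partial>lborel)
        (\<lambda>x. \<integral>z. cross_coeff f g z * partials (i # is) (phase_shift z g) x \<partial>lborel)"
    proof (rule has_partial_integral)
      show "has_partial i (\<lambda>x. cross_coeff f g z * partials is (phase_shift z g) x)
          (\<lambda>x. cross_coeff f g z * partials (i # is) (phase_shift z g) x)" for z
        using has_partial_mult[OF has_partial_const smooth_has_partials[OF smooth_phase_shift[OF sg]]] by simp
      show "\<exists>b. integrable lborel b \<and> (\<forall>z \<sigma>. \<bar>\<sigma>\<bar> \<le> 1 \<longrightarrow>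
          cmod (cross_coeff f g z * partials (i # is) (phase_shift z g) (x + \<sigma> *\<^sub>R axis i 1)) \<le> b z)" for x
        using int_b bound by blast
    qed (rule int)
    then have 1: "has_partial i (\<lambda>x. ?M * partials is f x)
        (\<lambda>x. \<integral>z. cross_coeff f g z * partials (i # is) (phase_shift z g) x \<partial>lborel)"
      by (simp only: Cons)
    have 2: "has_partial i (\<lambda>x. ?M * partials is f x) (\<lambda>x. ?M * partials (i # is) f x)"
      using has_partial_mult[OF has_partial_const smooth_has_partials[OF sf]] by simp
    show ?case
      using fun_cong[OF trans[OF has_partial_imp_partial[OF 1, symmetric] has_partial_imp_partial[OF 2]], of x] .
  qed
qed

section \<open>Change of window\<close>

text \<open>The error is estimated cell by cell through the oscillation. Vector values allow its use
  both for the complex integrand and for its real majorant.\<close>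

lemma riemann_sum_error:
  fixes \<phi> :: "'a::euclidean_space \<Rightarrow> 'b::banach"
  assumes p: "p tagged_division_of cbox a b" and cont: "continuous_on (cbox a b) \<phi>" and e: "0 \<le> e"
    and osc: "\<And>x k y. (x, k) \<in> p \<Longrightarrow> y \<in> k \<Longrightarrow> norm (\<phi> y - \<phi> x) \<le> e"
  shows "norm ((\<Sum>(x, k)\<in>p. measure lborel k *\<^sub>R \<phi> x) - integral (cbox a b) \<phi>) \<le> e * measure lborel (cbox a b)"
proof -
  have int: "\<phi> integrable_on cbox a b" by (rule integrable_continuous[OF cont])
  have "(\<Sum>(x, k)\<in>p. measure lborel k *\<^sub>R \<phi> x) - integral (cbox a b) \<phi> =
      (\<Sum>(x, k)\<in>p. measure lborel k *\<^sub>R \<phi> x - integral k \<phi>)"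
    unfolding integral_combine_tagged_division_topdown[OF int p]
    by (simp add: sum_subtractf split_def)
  also have "norm \<dots> \<le> (\<Sum>(x, k)\<in>p. e * measure lborel k)"
  proof (rule order_trans[OF norm_sum], rule sum_mono, clarify)
    fix x k assume xk: "(x, k) \<in> p"
    obtain c d where k: "k = cbox c d" using tagged_division_ofD(4)[OF p xk] by blast
    have "k \<subseteq> cbox a b" using tagged_division_ofD(3)[OF p xk] by blast
    then have "continuous_on (cbox c d) \<phi>" using cont continuous_on_subset k by blast
    then have ck: "\<phi> integrable_on cbox c d" by (rule integrable_continuous)
    have "((\<lambda>y. \<phi> y - \<phi> x) has_integral integral k \<phi> - measure lborel k *\<^sub>R \<phi> x) (cbox c d)"
      unfolding k by (intro has_integral_diff integrable_integral ck has_integral_const)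
    then have "norm (integral k \<phi> - measure lborel k *\<^sub>R \<phi> x) \<le> e * measure lborel (cbox c d)"
      by (rule has_integral_bound[OF e]) (use osc[OF xk] k in auto)
    then show "norm (measure lborel k *\<^sub>R \<phi> x - integral k \<phi>) \<le> e * measure lborel k"
      by (simp add: k norm_minus_commute)
  qed
  also have "\<dots> = e * (\<Sum>(x, k)\<in>p. measure lborel k)"
    by (simp add: sum_distrib_left split_def)
  also have "(\<Sum>(x, k)\<in>p. measure lborel k) = measure lborel (cbox a b)"
    by (rule additive_content_tagged_division[OF p])
  finally show ?thesis .
qed

lemma gelfand_shilov_sum:
  fixes k :: "'i \<Rightarrow> real ^ 'd \<Rightarrow> complex"
  assumes "finite I" "\<And>i. i \<in> I \<Longrightarrow> k i \<in> gelfand_shilov t s" and u: "gs_functional t s u" and t: "0 < t"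
  shows "(\<lambda>x. \<Sum>i\<in>I. c i * k i x) \<in> gelfand_shilov t s \<and>
    u (\<lambda>x. \<Sum>i\<in>I. c i * k i x) = (\<Sum>i\<in>I. c i * u (k i)) \<and>
    (\<forall>is. partials is (\<lambda>x. \<Sum>i\<in>I. c i * k i x) = (\<lambda>x. \<Sum>i\<in>I. c i * partials is (k i) x))"
  using assms(1,2)
proof (induction I)
  case empty
  let ?z = "\<lambda>x :: real ^ 'd. 0 :: complex"
  have z: "?z \<in> gelfand_shilov t s" by (rule zero_in_gelfand_shilov[OF t])
  have "u ?z = 0" using gs_functional_cmult[OF u z, of 0] by simp
  then show ?case using z by (simp add: partials_zero)
next
  case (insert j I)
  let ?f = "\<lambda>x. c j * k j x" and ?g = "\<lambda>x. \<Sum>i\<in>I. c i * k i x"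
  have kj: "k j \<in> gelfand_shilov t s" and g: "?g \<in> gelfand_shilov t s" using insert by auto
  have f: "?f \<in> gelfand_shilov t s" by (rule gelfand_shilov_cmult[OF kj t])
  have "u (\<lambda>x. ?f x + ?g x) = u ?f + u ?g" "u ?f = c j * u (k j)"
    by (rule gs_functional_add[OF u f g], rule gs_functional_cmult[OF u kj])
  moreover have "partials is (\<lambda>x. ?f x + ?g x) = (\<lambda>x. partials is ?f x + partials is ?g x)" for "is"
    by (intro partials_add gelfand_shilov_smooth[OF f] gelfand_shilov_smooth[OF g])
  moreover have "partials is ?f = (\<lambda>x. c j * partials is (k j) x)" for "is"
    by (rule partials_cmult[OF gelfand_shilov_smooth[OF kj]])
  ultimately show ?case
    using insert gelfand_shilov_add[OF f g t] by simp
qed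

text \<open>
  The estimates with \<open>h / 2\<close> and \<open>2 r\<close> in place of \<open>h\<close> and \<open>r\<close> make the normalised derivatives small
  for long lists and for large \<open>x\<close>; this leaves finitely many lists on a compact set.
\<close>

lemma cross_coeff_partials_equicontinuous:
  fixes f g :: "real ^ 'd \<Rightarrow> complex"
  assumes f: "f \<in> gelfand_shilov t s" and g: "g \<in> gelfand_shilov t s"
    and pos: "0 < t" "0 < s" "0 < h" "0 < r" and K: "compact K" and \<epsilon>: "0 < \<epsilon>"
  obtains \<delta> where "0 < \<delta>" "\<And>is x z z'. z \<in> K \<Longrightarrow> z' \<in> K \<Longrightarrow> dist z z' < \<delta> \<Longrightarrow>
    cmod (cross_coeff f g z * partials is (phase_shift z g) x -
          cross_coeff f g z' * partials is (phase_shift z' g) x) \<le>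
      h ^ length is * mfact is powr s * exp (- r * weight t x) * \<epsilon>"
proof -
  let ?G = "\<lambda>is x z. cross_coeff f g z * partials is (phase_shift z g) x"
  let ?N = "\<lambda>is x. h ^ length is * mfact is powr s * exp (- r * weight t x)"
  have sg: "smooth g" by (rule gelfand_shilov_smooth[OF g])
  have h2: "0 < h / 2" and r2: "0 < 2 * r" using pos by auto
  obtain C where C: "0 < C" "\<And>is z x. cmod (?G is x z) \<le>
      (h / 2) ^ length is * mfact is powr s * (C * exp (- 1 * phase_weight t s z) * exp (- (2 * r) * weight t x))"
    by (rule cross_coeff_partials_bound[OF f g pos(1,2) h2 r2], rule that)
  have bound: "cmod (?G is x z) \<le> ?N is x * (C * (1 / 2) ^ length is * exp (- r * weight t x))" for "is" x z
  proof -
    have "cmod (?G is x z) \<le>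
        (h / 2) ^ length is * mfact is powr s * (C * exp (- 1 * phase_weight t s z) * exp (- (2 * r) * weight t x))"
      by (rule C(2))
    also have "\<dots> \<le> (h / 2) ^ length is * mfact is powr s * (C * 1 * exp (- (2 * r) * weight t x))"
      using C(1) pos by (intro mult_left_mono mult_right_mono) auto
    also have "exp (- (2 * r) * weight t x) = exp (- r * weight t x) * exp (- r * weight t x)"
      by (simp add: exp_add[symmetric])
    also have "(h / 2) ^ length is = h ^ length is * (1 / 2) ^ length is"
      by (simp add: power_mult_distrib[symmetric])
    finally show ?thesis by (simp only: mult_ac mult_1_right mult_1)
  qed
  \<comment> \<open>Where both terms are individually at most half the tolerance, no continuity is
    required.\<close>
  have small: "cmod (?G is x z - ?G is x z') \<le> ?N is x * \<epsilon>"
    if "C * (1 / 2) ^ length is * exp (- r * weight t x) \<le> \<epsilon> / 2" for "is" x z z'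
  proof -
    have "cmod (?G is x z) \<le> ?N is x * (\<epsilon> / 2)" for z
      using order_trans[OF bound mult_left_mono[OF that]] pos by simp
    from norm_triangle_le_diff[OF add_mono[OF this[of z] this[of z'], THEN order_trans]]
    show ?thesis by simp
  qed
  obtain L where L: "(1 / 2) ^ L < \<epsilon> / (2 * C)"
    using real_arch_pow_inv[of "\<epsilon> / (2 * C)" "1 / 2"] \<epsilon> C by auto
  \<comment> \<open>Solves \<open>C * exp (- r * w) \<le> \<epsilon> / 2\<close>, so points of
    weight at least \<open>w\<close> fall under \<open>small\<close>; the maximum with 1 keeps
    \<open>w\<close> positive.\<close>
  define w where "w = max 1 (ln (2 * C / \<epsilon>) / r)"
  have w: "0 < w" "C * exp (- r * w) \<le> \<epsilon> / 2"
  proof -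
    have "ln (2 * C / \<epsilon>) \<le> r * w"
      using pos by (simp add: w_def max_def field_simps)
    then have "exp (ln (2 * C / \<epsilon>)) \<le> exp (r * w)" by simp
    then show "C * exp (- r * w) \<le> \<epsilon> / 2" using \<epsilon> C by (simp add: exp_minus field_simps)
  qed (simp add: w_def)
  define X where "X = w powr t"
  have X: "norm x \<le> X" if "weight t x < w" for x :: "real ^ 'd"
  proof -
    have "(norm x powr (1 / t)) powr t \<le> w powr t"
      using that pos by (intro powr_mono2) (auto simp: weight_def)
    then show ?thesis using pos by (simp add: powr_inverse_powr X_def)
  qed
  \<comment> \<open>For \<open>weight t x < w\<close> the factor
    \<open>exp (- r * weight t x)\<close> is at least \<open>exp (- r * w)\<close>, so for each list
    a fixed tolerance on a compact set suffices.\<close>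
  have "\<exists>\<delta>>0. \<forall>x\<in>cball 0 X. \<forall>z\<in>K. \<forall>z'\<in>K. dist z z' < \<delta> \<longrightarrow>
      cmod (?G is x z - ?G is x z') < h ^ length is * mfact is powr s * exp (- r * w) * \<epsilon>" for "is" :: "'d list"
  proof -
    have "continuous_on UNIV (\<lambda>p. cross_coeff f g (fst p) * partials is (phase_shift (fst p) g) (snd p))"
      using continuous_partials_phase_shift[OF sg, of "is" "[]"]
        continuous_on_compose2[OF continuous_cross_coeff[OF f g pos(1)] continuous_on_fst[OF continuous_on_id], of UNIV]
      by (intro continuous_on_mult) auto
    then have "uniformly_continuous_on (K \<times> cball 0 X)
        (\<lambda>p. cross_coeff f g (fst p) * partials is (phase_shift (fst p) g) (snd p))"
      using K by (intro compact_uniformly_continuous compact_Times compact_cball) (auto intro: continuous_on_subset)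
    moreover have "0 < h ^ length is * mfact is powr s * exp (- r * w) * \<epsilon>"
      using pos \<epsilon> mfact_ge_1[of "is"] by auto
    ultimately obtain \<delta> where \<delta>: "0 < \<delta>" "\<And>p p'. p \<in> K \<times> cball 0 X \<Longrightarrow> p' \<in> K \<times> cball 0 X \<Longrightarrow> dist p' p < \<delta> \<Longrightarrow>
        dist (cross_coeff f g (fst p') * partials is (phase_shift (fst p') g) (snd p'))
          (cross_coeff f g (fst p) * partials is (phase_shift (fst p) g) (snd p)) <
        h ^ length is * mfact is powr s * exp (- r * w) * \<epsilon>"
      unfolding uniformly_continuous_on_def by metis
    have "cmod (?G is x z - ?G is x z') < h ^ length is * mfact is powr s * exp (- r * w) * \<epsilon>"
      if "x \<in> cball 0 X" "z \<in> K" "z' \<in> K" "dist z z' < \<delta>" for x z z'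
      using \<delta>(2)[of "(z', x)" "(z, x)"] that by (simp add: dist_Pair_Pair dist_norm)
    then show ?thesis using \<delta>(1) by blast
  qed
  then obtain \<Delta> where \<Delta>: "\<And>is :: 'd list. 0 < \<Delta> is" "\<And>is x z z'. x \<in> cball 0 X \<Longrightarrow> z \<in> K \<Longrightarrow> z' \<in> K \<Longrightarrow>
      dist z z' < \<Delta> is \<Longrightarrow> cmod (?G is x z - ?G is x z') < h ^ length is * mfact is powr s * exp (- r * w) * \<epsilon>"
    by metis
  define S where "S = {is :: 'd list. length is \<le> L}"
  have S: "finite S" "[] \<in> S"
    using finite_lists_length_le[of "UNIV :: 'd set" L] by (auto simp: S_def)
  have "cmod (?G is x z - ?G is x z') \<le> ?N is x * \<epsilon>"
    if z: "z \<in> K" "z' \<in> K" and d: "dist z z' < Min (\<Delta> ` S)" for "is" x z z'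
  proof (cases "is \<in> S \<and> weight t x < w")
    case True
    then have "Min (\<Delta> ` S) \<le> \<Delta> is" using S by (intro Min_le) auto
    then have "dist z z' < \<Delta> is" using d by linarith
    then have "cmod (?G is x z - ?G is x z') \<le> h ^ length is * mfact is powr s * exp (- r * w) * \<epsilon>"
      using \<Delta>(2)[of x z z' "is"] X[of x] True z by auto
    also have "\<dots> \<le> ?N is x * \<epsilon>"
      using True pos \<epsilon> by (intro mult_right_mono mult_left_mono) auto
    finally show ?thesis .
  next
    case False
    have e1: "exp (- r * weight t x) \<le> 1" using pos by simp
    have p1: "(1 / 2 :: real) ^ length is \<le> 1" by (simp add: power_le_one)
    from False consider "L \<le> length is" | "w \<le> weight t x" by (auto simp: S_def)
    then have "C * (1 / 2) ^ length is * exp (- r * weight t x) \<le> \<epsilon> / 2"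
    proof cases
      case 1
      have "C * (1 / 2) ^ length is * exp (- r * weight t x) \<le> C * (1 / 2) ^ L * 1"
        using 1 C e1 by (intro mult_mono power_decreasing) auto
      also have "\<dots> \<le> \<epsilon> / 2" using L C by (simp add: field_simps)
      finally show ?thesis .
    next
      case 2
      have "C * (1 / 2) ^ length is * exp (- r * weight t x) \<le> C * 1 * exp (- r * w)"
        using 2 C p1 pos by (intro mult_mono) auto
      then show ?thesis using w by simp
    qed
    then show ?thesis by (rule small)
  qed
  moreover have "0 < Min (\<Delta> ` S)" using S \<Delta>(1) by (subst Min_gr_iff) auto
  ultimately show ?thesis using that by blast
qed

text \<open>
  By the reconstruction formula a multiple of \<open>f\<close> is a limit, in the seminorm controlling \<open>u\<close>, of
  Riemann sums of \<open>z \<mapsto> cross_coeff f g z * phase_shift z g\<close>, to which \<open>u\<close> applies termwise.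
\<close>

lemma gs_functional_cross_coeff_bound:
  fixes f g :: "real ^ 'd \<Rightarrow> complex"
  assumes u: "gs_functional t s u" and f: "f \<in> gelfand_shilov t s" and g: "g \<in> gelfand_shilov t s"
    and pos: "0 < t" "0 < s" and B: "0 \<le> B"
    and bound: "\<And>z. cmod (cross_coeff f g z * u (phase_shift z g)) \<le> B * exp (- 1 * phase_weight t s z)"
  shows "(2 * pi) ^ CARD('d) * (\<integral>x. (cmod (g x))\<^sup>2 \<partial>lborel) * cmod (u f) \<le>
    B * (\<integral>z. exp (- 1 * phase_weight t s (z :: (real ^ 'd) \<times> (real ^ 'd))) \<partial>lborel)"
proof -
  let ?M = "(2 * pi) ^ CARD('d) * (\<integral>x. (cmod (g x))\<^sup>2 \<partial>lborel)"
  let ?E = "\<lambda>z :: (real ^ 'd) \<times> (real ^ 'd). exp (- 1 * phase_weight t s z)"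
  let ?J = "integral\<^sup>L lborel ?E"
  let ?G = "\<lambda>is x z. cross_coeff f g z * partials is (phase_shift z g) x"
  have M: "0 \<le> ?M" by (intro mult_nonneg_nonneg integral_nonneg_AE) auto
  have intE: "integrable lborel ?E" using pos by (intro integrable_exp_phase_weight) auto
  have contE: "continuous_on UNIV ?E"
    unfolding phase_weight_def weight_def using pos by (auto intro!: continuous_intros continuous_on_powr')
  obtain h r C0 where hr: "0 < h" "0 < r" "0 < C0" and
    ubd: "\<And>f K. f \<in> gelfand_shilov t s \<Longrightarrow> 0 < K \<Longrightarrow>
        gs_bound s h (\<lambda>x. K * exp (- r * weight t x)) f \<Longrightarrow> cmod (u f) \<le> C0 * K"
    using u unfolding gs_functional_def by blast
  obtain C where C: "0 < C" "\<And>is z x. cmod (?G is x z) \<le>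
      h ^ length is * mfact is powr s * (C * ?E z * exp (- r * weight t x))"
    by (rule cross_coeff_partials_bound[OF f g pos hr(1,2)], rule that)
  have sg: "smooth g" and sf: "smooth f" using f g by (auto intro: gelfand_shilov_smooth)
  have contG: "continuous_on S (?G is x)" for "is" x S
    using continuous_cross_coeff[OF f g pos(1)] continuous_partials_phase_shift_fst[OF sg]
    by (intro continuous_on_mult) (auto intro: continuous_on_subset)
  have intG: "integrable lborel (?G is x)" for "is" x
  proof (rule Bochner_Integration.integrable_bound)
    show "integrable lborel (\<lambda>z. (h ^ length is * mfact is powr s * C * exp (- r * weight t x)) * ?E z)"
      using intE by (rule integrable_mult_right)
    show "?G is x \<in> borel_measurable lborel" using contG by (auto intro!: borel_measurable_continuous_onI)
    show "AE z in lborel. norm (?G is x z) \<le> norm ((h ^ length is * mfact is powr s * C * exp (- r * weight t x)) * ?E z)"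
      by (rule AE_I2) (use order_trans[OF C(2) abs_ge_self] in \<open>simp add: mult_ac\<close>)
  qed
  have main: "?M * cmod (u f) \<le> C0 * (2 * \<epsilon>) + B * (?J + \<epsilon>)" if \<epsilon>: "0 < \<epsilon>" for \<epsilon>
  proof -
    define Q where "Q n = cbox (- (real n *\<^sub>R One)) (real n *\<^sub>R One :: (real ^ 'd) \<times> (real ^ 'd))" for n
    have Q_in: "\<exists>N. \<forall>n\<ge>N. z \<in> Q n" for z
    proof -
      obtain N :: nat where N: "norm z \<le> real N" using real_arch_simple by blast
      have "z \<in> Q n" if "N \<le> n" for n
        unfolding Q_def mem_box
      proof
        fix b :: "(real ^ 'd) \<times> (real ^ 'd)" assume b: "b \<in> Basis"
        have "\<bar>z \<bullet> b\<bar> \<le> real n" using Basis_le_norm[OF b, of z] N that by linarith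
        then show "- (real n *\<^sub>R One) \<bullet> b \<le> z \<bullet> b \<and> z \<bullet> b \<le> real n *\<^sub>R One \<bullet> b" using b by auto
      qed
      then show ?thesis by blast
    qed
    have "(\<lambda>n. \<integral>z. indicator (Q n) z *\<^sub>R ?E z \<partial>lborel) \<longlonglongrightarrow> ?J"
    proof (rule integral_dominated_convergence[where w="?E"])
      show "AE z in lborel. (\<lambda>n. indicator (Q n) z *\<^sub>R ?E z) \<longlonglongrightarrow> ?E z"
      proof (rule AE_I2)
        fix z
        obtain N where "\<forall>n\<ge>N. z \<in> Q n" using Q_in by blast
        then have "\<forall>\<^sub>F n in sequentially. indicator (Q n) z *\<^sub>R ?E z = ?E z"
          by (auto simp: eventually_sequentially intro!: exI[of _ N])
        then show "(\<lambda>n. indicator (Q n) z *\<^sub>R ?E z) \<longlonglongrightarrow> ?E z" by (rule tendsto_eventually)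
      qed
      show "(\<lambda>z. indicator (Q n) z *\<^sub>R ?E z) \<in> borel_measurable lborel" for n
        using intE by (auto simp: Q_def)
    qed (use intE in \<open>auto simp: indicator_def\<close>)
    \<comment> \<open>\<open>C\<close> compares the integrand with \<open>?E\<close>, so this tail
      of \<open>?E\<close> bounds the normalised tail of every derivative by
      \<open>\<epsilon>\<close>.\<close>
    moreover have "0 < \<epsilon> / C" using \<epsilon> C by simp
    ultimately have "\<forall>\<^sub>F n in sequentially. dist (\<integral>z. indicator (Q n) z *\<^sub>R ?E z \<partial>lborel) ?J < \<epsilon> / C"
      by (rule tendstoD)
    then obtain n where n: "dist (\<integral>z. indicator (Q n) z *\<^sub>R ?E z \<partial>lborel) ?J < \<epsilon> / C"
      by (auto simp: eventually_sequentially)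
    define K where "K = Q n"
    obtain a b where K: "K = cbox a b" by (simp add: K_def Q_def)
    have Kms: "K \<in> sets lborel" and cK: "compact K" by (auto simp: K)
    have intKE: "integrable lborel (\<lambda>z. indicator K z *\<^sub>R ?E z)"
      using Kms intE by (rule integrable_mult_indicator)
    have intKG: "integrable lborel (\<lambda>z. indicator K z *\<^sub>R ?G is x z)" for "is" x
      using Kms intG by (rule integrable_mult_indicator)
    have KE: "integral K ?E \<le> ?J" "?J - integral K ?E \<le> \<epsilon> / C"
    proof -
      have eq: "integral K ?E = (\<integral>z. indicator K z *\<^sub>R ?E z \<partial>lborel)"
        using set_borel_integral_eq_integral(2)[of K ?E] intKE
        by (simp add: set_integrable_def set_lebesgue_integral_def)
      show "integral K ?E \<le> ?J"
        unfolding eq using intKE intE by (intro integral_mono) (auto simp: indicator_def)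
      show "?J - integral K ?E \<le> \<epsilon> / C"
        unfolding eq using n by (simp add: K_def dist_real_def)
    qed
    \<comment> \<open>An oscillation of \<open>\<epsilon>'\<close> on each cell gives a total error
      of at most \<open>\<epsilon>\<close>; the added 1 covers a box of measure 0.\<close>
    define \<epsilon>' where "\<epsilon>' = \<epsilon> / (measure lborel K + 1)"
    have \<epsilon>': "0 < \<epsilon>'" "\<epsilon>' * measure lborel K \<le> \<epsilon>"
    proof -
      have m: "0 < measure lborel K + 1" by (simp add: add_nonneg_pos)
      then show "0 < \<epsilon>'" using \<epsilon> by (simp add: \<epsilon>'_def)
      then have "\<epsilon>' * measure lborel K \<le> \<epsilon>' * (measure lborel K + 1)" by (intro mult_left_mono) auto
      also have "\<dots> = \<epsilon>" using m by (simp add: \<epsilon>'_def)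
      finally show "\<epsilon>' * measure lborel K \<le> \<epsilon>" .
    qed
    let ?N = "\<lambda>is x. h ^ length is * mfact is powr s * exp (- r * weight t x)"
    obtain \<delta>1 where \<delta>1: "0 < \<delta>1" "\<And>is x z z'. z \<in> K \<Longrightarrow> z' \<in> K \<Longrightarrow> dist z z' < \<delta>1 \<Longrightarrow>
        cmod (?G is x z - ?G is x z') \<le> ?N is x * \<epsilon>'"
      by (rule cross_coeff_partials_equicontinuous[OF f g pos hr(1,2) cK \<epsilon>'(1)], rule that)
    have "uniformly_continuous_on K ?E"
      using contE cK by (intro compact_uniformly_continuous) (auto intro: continuous_on_subset)
    then obtain \<delta>2 where \<delta>2: "0 < \<delta>2" "\<And>z z'. z \<in> K \<Longrightarrow> z' \<in> K \<Longrightarrow> dist z z' < \<delta>2 \<Longrightarrow> \<bar>?E z - ?E z'\<bar> \<le> \<epsilon>'"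
      unfolding uniformly_continuous_on_def dist_real_def using \<epsilon>'(1) by (metis less_imp_le)
    define \<delta> where "\<delta> = min \<delta>1 \<delta>2"
    have "gauge (\<lambda>z. ball z \<delta>)" using \<delta>1 \<delta>2 by (intro gauge_ball) (simp add: \<delta>_def)
    then obtain p where p: "p tagged_division_of cbox a b" and fine: "(\<lambda>z. ball z \<delta>) fine p"
      using fine_division_exists by blast
    have near: "z \<in> K" "y \<in> K" "dist y z < \<delta>1" "dist y z < \<delta>2" if "(z, k) \<in> p" "y \<in> k" for z k y
      using tagged_division_ofD(2,3)[OF p that(1)] fineD[OF fine that(1)] that(2)
      by (auto simp: K \<delta>_def dist_commute)
    have fin: "finite p" using p by blast
    let ?c = "\<lambda>zk. of_real (measure lborel (snd zk)) * cross_coeff f g (fst zk)"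
    let ?k = "\<lambda>zk. phase_shift (fst zk) g"
    define \<sigma> where "\<sigma> = (\<lambda>x. \<Sum>zk\<in>p. ?c zk * ?k zk x)"
    have \<sigma>: "\<sigma> \<in> gelfand_shilov t s" "u \<sigma> = (\<Sum>zk\<in>p. ?c zk * u (?k zk))"
      "partials is \<sigma> = (\<lambda>x. \<Sum>zk\<in>p. ?c zk * partials is (?k zk) x)" for "is"
      using gelfand_shilov_sum[OF fin _ u pos(1), of ?k ?c] gelfand_shilov_phase_shift[OF g pos]
      by (auto simp: \<sigma>_def)
    have Mf: "(\<lambda>x. of_real ?M * f x) \<in> gelfand_shilov t s" and m\<sigma>: "(\<lambda>x. (- 1) * \<sigma> x) \<in> gelfand_shilov t s"
      by (intro gelfand_shilov_cmult f \<sigma> pos)+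
    define \<phi> where "\<phi> = (\<lambda>x. of_real ?M * f x + (- 1) * \<sigma> x)"
    have \<phi>: "\<phi> \<in> gelfand_shilov t s"
      unfolding \<phi>_def by (rule gelfand_shilov_add[OF Mf m\<sigma> pos(1)])
    have u\<phi>: "u \<phi> = of_real ?M * u f - u \<sigma>"
    proof -
      have "u \<phi> = u (\<lambda>x. of_real ?M * f x) + u (\<lambda>x. (- 1) * \<sigma> x)"
        unfolding \<phi>_def by (rule gs_functional_add[OF u Mf m\<sigma>])
      moreover have "u (\<lambda>x. of_real ?M * f x) = of_real ?M * u f" "u (\<lambda>x. (- 1) * \<sigma> x) = (- 1) * u \<sigma>"
        by (rule gs_functional_cmult[OF u f], rule gs_functional_cmult[OF u \<sigma>(1)])
      ultimately show ?thesis by simp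
    qed
    \<comment> \<open>One \<open>\<epsilon>\<close> is the truncation to \<open>K\<close>, the other
      the Riemann sum error on \<open>K\<close>.\<close>
    have "gs_bound s h (\<lambda>x. (2 * \<epsilon>) * exp (- r * weight t x)) \<phi>"
      unfolding gs_bound_def
    proof (intro allI)
      fix "is" :: "'d list" and x :: "real ^ 'd"
      have N: "0 \<le> ?N is x" using hr by simp
      have "partials is \<phi> x = partials is (\<lambda>x. of_real ?M * f x) x + partials is (\<lambda>x. (- 1) * \<sigma> x) x"
        unfolding \<phi>_def partials_add[OF gelfand_shilov_smooth[OF Mf] gelfand_shilov_smooth[OF m\<sigma>]] ..
      also have "\<dots> = of_real ?M * partials is f x - partials is \<sigma> x"
        unfolding partials_cmult[OF sf] partials_cmult[OF gelfand_shilov_smooth[OF \<sigma>(1)]] by simp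
      also have "partials is \<sigma> x = (\<Sum>(z, k)\<in>p. measure lborel k *\<^sub>R ?G is x z)"
        unfolding \<sigma>(3) by (simp add: split_def scaleR_conv_of_real mult.assoc)
      also have "of_real ?M * partials is f x = integral\<^sup>L lborel (?G is x)"
        by (rule integral_cross_coeff_partials[OF f g pos, symmetric])
      finally have eq: "partials is \<phi> x = (integral\<^sup>L lborel (?G is x) - integral K (?G is x)) -
          ((\<Sum>(z, k)\<in>p. measure lborel k *\<^sub>R ?G is x z) - integral K (?G is x))"
        by simp
      have 1: "cmod (integral\<^sup>L lborel (?G is x) - integral K (?G is x)) \<le> ?N is x * \<epsilon>"
      proof -
        have KG: "integral K (?G is x) = (\<integral>z. indicator K z *\<^sub>R ?G is x z \<partial>lborel)"
          using set_borel_integral_eq_integral(2)[of K "?G is x"] intKG[of "is" x]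
          by (simp add: set_integrable_def set_lebesgue_integral_def)
        have KE': "integral K ?E = (\<integral>z. indicator K z *\<^sub>R ?E z \<partial>lborel)"
          using set_borel_integral_eq_integral(2)[of K ?E] intKE
          by (simp add: set_integrable_def set_lebesgue_integral_def)
        have "cmod (integral\<^sup>L lborel (?G is x) - integral K (?G is x)) =
            cmod (\<integral>z. ?G is x z - indicator K z *\<^sub>R ?G is x z \<partial>lborel)"
          unfolding KG by (subst Bochner_Integration.integral_diff[OF intG intKG]) simp
        also have "\<dots> \<le> (\<integral>z. cmod (?G is x z - indicator K z *\<^sub>R ?G is x z) \<partial>lborel)"
          by (rule integral_norm_bound)
        also have "\<dots> \<le> (\<integral>z. (?N is x * C) * (?E z - indicator K z *\<^sub>R ?E z) \<partial>lborel)"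
        proof (rule integral_mono)
          show "integrable lborel (\<lambda>z. cmod (?G is x z - indicator K z *\<^sub>R ?G is x z))"
            by (intro integrable_norm Bochner_Integration.integrable_diff intG intKG)
          show "integrable lborel (\<lambda>z. (?N is x * C) * (?E z - indicator K z *\<^sub>R ?E z))"
            by (intro integrable_mult_right Bochner_Integration.integrable_diff intE intKE)
          show "cmod (?G is x z - indicator K z *\<^sub>R ?G is x z) \<le> (?N is x * C) * (?E z - indicator K z *\<^sub>R ?E z)" for z
            using C(2)[of z "is" x] by (cases "z \<in> K") (simp_all add: mult_ac)
        qed
        also have "\<dots> = (?N is x * C) * (?J - integral K ?E)"
          unfolding KE' by (subst integral_mult_right_zero) (subst Bochner_Integration.integral_diff[OF intE intKE], simp)
        also have "\<dots> \<le> (?N is x * C) * (\<epsilon> / C)"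
          using N C KE by (intro mult_left_mono) auto
        finally show ?thesis using C by simp
      qed
      have "norm ((\<Sum>(z, k)\<in>p. measure lborel k *\<^sub>R ?G is x z) - integral (cbox a b) (?G is x)) \<le> (?N is x * \<epsilon>') * measure lborel (cbox a b)"
        using near \<delta>1(2) N \<epsilon>' by (intro riemann_sum_error[OF p contG]) auto
      then have "cmod ((\<Sum>(z, k)\<in>p. measure lborel k *\<^sub>R ?G is x z) - integral K (?G is x)) \<le> ?N is x * (\<epsilon>' * measure lborel K)"
        by (simp add: K mult.assoc)
      also have "\<dots> \<le> ?N is x * \<epsilon>" using N \<epsilon>' by (intro mult_left_mono) auto
      finally have 2: "cmod ((\<Sum>(z, k)\<in>p. measure lborel k *\<^sub>R ?G is x z) - integral K (?G is x)) \<le> ?N is x * \<epsilon>" .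
      have "cmod (partials is \<phi> x) \<le> ?N is x * \<epsilon> + ?N is x * \<epsilon>"
        unfolding eq by (rule order_trans[OF norm_triangle_ineq4 add_mono[OF 1 2]])
      then show "cmod (partials is \<phi> x) \<le> h ^ length is * mfact is powr s * ((2 * \<epsilon>) * exp (- r * weight t x))"
        by (simp add: mult_ac)
    qed
    then have "cmod (u \<phi>) \<le> C0 * (2 * \<epsilon>)"
      using \<epsilon> by (intro ubd[OF \<phi>]) auto
    \<comment> \<open>The values of \<open>u\<close> enter term by term through
      \<open>bound\<close>; the fineness \<open>\<delta>2\<close> keeps the Riemann sum of the
      majorant below \<open>?J + \<epsilon>\<close>.\<close>
    moreover have "cmod (u \<sigma>) \<le> B * (?J + \<epsilon>)"
    proof -
      have "cmod (u \<sigma>) \<le> (\<Sum>zk\<in>p. cmod (?c zk * u (?k zk)))"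
        unfolding \<sigma>(2) by (rule norm_sum)
      also have "\<dots> \<le> (\<Sum>zk\<in>p. B * (measure lborel (snd zk) *\<^sub>R ?E (fst zk)))"
      proof (rule sum_mono)
        fix zk assume "zk \<in> p"
        have "cmod (?c zk * u (?k zk)) = measure lborel (snd zk) * cmod (cross_coeff f g (fst zk) * u (?k zk))"
          by (simp add: norm_mult)
        also have "\<dots> \<le> measure lborel (snd zk) * (B * ?E (fst zk))"
          by (intro mult_left_mono bound) simp
        finally show "cmod (?c zk * u (?k zk)) \<le> B * (measure lborel (snd zk) *\<^sub>R ?E (fst zk))"
          by (simp add: mult_ac)
      qed
      also have "\<dots> = B * (\<Sum>(z, k)\<in>p. measure lborel k *\<^sub>R ?E z)"
        by (simp add: sum_distrib_left split_def)
      also have "(\<Sum>(z, k)\<in>p. measure lborel k *\<^sub>R ?E z) \<le> ?J + \<epsilon>"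
      proof -
        have "norm ((\<Sum>(z, k)\<in>p. measure lborel k *\<^sub>R ?E z) - integral (cbox a b) ?E) \<le> \<epsilon>' * measure lborel (cbox a b)"
          using near \<delta>2(2) \<epsilon>' contE by (intro riemann_sum_error[OF p]) (auto intro: continuous_on_subset)
        then show ?thesis using \<epsilon>'(2) KE(1) by (simp add: K abs_le_iff)
      qed
      finally show ?thesis using B by (simp add: mult_left_mono)
    qed
    moreover have "?M * cmod (u f) = cmod (u \<phi> + u \<sigma>)"
    proof -
      have "u \<phi> + u \<sigma> = of_real ?M * u f" unfolding u\<phi> by simp
      then show ?thesis using M by (simp only: norm_mult norm_of_real abs_of_nonneg)
    qed
    ultimately show ?thesis
      using norm_triangle_ineq[of "u \<phi>" "u \<sigma>"] by linarith
  qed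
  have "?M * cmod (u f) \<le> B * ?J + \<epsilon>" if "0 < \<epsilon>" for \<epsilon>
  proof -
    define \<epsilon>1 where "\<epsilon>1 = \<epsilon> / (2 * C0 + B)"
    have d: "0 < 2 * C0 + B" using hr B by simp
    then have "C0 * (2 * \<epsilon>1) + B * (?J + \<epsilon>1) = B * ?J + \<epsilon>1 * (2 * C0 + B)"
      by (simp add: algebra_simps)
    also have "\<epsilon>1 * (2 * C0 + B) = \<epsilon>" using d by (simp add: \<epsilon>1_def)
    finally show ?thesis using main[of \<epsilon>1] d that by (simp add: \<epsilon>1_def)
  qed
  then show ?thesis by (rule field_le_epsilon)
qed

text \<open>A nonzero continuous function is nonzero on a nonempty open set, which is not
  negligible. This permits division by the constant of the reconstruction formula.\<close>

lemma integral_norm_square_pos: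
  fixes g :: "real ^ 'd \<Rightarrow> complex"
  assumes g: "g \<in> gelfand_shilov t s" and t: "0 < t" and nz: "g \<noteq> (\<lambda>_. 0)"
  shows "0 < (\<integral>x. (cmod (g x))\<^sup>2 \<partial>lborel)"
proof -
  have cont: "continuous_on UNIV g" by (rule smooth_continuous[OF gelfand_shilov_smooth[OF g]])
  obtain B where B: "0 < B" "\<And>x. cmod (g x) \<le> B" using gelfand_shilov_bounded[OF g t] by metis
  have int: "integrable lborel (\<lambda>x. (cmod (g x))\<^sup>2)"
  proof (rule Bochner_Integration.integrable_bound)
    show "integrable lborel (\<lambda>x. B * cmod (g x))"
      by (intro integrable_mult_right integrable_norm gelfand_shilov_integrable[OF g t])
    show "(\<lambda>x. (cmod (g x))\<^sup>2) \<in> borel_measurable lborel"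
      using cont by (auto intro!: borel_measurable_continuous_onI continuous_intros)
    show "AE x in lborel. norm ((cmod (g x))\<^sup>2) \<le> norm (B * cmod (g x))"
      using B by (auto simp: power2_eq_square abs_mult intro!: mult_right_mono)
  qed
  have "(\<integral>x. (cmod (g x))\<^sup>2 \<partial>lborel) \<noteq> 0"
  proof
    assume "(\<integral>x. (cmod (g x))\<^sup>2 \<partial>lborel) = 0"
    then have "AE x in lborel. (cmod (g x))\<^sup>2 = 0"
      using integral_nonneg_eq_0_iff_AE[OF int] by simp
    then have ae: "AE x in lborel. g x = 0" by simp
    have "open {x. g x \<noteq> 0}"
    proof -
      have "open (g -` (- {0}))"
        using cont by (intro open_vimage) auto
      then show ?thesis by (simp add: vimage_def)
    qed
    moreover have "{x. g x \<noteq> 0} \<noteq> {}" using nz by auto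
    moreover have "negligible {x. g x \<noteq> 0}"
    proof -
      have "{x \<in> space lborel. \<not> g x = 0} \<in> null_sets lborel"
        using ae \<open>open {x. g x \<noteq> 0}\<close> by (subst (asm) AE_iff_null) auto
      then show ?thesis
        by (simp add: negligible_iff_null_sets null_sets_completionI)
    qed
    ultimately show False using open_not_negligible by blast
  qed
  moreover have "0 \<le> (\<integral>x. (cmod (g x))\<^sup>2 \<partial>lborel)" by (rule integral_nonneg_AE) auto
  ultimately show ?thesis by linarith
qed

lemma phase_weight_add:
  assumes "0 < t" "0 < s"
  shows "phase_weight t s (z + z') \<le>
    (2 powr (1 / t) + 2 powr (1 / s)) * (phase_weight t s z + phase_weight t s z')"
proof -
  let ?w = "weight t (fst z) + weight t (fst z')" and ?v = "weight s (snd z) + weight s (snd z')"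
  have "phase_weight t s (z + z') \<le> 2 powr (1 / t) * ?w + 2 powr (1 / s) * ?v"
    using weight_add[OF assms(1), of "fst z" "fst z'"] weight_add[OF assms(2), of "snd z" "snd z'"]
    by (simp add: phase_weight_def)
  also have "\<dots> \<le> (2 powr (1 / t) + 2 powr (1 / s)) * ?w + (2 powr (1 / t) + 2 powr (1 / s)) * ?v"
    by (intro add_mono mult_right_mono) auto
  finally show ?thesis by (simp add: phase_weight_def algebra_simps)
qed

text \<open>Homogeneity of degree 1 explains the powers \<open>t\<close> and \<open>s\<close> of the
  dilation: \<open>phase_weight\<close> of a dilated point is \<open>l\<close> times its original
  value.\<close>

lemma weight_scale: "0 < t \<Longrightarrow> 0 < l \<Longrightarrow> weight t (l powr t *\<^sub>R x) = l * weight t x"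
  by (simp add: weight_def powr_mult powr_powr)

lemma SUP_ennreal_finite_iff:
  assumes "\<And>x. x \<in> A \<Longrightarrow> 0 \<le> f x"
  shows "(SUP x\<in>A. ennreal (f x)) < \<infinity> \<longleftrightarrow> (\<exists>C. \<forall>x\<in>A. f x \<le> C)"
proof
  assume fin: "(SUP x\<in>A. ennreal (f x)) < \<infinity>"
  define C where "C = enn2real (SUP x\<in>A. ennreal (f x))"
  have C: "(SUP x\<in>A. ennreal (f x)) = ennreal C" "0 \<le> C" using fin by (auto simp: C_def)
  have "f x \<le> C" if "x \<in> A" for x
    using SUP_upper[OF that, of "\<lambda>x. ennreal (f x)"] C by simp
  then show "\<exists>C. \<forall>x\<in>A. f x \<le> C" by blast
next
  assume "\<exists>C. \<forall>x\<in>A. f x \<le> C"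
  then obtain C where "\<And>x. x \<in> A \<Longrightarrow> f x \<le> C" by blast
  then have "(SUP x\<in>A. ennreal (f x)) \<le> ennreal C"
    by (intro SUP_least ennreal_leI) auto
  then show "(SUP x\<in>A. ennreal (f x)) < \<infinity>" using ennreal_less_top le_less_trans by fastforce
qed

text \<open>
  Near \<open>z\<close> the decay comes from the hypothesis on \<open>u\<close>; at distance comparable to \<open>l\<close> in the
  anisotropic weight it comes from \<open>cross_coeff\<close>, whose decay rate is chosen to beat the growth of \<open>u\<close>.
\<close>

lemma microlocal_window_change:
  fixes u :: "(real ^ 'd \<Rightarrow> complex) \<Rightarrow> complex" and f g :: "real ^ 'd \<Rightarrow> complex"
    and x0 \<xi>0 :: "real ^ 'd"
  assumes pos: "0 < t" "0 < s" and u: "gs_functional t s u"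
    and f: "f \<in> gelfand_shilov t s" and g: "g \<in> gelfand_shilov t s" and nz: "g \<noteq> (\<lambda>_. 0)"
    and e: "0 < e" and r: "0 < r"
    and near: "\<And>l x \<xi>. 0 < l \<Longrightarrow> (x, \<xi>) \<in> ball (x0, \<xi>0) e \<Longrightarrow>
      cmod (u (phase_shift (l powr t *\<^sub>R x, l powr s *\<^sub>R \<xi>) g)) \<le> C1 * exp (- r * l)"
  obtains C where "\<And>l x \<xi>. 0 < l \<Longrightarrow> (x, \<xi>) \<in> ball (x0, \<xi>0) (e / 2) \<Longrightarrow>
      cmod (u (phase_shift (l powr t *\<^sub>R x, l powr s *\<^sub>R \<xi>) f)) \<le> C * exp (- r * l)"
proof -
  let ?W = "phase_weight t s :: (real ^ 'd) \<times> (real ^ 'd) \<Rightarrow> real"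
  define M where "M = (2 * pi) ^ CARD('d) * (\<integral>x. (cmod (g x))\<^sup>2 \<partial>lborel)"
  have M: "0 < M" using integral_norm_square_pos[OF g pos(1) nz] by (simp add: M_def)
  define J where "J = (\<integral>z. exp (- 1 * ?W z) \<partial>lborel)"
  define c where "c = 2 powr (1 / t) + 2 powr (1 / s)"
  have c: "0 < c" by (simp add: c_def add_pos_pos)
  \<comment> \<open>Bounds the phase weight on the ball, hence that of the dilated point
    \<open>z0\<close> by \<open>l * w\<close>.\<close>
  define w where "w = (norm (x0, \<xi>0) + e) powr (1 / t) + (norm (x0, \<xi>0) + e) powr (1 / s)"
  have w: "0 \<le> w" by (simp add: w_def)
  \<comment> \<open>By homogeneity, leaving the dilated box of half-widths \<open>e / 4\<close>
    forces \<open>?W z\<close> to be at least \<open>\<kappa> * l\<close>.\<close>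
  define \<kappa> where "\<kappa> = min ((e / 4) powr (1 / t)) ((e / 4) powr (1 / s))"
  have \<kappa>: "0 < \<kappa>" using e by (simp add: \<kappa>_def)
  obtain Cg R where Cg: "0 < Cg" "0 < R" "\<And>z. cmod (u (phase_shift z g)) \<le> Cg * exp (R * ?W z)"
    by (rule gs_functional_phase_shift_growth[OF u pos g], rule that)
  \<comment> \<open>Chosen so that \<open>q * \<kappa> = r + R * c * w\<close>: far out,
    \<open>q * ?W z\<close> pays for the wanted decay and for the growth of \<open>u\<close> at
    \<open>z0\<close>. In \<open>\<rho>\<close>, the term \<open>R * c\<close> pays for the growth
    in \<open>z\<close> and 1 for integrability.\<close>
  define q where "q = (r + R * c * w) / \<kappa>"
  have q: "0 \<le> q" using Cg c w \<kappa> r by (simp add: q_def)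
  define \<rho> where "\<rho> = 1 + R * c + q"
  have \<rho>: "1 \<le> \<rho>"
    using Cg c q by (simp add: \<rho>_def)
  then have \<rho>0: "0 < \<rho>" by simp
  obtain CA where CA: "0 < CA" "\<And>z. cmod (cross_coeff f g z) \<le> CA * exp (- \<rho> * ?W z)"
    by (rule cross_coeff_decay[OF f g pos \<rho>0], rule that)
  have C1: "0 \<le> C1"
    using order_trans[OF norm_ge_zero near[of 1 x0 \<xi>0]] e by (simp add: zero_le_mult_iff)
  have "cmod (u (phase_shift (l powr t *\<^sub>R x, l powr s *\<^sub>R \<xi>) f)) \<le> (CA * (C1 + Cg) * J / M) * exp (- r * l)"
    if l: "0 < l" and x\<xi>: "(x, \<xi>) \<in> ball (x0, \<xi>0) (e / 2)" for l x \<xi>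
  proof -
    define z0 where "z0 = (l powr t *\<^sub>R x, l powr s *\<^sub>R \<xi>)"
    have Wz0: "?W z0 \<le> l * w"
    proof -
      have "norm (x, \<xi>) \<le> norm (x0, \<xi>0) + norm ((x, \<xi>) - (x0, \<xi>0))"
        by (rule norm_triangle_sub)
      also have "norm ((x, \<xi>) - (x0, \<xi>0)) = dist (x0, \<xi>0) (x, \<xi>)"
        by (metis dist_norm dist_commute)
      finally have n: "norm (x, \<xi>) \<le> norm (x0, \<xi>0) + e" using x\<xi> e by simp
      have "norm x \<le> norm (x0, \<xi>0) + e" "norm \<xi> \<le> norm (x0, \<xi>0) + e"
        using norm_fst_le[of x \<xi>] norm_snd_le[of \<xi> x] n by auto
      then have "weight t x + weight s \<xi> \<le> w"
        unfolding w_def weight_def using pos by (intro add_mono powr_mono2) auto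
      then have "l * (weight t x + weight s \<xi>) \<le> l * w" using l by (intro mult_left_mono) auto
      then show ?thesis using l pos by (simp add: phase_weight_def z0_def weight_scale distrib_left)
    qed
    have key: "cmod (cross_coeff f g z * u (phase_shift (z0 + z) g)) \<le>
        (CA * (C1 + Cg) * exp (- r * l)) * exp (- 1 * ?W z)" for z
    proof (cases "norm (fst z) < e / 4 * l powr t \<and> norm (snd z) < e / 4 * l powr s")
      case True
      \<comment> \<open>After scaling back, \<open>z\<close> moves \<open>(x, \<xi>)\<close> by less
        than \<open>e / 4 + e / 4\<close>, so the point stays in the ball of radius
        \<open>e\<close>.\<close>
      let ?y = "(1 / l powr t) *\<^sub>R fst z" and ?\<eta> = "(1 / l powr s) *\<^sub>R snd z"
      have lp: "0 < l powr t" "0 < l powr s" using l by auto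
      have "norm ?y < e / 4" "norm ?\<eta> < e / 4" using True lp by (auto simp: divide_simps mult.commute)
      then have "norm (?y, ?\<eta>) < e / 2" using norm_Pair_le[of ?y ?\<eta>] by linarith
      moreover have "dist (x, \<xi>) (x + ?y, \<xi> + ?\<eta>) = norm (?y, ?\<eta>)"
        by (simp add: dist_Pair_Pair norm_Pair dist_norm)
      ultimately have "(x + ?y, \<xi> + ?\<eta>) \<in> ball (x0, \<xi>0) e"
        using x\<xi> dist_triangle[of "(x0, \<xi>0)" "(x + ?y, \<xi> + ?\<eta>)" "(x, \<xi>)"] by simp
      moreover have "z0 + z = (l powr t *\<^sub>R (x + ?y), l powr s *\<^sub>R (\<xi> + ?\<eta>))"
        using lp by (simp add: z0_def scaleR_right_distrib prod_eq_iff)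
      ultimately have "cmod (u (phase_shift (z0 + z) g)) \<le> C1 * exp (- r * l)"
        using near[OF l] by simp
      moreover have "cmod (cross_coeff f g z) \<le> CA * exp (- 1 * ?W z)"
      proof -
        have "\<rho> * ?W z \<ge> 1 * ?W z" using \<rho> by (intro mult_right_mono) auto
        then have "CA * exp (- \<rho> * ?W z) \<le> CA * exp (- 1 * ?W z)" using CA by simp
        then show ?thesis using CA(2)[of z] by linarith
      qed
      ultimately have "cmod (cross_coeff f g z * u (phase_shift (z0 + z) g)) \<le>
          (CA * exp (- 1 * ?W z)) * (C1 * exp (- r * l))"
        unfolding norm_mult using CA by (intro mult_mono) auto
      also have "\<dots> = (CA * C1 * exp (- r * l)) * exp (- 1 * ?W z)" by (simp only: mult_ac)
      also have "\<dots> \<le> (CA * (C1 + Cg) * exp (- r * l)) * exp (- 1 * ?W z)"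
        using CA Cg by (intro mult_right_mono mult_left_mono) auto
      finally show ?thesis .
    next
      case False
      have far: "\<kappa> * l \<le> ?W z"
      proof -
        have *: "\<kappa> * l \<le> weight a v" if "0 < a" "e / 4 * l powr a \<le> norm v" "\<kappa> \<le> (e / 4) powr (1 / a)"
          for a and v :: "real ^ 'd"
        proof -
          have "\<kappa> * l \<le> (e / 4) powr (1 / a) * l" using that l by (intro mult_right_mono) auto
          also have "\<dots> = (e / 4 * l powr a) powr (1 / a)"
            unfolding powr_mult using that l by (simp add: powr_powr)
          also have "\<dots> \<le> weight a v" unfolding weight_def using that e by (intro powr_mono2) auto
          finally show ?thesis .
        qed
        show ?thesis
          using False *[OF pos(1), of "fst z"] *[OF pos(2), of "snd z"]
            weight_nonneg[of t "fst z"] weight_nonneg[of s "snd z"]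
          by (auto simp: phase_weight_def \<kappa>_def not_less simp del: weight_nonneg)
      qed
      have "R * ?W (z0 + z) \<le> R * (c * (l * w + ?W z))"
        using phase_weight_add[OF pos, of z0 z] Wz0 Cg c
        by (intro mult_left_mono order_trans[OF phase_weight_add[OF pos, of z0 z, folded c_def]]) auto
      moreover have "r * l + R * c * w * l \<le> q * ?W z"
      proof -
        have "r * l + R * c * w * l = q * (\<kappa> * l)"
          using \<kappa> by (simp add: q_def algebra_simps add_divide_distrib)
        also have "\<dots> \<le> q * ?W z" using far q by (rule mult_left_mono)
        finally show ?thesis .
      qed
      ultimately have "- \<rho> * ?W z + R * ?W (z0 + z) \<le> - r * l + - 1 * ?W z"
        by (simp add: \<rho>_def algebra_simps)
      then have ex: "exp (- \<rho> * ?W z) * exp (R * ?W (z0 + z)) \<le> exp (- r * l) * exp (- 1 * ?W z)"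
        unfolding exp_add[symmetric] by simp
      have "cmod (cross_coeff f g z * u (phase_shift (z0 + z) g)) \<le>
          (CA * exp (- \<rho> * ?W z)) * (Cg * exp (R * ?W (z0 + z)))"
        unfolding norm_mult using CA Cg by (intro mult_mono) auto
      also have "\<dots> = (CA * Cg) * (exp (- \<rho> * ?W z) * exp (R * ?W (z0 + z)))" by (simp only: mult_ac)
      also have "\<dots> \<le> (CA * Cg) * (exp (- r * l) * exp (- 1 * ?W z))"
        using CA Cg ex by (intro mult_left_mono) auto
      also have "\<dots> = (CA * Cg * exp (- r * l)) * exp (- 1 * ?W z)" by (simp only: mult_ac)
      also have "\<dots> \<le> (CA * (C1 + Cg) * exp (- r * l)) * exp (- 1 * ?W z)"
        using CA C1 by (intro mult_right_mono mult_left_mono) auto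
      finally show ?thesis .
    qed
    have hom: "u (phase_shift z0 (phase_shift z g)) = character (snd z) (fst z0) * u (phase_shift (z0 + z) g)" for z
      unfolding phase_shift_phase_shift
      by (rule gs_functional_cmult[OF u gelfand_shilov_phase_shift[OF g pos]])
    \<comment> \<open>The estimate is applied to the functional shifted by \<open>z0\<close>, so
      \<open>f\<close> and \<open>g\<close> stay fixed and the integral runs over displacements from
      \<open>z0\<close>.\<close>
    have "M * cmod (u (phase_shift z0 f)) \<le> (CA * (C1 + Cg) * exp (- r * l)) * J"
      unfolding M_def J_def
    proof (rule gs_functional_cross_coeff_bound[OF gs_functional_phase_shift[OF u pos, of z0] f g pos])
      show "0 \<le> CA * (C1 + Cg) * exp (- r * l)" using CA C1 Cg by simp
      show "cmod (cross_coeff f g z * u (phase_shift z0 (phase_shift z g))) \<le>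
          (CA * (C1 + Cg) * exp (- r * l)) * exp (- 1 * ?W z)" for z
        using key[of z] by (simp add: hom norm_mult)
    qed
    then show ?thesis using M by (simp add: z0_def field_simps)
  qed
  then show ?thesis by (rule that)
qed

theorem proposition3p5:
  fixes s t :: real
    and u :: "(real ^ 'd \<Rightarrow> complex) \<Rightarrow> complex"
    and z0 :: "(real ^ 'd) \<times> (real ^ 'd)"
    and \<psi> \<phi> :: "real ^ 'd \<Rightarrow> complex"
    and U :: "((real ^ 'd) \<times> (real ^ 'd)) set"
  assumes "s > 0" and "t > 0" and "s + t > 1"
    and "u \<in> gs_dual t s"
    and "z0 \<noteq> 0"
    and "\<psi> \<in> gelfand_shilov t s" and "\<psi> \<noteq> (\<lambda>_. 0)"
    and "open U" and "U \<subseteq> UNIV - {0}" and "z0 \<in> U"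
    and "\<forall>r>0. (SUP (l, x, \<xi>) \<in> {0<..} \<times> U.
           ennreal (exp (r * l) * cmod (stft \<psi> u (l powr t *\<^sub>R x, l powr s *\<^sub>R \<xi>)))) < \<infinity>"
    and "\<phi> \<in> gelfand_shilov t s" and "\<phi> \<noteq> (\<lambda>_. 0)"
  shows "\<exists>V. open V \<and> V \<subseteq> U \<and> z0 \<in> V \<and>
           (\<forall>r>0. (SUP (l, x, \<xi>) \<in> {0<..} \<times> V.
             ennreal (exp (r * l) * cmod (stft \<phi> u (l powr t *\<^sub>R x, l powr s *\<^sub>R \<xi>)))) < \<infinity>)"
proof -
  note pos = assms(2,1)
  define K where "K = (2 * pi) powr (- (real CARD('d) / 2))"
  have K: "0 < K" by (simp add: K_def)
  have stft: "cmod (stft \<theta> u (x, \<xi>)) = K * cmod (u (phase_shift (x, \<xi>) (\<lambda>y. cnj (\<theta> y))))" for \<theta> x \<xi>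
    by (simp add: stft_eq_phase_shift norm_mult K_def)
  have finite_iff: "(SUP (l, x, \<xi>) \<in> {0<..} \<times> S.
        ennreal (exp (r * l) * cmod (stft \<theta> u (l powr t *\<^sub>R x, l powr s *\<^sub>R \<xi>)))) < \<infinity> \<longleftrightarrow>
      (\<exists>C. \<forall>l x \<xi>. 0 < l \<longrightarrow> (x, \<xi>) \<in> S \<longrightarrow>
        exp (r * l) * (K * cmod (u (phase_shift (l powr t *\<^sub>R x, l powr s *\<^sub>R \<xi>) (\<lambda>y. cnj (\<theta> y))))) \<le> C)"
    for S \<theta> r
  proof -
    let ?q = "\<lambda>(l, x, \<xi>). exp (r * l) * cmod (stft \<theta> u (l powr t *\<^sub>R x, l powr s *\<^sub>R \<xi>))"
    have "(SUP p \<in> {0<..} \<times> S. ennreal (?q p)) < \<infinity> \<longleftrightarrow> (\<exists>C. \<forall>p\<in>{0<..} \<times> S. ?q p \<le> C)"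
      by (rule SUP_ennreal_finite_iff) auto
    moreover have "(\<forall>p\<in>{0<..} \<times> S. ?q p \<le> C) \<longleftrightarrow> (\<forall>l x \<xi>. 0 < l \<longrightarrow> (x, \<xi>) \<in> S \<longrightarrow>
        exp (r * l) * (K * cmod (u (phase_shift (l powr t *\<^sub>R x, l powr s *\<^sub>R \<xi>) (\<lambda>y. cnj (\<theta> y))))) \<le> C)" for C
      by (auto simp: stft)
    moreover have "(\<lambda>(l, x, \<xi>). ennreal (exp (r * l) * cmod (stft \<theta> u (l powr t *\<^sub>R x, l powr s *\<^sub>R \<xi>)))) =
        (\<lambda>p. ennreal (?q p))"
      by (auto simp: fun_eq_iff)
    ultimately show ?thesis by simp
  qed
  have u: "gs_functional t s u" by (rule gs_dual_functional[OF assms(4) pos(1)])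
  let ?f = "\<lambda>y. cnj (\<phi> y)" and ?g = "\<lambda>y. cnj (\<psi> y)"
  have f: "?f \<in> gelfand_shilov t s" and g: "?g \<in> gelfand_shilov t s"
    using assms by (auto intro: gelfand_shilov_cnj)
  have nz: "?g \<noteq> (\<lambda>_. 0)" using assms(7) by (auto simp: fun_eq_iff)
  \<comment> \<open>The radius is fixed before \<open>r\<close>, so one ball
    \<open>ball z0 (e / 2)\<close> serves every \<open>r\<close>.\<close>
  obtain e where e: "0 < e" "ball z0 e \<subseteq> U"
    using \<open>open U\<close> \<open>z0 \<in> U\<close> open_contains_ball by blast
  have decay: "\<exists>C. \<forall>l x \<xi>. 0 < l \<longrightarrow> (x, \<xi>) \<in> ball z0 (e / 2) \<longrightarrow>
      exp (r * l) * (K * cmod (u (phase_shift (l powr t *\<^sub>R x, l powr s *\<^sub>R \<xi>) ?f))) \<le> C" if r: "0 < r" for r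
  proof -
    obtain C where C: "\<And>l x \<xi>. 0 < l \<Longrightarrow> (x, \<xi>) \<in> U \<Longrightarrow>
        exp (r * l) * (K * cmod (u (phase_shift (l powr t *\<^sub>R x, l powr s *\<^sub>R \<xi>) ?g))) \<le> C"
      using assms(11) r unfolding finite_iff by blast
    have "cmod (u (phase_shift (l powr t *\<^sub>R x, l powr s *\<^sub>R \<xi>) ?g)) \<le> (C / K) * exp (- r * l)"
      if "0 < l" "(x, \<xi>) \<in> ball (fst z0, snd z0) e" for l x \<xi>
      using C[OF that(1), of x \<xi>] that(2) e(2) K by (auto simp: exp_minus field_simps)
    from microlocal_window_change[OF pos u f g nz e(1) r this]
    obtain D where D: "\<And>l x \<xi>. 0 < l \<Longrightarrow> (x, \<xi>) \<in> ball (fst z0, snd z0) (e / 2) \<Longrightarrow>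
        cmod (u (phase_shift (l powr t *\<^sub>R x, l powr s *\<^sub>R \<xi>) ?f)) \<le> D * exp (- r * l)"
      by blast
    have "exp (r * l) * (K * cmod (u (phase_shift (l powr t *\<^sub>R x, l powr s *\<^sub>R \<xi>) ?f))) \<le> K * D"
      if "0 < l" "(x, \<xi>) \<in> ball z0 (e / 2)" for l x \<xi>
      using D[OF that(1), of x \<xi>] that(2) K by (simp add: exp_minus field_simps)
    then show ?thesis by blast
  qed
  have "ball z0 (e / 2) \<subseteq> U" using e by (auto simp: subset_iff)
  moreover have "z0 \<in> ball z0 (e / 2)" using e by simp
  ultimately show ?thesis
    unfolding finite_iff using decay by blast
qed

end
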